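(* For every constant $C_0\ge1$ there is a polynomial $p$ (depending only on $C_0$) such that for every $n\ge2$, every $Q'$-norm $l':\mathbb{R}^n\to\mathbb{R}$ and every $0<\epsilon\le1/2$, there is a one-pass turnstile streaming algorithm that, on an input stream defining a vector $v\in\mathbb{Z}^n$ with $|v_i|\le n^{C_0}$ for all $i$, outputs with probability at least $0.99$ a $(1+\epsilon)$-approximation to $l'(v)$, and uses at most $p(\log(n)/\epsilon)$ bits of space.
   Context: A norm $l:\mathbb{R}^n\to\mathbb{R}$ is symmetric if it is invariant under coordinate permutations and sign flips of coordinates. A norm $l:\mathbb{R}^n\to\mathbb{R}$ is a $Q$-norm if there is a symmetric norm $\Phi:\mathbb{R}^n\to\mathbb{R}$ such that $l(x)=\Phi(x^2)^{1/2}$ for all $x\in\mathbb{R}^n$, where $x^2=(x_1^2,\dots,x_n^2)$. A norm $l'$ on $\mathbb{R}^n$ is a $Q'$-norm if its dual norm $l(x)=\sup\{\langle x,y\rangle/l'(y):y\ne0\}$ is a $Q$-norm. Turnstile streaming model: the stream is a sequence of updates $(i,\pm1)$, $i\in[n]$; each update adds $\pm1$ to coordinate $i$ of a vector $v$ that starts at $0$, and the algorithm must output an answer about the final $v$. Coordinates of $v$ are assumed bounded in absolute value by $\mathrm{poly}(n)$. The algorithm is randomized, reads the stream once, and its space is the number of bits of working memory. The algorithm has access to an oracle that computes the norm of a vector $w\in\mathbb{R}^n$ using queries to the coordinates of $w$, which the algorithm must be able to answer (the oracle's own storage is not counted). For $D\ge1$, a $D$-approximation to $l'(v)$ is a value $\hat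 l$ with $l'(v)\le\hat l\le D\,l'(v)$. *)

theory Defs
  imports
    "HOL-Probability.Probability"
    "HOL-Combinatorics.Permutations"
    "HOL-Computational_Algebra.Polynomial"
begin

section \<open>Norms on \<open>n\<close>-dimensional real space\<close>

text \<open>
  The dimension has to be quantified inside a formula, so it cannot be a type. Vectors are functions
  on the index set \<open>{..<n}\<close> (the coordinates are numbered from 0), extended by 0 so that equality of
  vectors is equality of functions. A norm is only constrained on this carrier.
\<close>

definition Rn :: "nat \<Rightarrow> (nat \<Rightarrow> real) set" where
  "Rn n = {x. \<forall>i\<ge>n. x i = 0}"

definition is_norm :: "nat \<Rightarrow> ((nat \<Rightarrow> real) \<Rightarrow> real) \<Rightarrow> bool" where
  "is_norm n l \<longleftrightarrow>
     (\<forall>x\<in>Rn n. 0 \<le> l x) \<and>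
     (\<forall>x\<in>Rn n. l x = 0 \<longleftrightarrow> x = (\<lambda>_. 0)) \<and>
     (\<forall>x\<in>Rn n. \<forall>c. l (\<lambda>i. c * x i) = \<bar>c\<bar> * l x) \<and>
     (\<forall>x\<in>Rn n. \<forall>y\<in>Rn n. l (\<lambda>i. x i + y i) \<le> l x + l y)"

definition symmetric_norm :: "nat \<Rightarrow> ((nat \<Rightarrow> real) \<Rightarrow> real) \<Rightarrow> bool" where
  "symmetric_norm n l \<longleftrightarrow>
     is_norm n l \<and>
     (\<forall>x\<in>Rn n. \<forall>\<pi>. \<pi> permutes {..<n} \<longrightarrow> l (x \<circ> \<pi>) = l x) \<and>
     (\<forall>x\<in>Rn n. \<forall>\<sigma>. (\<forall>i. \<sigma> i \<in> {-1, 1}) \<longrightarrow> l (\<lambda>i. \<sigma> i * x i) = l x)"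

definition Q_norm :: "nat \<Rightarrow> ((nat \<Rightarrow> real) \<Rightarrow> real) \<Rightarrow> bool" where
  "Q_norm n l \<longleftrightarrow>
     is_norm n l \<and>
     (\<exists>\<Phi>. symmetric_norm n \<Phi> \<and> (\<forall>x\<in>Rn n. l x = sqrt (\<Phi> (\<lambda>i. (x i)\<^sup>2))))"

definition dual_norm :: "nat \<Rightarrow> ((nat \<Rightarrow> real) \<Rightarrow> real) \<Rightarrow> (nat \<Rightarrow> real) \<Rightarrow> real" where
  "dual_norm n l x = (SUP y \<in> Rn n - {\<lambda>_. 0}. (\<Sum>i<n. x i * y i) / l y)"

definition Q'_norm :: "nat \<Rightarrow> ((nat \<Rightarrow> real) \<Rightarrow> real) \<Rightarrow> bool" where
  "Q'_norm n l \<longleftrightarrow> is_norm n l \<and> Q_norm n (dual_norm n l)"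


section \<open>Turnstile streams and one-pass streaming algorithms\<close>

definition turnstile_stream :: "nat \<Rightarrow> (nat \<times> int) list \<Rightarrow> bool" where
  "turnstile_stream n us \<longleftrightarrow> set us \<subseteq> {..<n} \<times> {-1, 1}"

definition stream_vec :: "(nat \<times> int) list \<Rightarrow> nat \<Rightarrow> int" where
  "stream_vec us i = (\<Sum>(j, d)\<leftarrow>us. if j = i then d else 0)"

text \<open>
  The working memory is a bit string. It is the only thing carried from one update to the next:
  every random choice made by \<open>alg_update\<close> is fresh, so random bits that are to be reused must be
  stored, and are counted. When the stream has ended, \<open>alg_query\<close> is the vector handed to the norm
  oracle; the memory contents determine all its coordinates, so the algorithm can answer the
  oracle's coordinate queries. \<open>alg_output\<close> gets the memory contents and the oracle's answer.
  The model is non-uniform: the maps are arbitrary, and the size of the memory is the only resource.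
\<close>

record streaming_alg =
  alg_init :: "bool list pmf"
  alg_update :: "nat \<times> int \<Rightarrow> bool list \<Rightarrow> bool list pmf"
  alg_query :: "bool list \<Rightarrow> nat \<Rightarrow> real"
  alg_output :: "bool list \<Rightarrow> real \<Rightarrow> real pmf"

text \<open>Algorithms for vectors of dimension \<open>n\<close> whose working memory consists of \<open>s\<close> bits:\<close>

definition space_bounded :: "nat \<Rightarrow> nat \<Rightarrow> streaming_alg \<Rightarrow> bool" where
  "space_bounded n s A \<longleftrightarrow>
     (\<forall>m \<in> set_pmf (alg_init A). length m = s) \<and>
     (\<forall>u \<in> {..<n} \<times> {-1, 1}. \<forall>m. length m = s \<longrightarrow>
        (\<forall>m' \<in> set_pmf (alg_update A u m). length m' = s)) \<and>
     (\<forall>m. length m = s \<longrightarrow> alg_query A m \<in> Rn n)"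

definition final_memory :: "streaming_alg \<Rightarrow> (nat \<times> int) list \<Rightarrow> bool list pmf" where
  "final_memory A us = foldl (\<lambda>M u. bind_pmf M (alg_update A u)) (alg_init A) us"

definition run_alg ::
    "streaming_alg \<Rightarrow> ((nat \<Rightarrow> real) \<Rightarrow> real) \<Rightarrow> (nat \<times> int) list \<Rightarrow> real pmf" where
  "run_alg A orc us =
     bind_pmf (final_memory A us) (\<lambda>m. alg_output A m (orc (alg_query A m)))"

definition is_D_approx :: "real \<Rightarrow> real \<Rightarrow> real \<Rightarrow> bool" where
  "is_D_approx D t z \<longleftrightarrow> t \<le> z \<and> z \<le> D * t"

end

(*
  With x^2 denoting the coordinatewise square, a Q'-norm l' is monotone in the truncated sums of its
  argument: if sum_i min(a_i^2, T) <= kappa * sum_i min(b_i^2, T) for all T >= 0, then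
  l'(a) <= kappa * l'(b). The reason is that l'(b)^2 is the minimum of sum_i b_i^2 / w_i over the
  weights w dominated by the symmetric norm Phi, and a minimising w for b, stretched by the factor
  kappa, is an admissible competitor for a.

  So it suffices to learn all truncated sums up to a factor 1 + O(eps). Let Z = sum_i c_i v_i, where
  the c_i are independent, equal to 0 with probability 1 - p and to a random sign otherwise. For a
  smoothed truncation h, the expectation of h(Z / t) is p S - O((p S)^2 / eps) with
  S = sum_i h(v_i / t) whenever p S is small. Hence polylogarithmically many independent copies of Z,
  for p and t in geometric progressions, determine the truncated sums. The norm oracle is queried at
  any integer vector whose expectations agree with the observed averages.
*)

theory Submission
  imports Defs
begin

section \<open>Supporting functionals and dual norms\<close>

text \<open>The corner of the plain truncation is the reason for smoothing. For
  \<open>min (z\<^sup>2) 1\<close> the average of the values at \<open>1 + y\<close> and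
  \<open>1 - y\<close> falls short of 1 by about \<open>\<bar>y\<bar>\<close>, while only a loss of
  order \<open>y\<^sup>2\<close> is affordable; rounding the corner over a window of width
  \<open>\<eta>\<close> makes the loss of order \<open>y\<^sup>2 / \<eta>\<close>. No single
  sampling rate works: the bias is quadratic in \<open>p * S\<close> while the statistical error is
  additive, so \<open>p * S\<close> may be neither large nor tiny. Two obstacles come from the
  model. A sign must be the same at every update of its coordinate, and storing all signs is too
  expensive; a union bound over all admissible final vectors yields a fixed list of seeds, and only
  the index of a seed is kept. Intermediate vectors of a stream are unbounded, so counters are kept
  modulo a number large enough to recover their final values. With a good seed \<open>v\<close>
  itself agrees with the observed averages, so it can be compared in both directions with whichever
  agreeing vector is queried. This is why the factor \<open>\<kappa>\<close> occurs squared in the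
  end.\<close>

definition dot :: "nat \<Rightarrow> (nat \<Rightarrow> real) \<Rightarrow> (nat \<Rightarrow> real) \<Rightarrow> real" where
  "dot n x y = (\<Sum>i<n. x i * y i)"

definition axis_vec :: "nat \<Rightarrow> nat \<Rightarrow> real" where
  "axis_vec k = (\<lambda>i. if i = k then 1 else 0)"

lemma axis_vec_Rn: "k < n \<Longrightarrow> axis_vec k \<in> Rn n"
  by (auto simp: axis_vec_def Rn_def)

lemma is_normD:
  assumes "is_norm n l"
  shows is_norm_nonneg: "x \<in> Rn n \<Longrightarrow> 0 \<le> l x"
    and is_norm_eq_0_iff: "x \<in> Rn n \<Longrightarrow> l x = 0 \<longleftrightarrow> x = (\<lambda>_. 0)"
    and is_norm_scale: "x \<in> Rn n \<Longrightarrow> l (\<lambda>i. c * x i) = \<bar>c\<bar> * l x"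
    and is_norm_triangle: "x \<in> Rn n \<Longrightarrow> y \<in> Rn n \<Longrightarrow> l (\<lambda>i. x i + y i) \<le> l x + l y"
  using assms unfolding is_norm_def by blast+

definition sublinear :: "((nat \<Rightarrow> real) \<Rightarrow> real) \<Rightarrow> bool" where
  "sublinear p \<longleftrightarrow> (\<forall>u v. p (\<lambda>i. u i + v i) \<le> p u + p v) \<and>
     (\<forall>c u. 0 \<le> c \<longrightarrow> p (\<lambda>i. c * u i) = c * p u)"

lemma sublinear_add: "sublinear p \<Longrightarrow> p (\<lambda>i. u i + v i) \<le> p u + p v"
  and sublinear_scale: "sublinear p \<Longrightarrow> 0 \<le> c \<Longrightarrow> p (\<lambda>i. c * u i) = c * p u"
  unfolding sublinear_def by blast+

lemma sublinear_zero: "sublinear p \<Longrightarrow> p (\<lambda>_. 0) = 0"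
  using sublinear_scale[of p 0 "\<lambda>_. 0"] by simp

lemma sublinear_uminus: "sublinear p \<Longrightarrow> - p (\<lambda>i. - u i) \<le> p u"
  using sublinear_add[of p u "\<lambda>i. - u i"] sublinear_zero[of p] by simp

lemma sublinear_sum:
  assumes p: "sublinear p" and "finite I"
  shows "p (\<lambda>i. \<Sum>k\<in>I. f k i) \<le> (\<Sum>k\<in>I. p (f k))"
  using assms(2)
proof (induction I rule: finite_induct)
  case (insert k I)
  then show ?case
    using sublinear_add[OF p, of "f k" "\<lambda>i. \<Sum>k\<in>I. f k i"] by simp
qed (simp add: sublinear_zero[OF p])

text \<open>The elementary step of the Hahn--Banach theorem: replacing \<open>p\<close> by
  \<open>inf\<^sub>s (p (v + s e) - s p e)\<close> makes it linear along \<open>e\<close>.\<close>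

lemma sublinear_linearise:
  assumes p: "sublinear p"
  obtains q where "sublinear q" "\<And>v. q v \<le> p v" "q (\<lambda>i. - e i) \<le> - p e"
proof -
  define g where "g v s = p (\<lambda>i. v i + s * e i) - s * p e" for v s
  define q where "q v = (INF s\<in>{0..}. g v s)" for v
  have lower: "- p (\<lambda>i. - v i) \<le> g v s" if "0 \<le> s" for v s
  proof -
    have "s * p e = p (\<lambda>i. s * e i)" using sublinear_scale[OF p that] by simp
    also have "(\<lambda>i. s * e i) = (\<lambda>i. (v i + s * e i) + - v i)" by auto
    also have "p \<dots> \<le> p (\<lambda>i. v i + s * e i) + p (\<lambda>i. - v i)" by (rule sublinear_add[OF p])
    finally show ?thesis by (simp add: g_def)
  qed
  have bdd: "bdd_below (g v ` {0..})" for v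
    by (rule bdd_belowI2[where m = "- p (\<lambda>i. - v i)"]) (simp add: lower)
  have q_le: "q v \<le> g v s" if "0 \<le> s" for v s
    unfolding q_def by (rule cINF_lower[OF bdd]) (use that in auto)
  have q_ge: "c \<le> q v" if "\<And>s. 0 \<le> s \<Longrightarrow> c \<le> g v s" for c v
    unfolding q_def by (rule cINF_greatest) (use that in auto)
  have add: "q (\<lambda>i. u i + v i) \<le> q u + q v" for u v
  proof -
    have *: "q (\<lambda>i. u i + v i) \<le> g u s + g v t" if "0 \<le> s" "0 \<le> t" for s t
    proof -
      have "q (\<lambda>i. u i + v i) \<le> g (\<lambda>i. u i + v i) (s + t)" using that by (intro q_le) simp
      also have "\<dots> = p (\<lambda>i. (u i + s * e i) + (v i + t * e i)) - (s + t) * p e"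
        by (simp add: g_def algebra_simps)
      also have "\<dots> \<le> g u s + g v t"
        using sublinear_add[OF p, of "\<lambda>i. u i + s * e i" "\<lambda>i. v i + t * e i"]
        by (simp add: g_def algebra_simps)
      finally show ?thesis .
    qed
    have "q (\<lambda>i. u i + v i) - g u s \<le> q v" if "0 \<le> s" for s
      by (rule q_ge) (use *[OF that] in \<open>simp add: algebra_simps\<close>)
    then have "q (\<lambda>i. u i + v i) - q v \<le> q u"
      by (intro q_ge) (simp add: algebra_simps)
    then show ?thesis by simp
  qed
  have scale_le: "q (\<lambda>i. c * u i) \<le> c * q u" if c: "0 < c" for c u
  proof -
    have "q (\<lambda>i. c * u i) / c \<le> q u"
    proof (rule q_ge)
      fix s :: real assume s: "0 \<le> s"
      have "q (\<lambda>i. c * u i) \<le> g (\<lambda>i. c * u i) (c * s)" using c s by (intro q_le) simp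
      also have "\<dots> = c * g u s"
        using sublinear_scale[OF p, of c "\<lambda>i. u i + s * e i"] c
        by (simp add: g_def algebra_simps)
      finally show "q (\<lambda>i. c * u i) / c \<le> g u s" using c by (simp add: field_simps)
    qed
    then show ?thesis using c by (simp add: field_simps)
  qed
  have scale: "q (\<lambda>i. c * u i) = c * q u" if c: "0 < c" for c u
  proof (rule antisym[OF scale_le[OF c]])
    have "q u \<le> (1 / c) * q (\<lambda>i. c * u i)"
      using scale_le[of "1 / c" "\<lambda>i. c * u i"] c by simp
    then show "c * q u \<le> q (\<lambda>i. c * u i)" using c by (simp add: field_simps)
  qed
  have g0: "g (\<lambda>_. 0) s = 0" if "0 \<le> s" for s
    using that sublinear_scale[OF p, of s e] by (simp add: g_def)
  have "q (\<lambda>_. 0) = 0"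
    using q_le[of 0 "\<lambda>_. 0"] q_ge[of 0 "\<lambda>_. 0"] g0 by (intro antisym) simp_all
  then have "sublinear q"
    unfolding sublinear_def using add scale by (auto simp: le_less)
  moreover have "q v \<le> p v" for v using q_le[of 0 v] by (simp add: g_def)
  moreover have "q (\<lambda>i. - e i) \<le> - p e"
    using q_le[of 1 "\<lambda>i. - e i"] sublinear_zero[OF p] by (simp add: g_def)
  ultimately show ?thesis using that by blast
qed

lemma sublinear_linearise_set:
  assumes "finite E" "sublinear p"
  obtains q where "sublinear q" "\<And>v. q v \<le> p v" "\<And>e. e \<in> E \<Longrightarrow> q (\<lambda>i. - e i) = - q e"
  using assms
proof (induction E arbitrary: thesis rule: finite_induct)
  case empty
  then show ?case by blast
next
  case (insert e E)
  obtain r where r: "sublinear r" "\<And>v. r v \<le> p v" "\<And>e. e \<in> E \<Longrightarrow> r (\<lambda>i. - e i) = - r e"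
    using insert.IH insert.prems(2) by blast
  obtain q where q: "sublinear q" "\<And>v. q v \<le> r v" "q (\<lambda>i. - e i) \<le> - r e"
    using sublinear_linearise[OF r(1)] by blast
  have "q (\<lambda>i. - d i) = - q d" if "d \<in> insert e E" for d
  proof -
    have "q (\<lambda>i. - d i) \<le> - r d"
      using that q(3) q(2)[of "\<lambda>i. - d i"] r(3)[of d] by auto
    moreover have "- r d \<le> - q d" using q(2) by simp
    moreover have "- q d \<le> q (\<lambda>i. - d i)" using sublinear_uminus[OF q(1), of d] by simp
    ultimately show ?thesis by simp
  qed
  moreover have "q v \<le> p v" for v using q(2) r(2) order.trans by blast
  ultimately show ?case using insert.prems(1) q(1) by blast
qed

text \<open>Finite-dimensional Hahn-Banach. Linearising along \<open>b\<close> first secures the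
  value at \<open>b\<close>, since everything below \<open>p1\<close> is at most
  \<open>- l b\<close> at the negative of \<open>b\<close>. Linearising along the axis vectors then
  makes \<open>q\<close> linear on \<open>Rn n\<close>, and its values on the axis vectors are the
  coordinates of \<open>x\<close>.\<close>

lemma is_norm_supporting_functional:
  assumes l: "is_norm n l" and b: "b \<in> Rn n"
  obtains x where "x \<in> Rn n" "dot n b x = l b" "\<And>v. v \<in> Rn n \<Longrightarrow> dot n v x \<le> l v"
proof -
  define tr where "tr v = (\<lambda>i. if i < n then v i else 0)" for v :: "nat \<Rightarrow> real"
  have tr: "tr v \<in> Rn n" for v by (simp add: tr_def Rn_def)
  have tr_id: "tr v = v" if "v \<in> Rn n" for v using that by (auto simp: tr_def Rn_def)
  define p where "p v = l (tr v)" for v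
  have p: "sublinear p"
    unfolding sublinear_def
  proof (intro conjI allI impI)
    fix u v
    have "tr (\<lambda>i. u i + v i) = (\<lambda>i. tr u i + tr v i)" by (auto simp: tr_def)
    then show "p (\<lambda>i. u i + v i) \<le> p u + p v"
      unfolding p_def using is_norm_triangle[OF l tr tr] by simp
  next
    fix c :: real and u assume "0 \<le> c"
    moreover have "tr (\<lambda>i. c * u i) = (\<lambda>i. c * tr u i)" by (auto simp: tr_def)
    ultimately show "p (\<lambda>i. c * u i) = c * p u"
      unfolding p_def using is_norm_scale[OF l tr] by simp
  qed
  obtain p1 where p1: "sublinear p1" "\<And>v. p1 v \<le> p v" "p1 (\<lambda>i. - b i) \<le> - p b"
    using sublinear_linearise[OF p] by blast
  obtain q where q: "sublinear q" "\<And>v. q v \<le> p1 v"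
      and lin: "\<And>k. k < n \<Longrightarrow> q (\<lambda>i. - axis_vec k i) = - q (axis_vec k)"
    by (rule sublinear_linearise_set[of "axis_vec ` {..<n}" p1]) (use p1(1) in auto)
  define x where "x i = (if i < n then q (axis_vec i) else 0)" for i
  have q_axis: "q (\<lambda>i. c * axis_vec k i) = c * q (axis_vec k)" if "k < n" for c k
  proof (cases "0 \<le> c")
    case True
    then show ?thesis by (rule sublinear_scale[OF q(1)])
  next
    case False
    then have "q (\<lambda>i. (- c) * (- axis_vec k i)) = (- c) * q (\<lambda>i. - axis_vec k i)"
      by (intro sublinear_scale[OF q(1)]) simp
    then show ?thesis using lin[OF that] by simp
  qed
  have q_le: "q v \<le> dot n v x" if "v \<in> Rn n" for v
  proof -
    have v: "v = (\<lambda>i. \<Sum>k<n. v k * axis_vec k i)"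
      using that by (auto simp: axis_vec_def Rn_def fun_eq_iff if_distrib cong: if_cong)
    have "q v = q (\<lambda>i. \<Sum>k<n. v k * axis_vec k i)" using v by simp
    also have "\<dots> \<le> (\<Sum>k<n. q (\<lambda>i. v k * axis_vec k i))"
      using sublinear_sum[OF q(1), of "{..<n}" "\<lambda>k i. v k * axis_vec k i"] by simp
    also have "\<dots> = dot n v x" by (auto simp: dot_def x_def q_axis intro!: sum.cong)
    finally show ?thesis .
  qed
  have q_ge: "dot n v x \<le> q v" if "v \<in> Rn n" for v
  proof -
    have "q (\<lambda>i. - v i) \<le> dot n (\<lambda>i. - v i) x" using that by (intro q_le) (simp add: Rn_def)
    also have "\<dots> = - dot n v x" by (simp add: dot_def sum_negf)
    finally show ?thesis using sublinear_uminus[OF q(1), of v] by simp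
  qed
  have "dot n v x \<le> l v" if "v \<in> Rn n" for v
    using q_ge[OF that] q(2)[of v] p1(2)[of v] by (simp add: p_def tr_id that)
  moreover have "l b \<le> dot n b x"
    using sublinear_uminus[OF q(1), of b] q(2)[of "\<lambda>i. - b i"] p1(3) q_le[OF b]
    by (simp add: p_def tr_id b)
  moreover have "x \<in> Rn n" by (simp add: x_def Rn_def)
  ultimately show ?thesis using that[of x] b by (meson antisym)
qed

text \<open>By compactness \<open>l\<close> has a positive minimum on the unit sphere of the maximum
  norm. This bounds the quotients in \<open>dual_norm\<close>; a \<open>SUP\<close> over an
  unbounded set of reals would carry no information.\<close>

lemma is_norm_bounds_coordinates:
  assumes l: "is_norm n l"
  obtains c where "0 < c" "\<And>v i. v \<in> Rn n \<Longrightarrow> i < n \<Longrightarrow> c * \<bar>v i\<bar> \<le> l v"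
proof (cases "n = 0")
  case True
  then show ?thesis using that[of 1] by simp
next
  case False
  \<comment> \<open>The factors from index \<open>n\<close> on are \<open>{0}\<close>, so Tychonoff
    makes the cube compact inside the product over all natural numbers.\<close>
  define B where "B = (PiE UNIV (\<lambda>i. if i < n then {-1..1} else {0}) :: (nat \<Rightarrow> real) set)"
  have "compact B"
    using compactin_PiE[of "\<lambda>_. euclidean :: real topology" "UNIV :: nat set"
        "\<lambda>i. if i < n then {-1..1} else {0}"]
    by (simp add: B_def euclidean_product_topology)
  define S where "S = {v \<in> B. \<exists>i<n. \<bar>v i\<bar> = 1}"
  have "S = B \<inter> (\<Union>i<n. {v. \<bar>v i\<bar> = 1})" by (auto simp: S_def)
  moreover have "closed {v :: nat \<Rightarrow> real. \<bar>v i\<bar> = 1}" for i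
    by (intro closed_Collect_eq continuous_intros) auto
  ultimately have "compact S"
    using \<open>compact B\<close> by (auto intro!: compact_Int_closed closed_UN)
  have BRn: "B \<subseteq> Rn n"
  proof
    fix v assume "v \<in> B"
    then have "v i \<in> (if i < n then {-1..1} else {0})" for i by (simp add: B_def PiE_iff)
    from this[of i for i] show "v \<in> Rn n" by (simp add: Rn_def) (metis not_le singletonD)
  qed
  then have SRn: "S \<subseteq> Rn n" by (auto simp: S_def)
  have "axis_vec 0 \<in> S" using False
    by (simp add: S_def B_def axis_vec_def PiE_iff)
  then have "S \<noteq> {}" by auto
  have lip: "l u - l v \<le> (\<Sum>i<n. \<bar>u i - v i\<bar> * l (axis_vec i))" if "u \<in> Rn n" "v \<in> Rn n" for u v
  proof -
    have *: "l (\<lambda>i. \<Sum>k\<in>I. f k i) \<le> (\<Sum>k\<in>I. l (f k))"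
      if "finite I" "\<And>k. k \<in> I \<Longrightarrow> f k \<in> Rn n" for I :: "nat set" and f
      using that
    proof (induction I rule: finite_induct)
      case empty
      show ?case using is_norm_eq_0_iff[OF l, of "\<lambda>_. 0"] by (simp add: Rn_def)
    next
      case (insert k I)
      then have "(\<lambda>i. \<Sum>k\<in>I. f k i) \<in> Rn n" by (simp add: Rn_def)
      then show ?case
        using insert is_norm_triangle[OF l, of "f k" "\<lambda>i. \<Sum>k\<in>I. f k i"] by force
    qed
    have d: "(\<lambda>i. u i - v i) = (\<lambda>i. \<Sum>k<n. (u k - v k) * axis_vec k i)"
      using that by (auto simp: axis_vec_def Rn_def fun_eq_iff if_distrib cong: if_cong)
    have "l u = l (\<lambda>i. v i + (u i - v i))" by simp
    also have "\<dots> \<le> l v + l (\<lambda>i. u i - v i)"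
      using that by (intro is_norm_triangle[OF l]) (auto simp: Rn_def)
    also have "l (\<lambda>i. u i - v i) \<le> (\<Sum>k<n. l (\<lambda>i. (u k - v k) * axis_vec k i))"
      unfolding d by (rule *) (auto simp: Rn_def axis_vec_def)
    also have "\<dots> = (\<Sum>i<n. \<bar>u i - v i\<bar> * l (axis_vec i))"
      by (intro sum.cong) (auto simp: is_norm_scale[OF l] axis_vec_Rn)
    finally show ?thesis by simp
  qed
  have "continuous_on S l"
    unfolding continuous_on_def
  proof
    fix v assume v: "v \<in> S"
    have coord: "((\<lambda>u. u i) \<longlongrightarrow> v i) (at v within S)" for i
      using continuous_on_product_coordinates[of i]
      by (auto simp: continuous_on_def intro: tendsto_within_subset)
    have "((\<lambda>u. \<Sum>i<n. \<bar>u i - v i\<bar> * l (axis_vec i)) \<longlongrightarrow> (\<Sum>i<n. \<bar>v i - v i\<bar> * l (axis_vec i))) (at v within S)"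
      by (intro tendsto_intros coord)
    then have "((\<lambda>u. \<Sum>i<n. \<bar>u i - v i\<bar> * l (axis_vec i)) \<longlongrightarrow> 0) (at v within S)" by simp
    moreover have "\<forall>\<^sub>F u in at v within S. norm (l u - l v) \<le> (\<Sum>i<n. \<bar>u i - v i\<bar> * l (axis_vec i))"
      unfolding eventually_at_topological
    proof (intro exI[of _ UNIV] conjI ballI impI)
      fix u assume "u \<in> S"
      then have "u \<in> Rn n" "v \<in> Rn n" using v SRn by auto
      then show "norm (l u - l v) \<le> (\<Sum>i<n. \<bar>u i - v i\<bar> * l (axis_vec i))"
        using lip[of u v] lip[of v u] by (simp add: abs_minus_commute abs_le_iff)
    qed auto
    ultimately have "((\<lambda>u. l u - l v) \<longlongrightarrow> 0) (at v within S)"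
      by (rule Lim_null_comparison[rotated])
    then show "(l \<longlongrightarrow> l v) (at v within S)" by (simp add: LIM_zero_iff)
  qed
  then obtain m where m: "m \<in> S" "\<And>v. v \<in> S \<Longrightarrow> l m \<le> l v"
    using continuous_attains_inf[OF \<open>compact S\<close> \<open>S \<noteq> {}\<close>] by blast
  have "m \<noteq> (\<lambda>_. 0)" using m(1) by (auto simp: S_def)
  then have "0 < l m"
    using is_norm_eq_0_iff[OF l] is_norm_nonneg[OF l] m(1) SRn by (metis less_le subsetD)
  moreover have "l m * \<bar>v i\<bar> \<le> l v" if v: "v \<in> Rn n" and i: "i < n" for v i
  proof (cases "v i = 0")
    case True
    then show ?thesis using is_norm_nonneg[OF l v] by simp
  next
    case False
    define s where "s = Max ((\<lambda>i. \<bar>v i\<bar>) ` {..<n})"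
    have s: "\<bar>v j\<bar> \<le> s" if "j < n" for j unfolding s_def using that by (intro Max_ge) auto
    have "s \<in> (\<lambda>i. \<bar>v i\<bar>) ` {..<n}" unfolding s_def using i by (intro Max_in) auto
    then obtain k where k: "k < n" "s = \<bar>v k\<bar>" by auto
    have "0 < s" using s[OF i] False by linarith
    define u where "u i = (1 / s) * v i" for i
    have "\<bar>u j\<bar> \<le> 1" if "j < n" for j
      using s[OF that] \<open>0 < s\<close> by (simp add: u_def abs_mult)
    moreover have "\<bar>u k\<bar> = 1" using k \<open>0 < s\<close> by (simp add: u_def abs_mult)
    moreover have "u j = 0" if "\<not> j < n" for j using that v by (simp add: u_def Rn_def)
    ultimately have "u \<in> B" by (simp add: B_def PiE_iff abs_le_iff minus_le_iff)
    then have "u \<in> S" using k \<open>\<bar>u k\<bar> = 1\<close> unfolding S_def by blast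
    then have "l m \<le> l u" by (rule m(2))
    also have "l u = \<bar>1 / s\<bar> * l v"
      unfolding u_def by (rule is_norm_scale[OF l v])
    finally have "l m * s \<le> l v" using \<open>0 < s\<close> by (simp add: field_simps)
    moreover have "l m * \<bar>v i\<bar> \<le> l m * s" using s[OF i] \<open>0 < l m\<close> by simp
    ultimately show ?thesis by linarith
  qed
  ultimately show ?thesis by (rule that[of "l m"])
qed

lemma dot_le_dual_norm:
  assumes l: "is_norm n l" and v: "v \<in> Rn n" and x: "x \<in> Rn n"
  shows "dot n v x \<le> l v * dual_norm n l x"
proof (cases "v = (\<lambda>_. 0)")
  case True
  then show ?thesis using is_norm_eq_0_iff[OF l v] by (simp add: dot_def)
next
  case False
  have pos: "0 < l u" if "u \<in> Rn n - {\<lambda>_. 0}" for u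
    using that is_norm_eq_0_iff[OF l, of u] is_norm_nonneg[OF l, of u] by auto
  obtain c where c: "0 < c" "\<And>v i. v \<in> Rn n \<Longrightarrow> i < n \<Longrightarrow> c * \<bar>v i\<bar> \<le> l v"
    using is_norm_bounds_coordinates[OF l] by blast
  have "bdd_above ((\<lambda>y. (\<Sum>i<n. x i * y i) / l y) ` (Rn n - {\<lambda>_. 0}))"
  proof (rule bdd_aboveI2)
    fix y assume y: "y \<in> Rn n - {\<lambda>_. 0}"
    have "(\<Sum>i<n. x i * y i) \<le> (\<Sum>i<n. \<bar>x i\<bar> * (l y / c))"
    proof (rule sum_mono)
      fix i assume "i \<in> {..<n}"
      then have "\<bar>y i\<bar> \<le> l y / c" using c y by (simp add: field_simps)
      then show "x i * y i \<le> \<bar>x i\<bar> * (l y / c)"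
        by (metis abs_ge_self abs_mult abs_ge_zero mult_left_mono order_trans)
    qed
    then show "(\<Sum>i<n. x i * y i) / l y \<le> (\<Sum>i<n. \<bar>x i\<bar> / c)"
      using pos[OF y] by (simp add: divide_le_eq sum_distrib_right)
  qed
  then have "(\<Sum>i<n. x i * v i) / l v \<le> dual_norm n l x"
    unfolding dual_norm_def by (rule cSUP_upper[rotated]) (use v False in auto)
  then show ?thesis using pos[of v] v False by (simp add: dot_def divide_le_eq mult.commute)
qed

lemma dual_norm_le_1:
  assumes l: "is_norm n l" and "0 < n" and le: "\<And>v. v \<in> Rn n \<Longrightarrow> dot n v x \<le> l v"
  shows "dual_norm n l x \<le> 1"
  unfolding dual_norm_def
proof (rule cSUP_least)
  have "axis_vec 0 \<in> Rn n - {\<lambda>_. 0}"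
    using axis_vec_Rn[OF \<open>0 < n\<close>] by (auto simp: axis_vec_def fun_eq_iff)
  then show "Rn n - {\<lambda>_. 0} \<noteq> {}" by blast
  fix y assume y: "y \<in> Rn n - {\<lambda>_. 0}"
  then have "0 < l y"
    using is_norm_eq_0_iff[OF l, of y] is_norm_nonneg[OF l, of y] by auto
  moreover have "(\<Sum>i<n. x i * y i) \<le> l y" using le[of y] y by (simp add: dot_def mult.commute)
  ultimately show "(\<Sum>i<n. x i * y i) / l y \<le> 1" by simp
qed

section \<open>Weights dominated by a symmetric norm\<close>

lemma le_if_le_plus_small:
  fixes x y c :: real
  assumes "\<And>s. 0 < s \<Longrightarrow> x \<le> y + s * c"
  shows "x \<le> y"
proof (rule field_le_epsilon)
  fix e :: real assume e: "0 < e"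
  have "x \<le> y + e / (\<bar>c\<bar> + 1) * c" using e by (intro assms) simp
  also have "e / (\<bar>c\<bar> + 1) * c \<le> e"
  proof -
    have "e * c \<le> e * (\<bar>c\<bar> + 1)" using e by (intro mult_left_mono) auto
    then show ?thesis by (simp add: field_simps)
  qed
  finally show "x \<le> y + e" by simp
qed

text \<open>The tangent of the square root at 1; it linearises the dual norm in the first-order
  arguments below.\<close>

lemma sqrt_le_if_le:
  fixes x y :: real
  assumes "0 \<le> y" "x \<le> 1 + 2 * y"
  shows "sqrt x \<le> 1 + y"
proof (rule real_le_lsqrt)
  have "x \<le> 1 + 2 * y + y\<^sup>2" using assms zero_le_power2[of y] by linarith
  then show "x \<le> (1 + y)\<^sup>2" by (simp add: power2_sum)
qed (use assms in simp)

text \<open>Summation by parts as an invariant: up to index \<open>k\<close>, the weighted sum of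
  the differences \<open>v i - u i\<close> is at least \<open>x k\<close> times their partial sum,
  because \<open>x\<close> decreases and the partial sums are nonnegative.\<close>

lemma abel_le_antimono:
  fixes x u v :: "nat \<Rightarrow> real"
  assumes "antimono_on {..<n} x" "\<And>i. i < n \<Longrightarrow> 0 \<le> x i"
    and "\<And>m. m \<le> n \<Longrightarrow> (\<Sum>i<m. u i) \<le> (\<Sum>i<m. v i)"
  shows "(\<Sum>i<n. u i * x i) \<le> (\<Sum>i<n. v i * x i)"
proof (cases n)
  case (Suc n')
  have "x k * (\<Sum>i<Suc k. v i - u i) \<le> (\<Sum>i<Suc k. (v i - u i) * x i)" if "k < n" for k
    using that
  proof (induction k)
    case (Suc k)
    have "x (Suc k) * (\<Sum>i<Suc k. v i - u i) \<le> x k * (\<Sum>i<Suc k. v i - u i)"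
      using Suc.prems assms(3)[of "Suc k"] monotone_onD[OF assms(1), of k "Suc k"]
      by (intro mult_right_mono) (auto simp: sum_subtractf)
    then show ?case using Suc by (simp add: algebra_simps)
  qed simp
  from this[of n'] have "x n' * (\<Sum>i<n. v i - u i) \<le> (\<Sum>i<n. (v i - u i) * x i)"
    using Suc by simp
  moreover have "0 \<le> x n' * (\<Sum>i<n. v i - u i)"
    using assms(2)[of n'] assms(3)[of n] Suc by (simp add: sum_subtractf)
  ultimately show ?thesis by (simp add: sum_subtractf algebra_simps)
qed simp

text \<open>The mirror image with tail sums. The constant part \<open>g 0\<close> is weighted with
  the full sum; the remainder \<open>g - g 0\<close> is again increasing and nonnegative and
  vanishes at index 0.\<close>

lemma abel_nonneg_mono:
  fixes g d :: "nat \<Rightarrow> real"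
  assumes "mono_on {..<n} g" "\<And>i. i < n \<Longrightarrow> 0 \<le> g i"
    and "\<And>k. k \<le> n \<Longrightarrow> 0 \<le> (\<Sum>j=k..<n. d j)"
  shows "0 \<le> (\<Sum>j<n. d j * g j)"
  using assms
proof (induction n arbitrary: g d)
  case (Suc n)
  have "0 \<le> (\<Sum>j<n. d (Suc j) * (g (Suc j) - g 0))"
  proof (rule Suc.IH)
    show "mono_on {..<n} (\<lambda>j. g (Suc j) - g 0)"
      using monotone_onD[OF Suc.prems(1)] by (auto intro!: monotone_onI)
    show "0 \<le> g (Suc i) - g 0" if "i < n" for i
      using that monotone_onD[OF Suc.prems(1), of 0 "Suc i"] by auto
    show "0 \<le> (\<Sum>j=k..<n. d (Suc j))" if "k \<le> n" for k
      using Suc.prems(3)[of "Suc k"] that by (simp add: sum.shift_bounds_Suc_ivl[symmetric] del: sum.op_ivl_Suc)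
  qed
  moreover have "0 \<le> g 0 * (\<Sum>j=0..<Suc n. d j)"
    using Suc.prems(2)[of 0] Suc.prems(3)[of 0] by (intro mult_nonneg_nonneg) auto
  moreover have "(\<Sum>j<Suc n. d j * g j)
      = g 0 * (\<Sum>j=0..<Suc n. d j) + (\<Sum>j<n. d (Suc j) * (g (Suc j) - g 0))"
    unfolding atLeast0LessThan sum.lessThan_Suc_shift
    by (simp add: algebra_simps sum.distrib sum_subtractf sum_distrib_left)
  ultimately show ?case by simp
qed simp

lemma permutation_antimono:
  fixes z :: "nat \<Rightarrow> real"
  obtains \<pi> where "\<pi> permutes {..<n}" "antimono_on {..<n} (z \<circ> \<pi>)"
proof (induction n arbitrary: z thesis)
  case 0
  show ?case by (rule 0[of id]) (auto intro: monotone_onI permutes_id)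
next
  case (Suc n)
  have "Min (z ` {..n}) \<in> z ` {..n}" by (intro Min_in) auto
  then obtain k where k: "k \<le> n" "z k = Min (z ` {..n})" by (metis atMost_iff imageE)
  define \<tau> where "\<tau> = Transposition.transpose k n"
  have \<tau>: "\<tau> permutes {..<Suc n}" using k by (auto simp: \<tau>_def intro: permutes_swap_id)
  obtain \<pi> where \<pi>: "\<pi> permutes {..<n}" "antimono_on {..<n} (z \<circ> \<tau> \<circ> \<pi>)"
    using Suc.IH by blast
  have \<pi>': "\<pi> permutes {..<Suc n}" using \<pi>(1) by (rule permutes_subset) auto
  show ?case
  proof (rule Suc.prems)
    show "\<tau> \<circ> \<pi> permutes {..<Suc n}" by (rule permutes_compose[OF \<pi>' \<tau>])
    have last: "(z \<circ> (\<tau> \<circ> \<pi>)) n = z k"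
      using permutes_not_in[OF \<pi>(1), of n] by (simp add: \<tau>_def)
    have le: "z k \<le> (z \<circ> (\<tau> \<circ> \<pi>)) i" if "i < Suc n" for i
    proof -
      have "\<tau> (\<pi> i) \<in> {..<Suc n}"
        using that permutes_in_image[OF \<tau>] permutes_in_image[OF \<pi>'] by simp
      then show ?thesis using k(2) by (auto intro!: Min_le)
    qed
    show "antimono_on {..<Suc n} (z \<circ> (\<tau> \<circ> \<pi>))"
    proof (rule monotone_onI)
      fix i j assume ij: "i \<in> {..<Suc n}" "j \<in> {..<Suc n}" "i \<le> j"
      show "(z \<circ> (\<tau> \<circ> \<pi>)) j \<le> (z \<circ> (\<tau> \<circ> \<pi>)) i"
      proof (cases "j = n")
        case True
        then show ?thesis using last le[of i] ij by simp
      next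
        case False
        then show ?thesis using monotone_onD[OF \<pi>(2), of i j] ij by (simp add: o_assoc)
      qed
    qed
  qed
qed

section \<open>The square of a Q'-norm as a minimum over weights\<close>

text \<open>For nonnegative \<open>w\<close> and symmetric \<open>\<Phi>\<close> this is the unit
  ball of the norm dual to \<open>\<Phi>\<close>. Only nonnegative \<open>z\<close> are tested
  because \<open>\<Phi>\<close> is going to be applied to squares.\<close>

definition dominated_weights :: "nat \<Rightarrow> ((nat \<Rightarrow> real) \<Rightarrow> real) \<Rightarrow> (nat \<Rightarrow> real) \<Rightarrow> bool" where
  "dominated_weights n \<Phi> w \<longleftrightarrow> (\<forall>z\<in>Rn n. (\<forall>i. 0 \<le> z i) \<longrightarrow> dot n w z \<le> \<Phi> z)"

lemma permutes_Rn:
  assumes "\<pi> permutes {..<n}" "z \<in> Rn n"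
  shows "z \<circ> \<pi> \<in> Rn n"
  using assms permutes_not_in[OF assms(1)] by (auto simp: Rn_def)

lemma dominated_weights_permute:
  assumes sym: "symmetric_norm n \<Phi>" and w: "dominated_weights n \<Phi> w" and \<pi>: "\<pi> permutes {..<n}"
  shows "dominated_weights n \<Phi> (w \<circ> \<pi>)"
  unfolding dominated_weights_def
proof (intro ballI impI)
  fix z assume z: "z \<in> Rn n" "\<forall>i. 0 \<le> z i"
  have inv: "inv \<pi> permutes {..<n}" by (rule permutes_inv[OF \<pi>])
  have "dot n (w \<circ> \<pi>) z = dot n w (z \<circ> inv \<pi>)"
    unfolding dot_def using sum.permute[OF \<pi>, of "\<lambda>i. w i * z (inv \<pi> i)"]
    by (simp add: o_def permutes_inverses[OF \<pi>])
  also have "\<dots> \<le> \<Phi> (z \<circ> inv \<pi>)"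
    using w z permutes_Rn[OF inv z(1)] by (auto simp: dominated_weights_def)
  also have "\<dots> = \<Phi> z" using sym z(1) inv by (auto simp: symmetric_norm_def)
  finally show "dot n (w \<circ> \<pi>) z \<le> \<Phi> z" .
qed

text \<open>Weak majorization by the prefix sums of \<open>w\<close>. Sorting \<open>z\<close>
  decreasingly reduces the claim to summation by parts, and the symmetry of \<open>\<Phi>\<close>
  absorbs the sorting.\<close>

lemma dominated_weights_majorize:
  assumes sym: "symmetric_norm n \<Phi>" and w: "dominated_weights n \<Phi> w"
    and le: "\<And>I. I \<subseteq> {..<n} \<Longrightarrow> (\<Sum>i\<in>I. w' i) \<le> (\<Sum>i<card I. w i)"
  shows "dominated_weights n \<Phi> w'"
  unfolding dominated_weights_def
proof (intro ballI impI)
  fix z assume z: "z \<in> Rn n" "\<forall>i. 0 \<le> z i"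
  obtain \<pi> where \<pi>: "\<pi> permutes {..<n}" "antimono_on {..<n} (z \<circ> \<pi>)"
    by (rule permutation_antimono)
  have "dot n w' z = (\<Sum>i<n. (w' \<circ> \<pi>) i * (z \<circ> \<pi>) i)"
    unfolding dot_def using sum.permute[OF \<pi>(1), of "\<lambda>i. w' i * z i"] by (simp add: o_def)
  also have "\<dots> \<le> (\<Sum>i<n. w i * (z \<circ> \<pi>) i)"
  proof (rule abel_le_antimono[OF \<pi>(2)])
    fix m assume m: "m \<le> n"
    have inj: "inj_on \<pi> {..<m}" using permutes_inj[OF \<pi>(1)] by (auto intro: inj_on_subset)
    have "\<pi> ` {..<m} \<subseteq> {..<n}" using m permutes_image[OF \<pi>(1)] by force
    from le[OF this] show "(\<Sum>i<m. (w' \<circ> \<pi>) i) \<le> (\<Sum>i<m. w i)"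
      using inj by (simp add: sum.reindex card_image)
  qed (use z in auto)
  also have "\<dots> \<le> \<Phi> (z \<circ> \<pi>)"
    using w z permutes_Rn[OF \<pi>(1) z(1)] by (auto simp: dominated_weights_def dot_def)
  also have "\<dots> = \<Phi> z" using sym z(1) \<pi>(1) by (auto simp: symmetric_norm_def)
  finally show "dot n w' z \<le> \<Phi> z" .
qed

text \<open>Let \<open>y\<close> support \<open>l\<close> at \<open>a\<close>. Cauchy-Schwarz for
  \<open>a i / sqrt (w i)\<close> and \<open>sqrt (w i) * y i\<close> leaves the sum of
  \<open>w i * (y i)\<^sup>2\<close>, which is at most 1 because \<open>y\<close> has dual norm at
  most 1.\<close>

lemma Q'_norm_sq_le_weighted:
  assumes l: "is_norm n l" and n: "0 < n" and \<Phi>: "is_norm n \<Phi>"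
    and dual: "\<And>x. x \<in> Rn n \<Longrightarrow> dual_norm n l x = sqrt (\<Phi> (\<lambda>i. (x i)\<^sup>2))"
    and w: "dominated_weights n \<Phi> w" "\<And>i. i < n \<Longrightarrow> 0 < w i" and a: "a \<in> Rn n"
  shows "(l a)\<^sup>2 \<le> (\<Sum>i<n. (a i)\<^sup>2 / w i)"
proof -
  obtain y where y: "y \<in> Rn n" "dot n a y = l a" "\<And>v. v \<in> Rn n \<Longrightarrow> dot n v y \<le> l v"
    using is_norm_supporting_functional[OF l a] by blast
  have "sqrt (\<Phi> (\<lambda>i. (y i)\<^sup>2)) \<le> 1" using dual_norm_le_1[OF l n y(3)] dual[OF y(1)] by simp
  moreover have y2: "(\<lambda>i. (y i)\<^sup>2) \<in> Rn n" using y(1) by (simp add: Rn_def)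
  ultimately have "dot n w (\<lambda>i. (y i)\<^sup>2) \<le> 1"
    using w(1) by (force simp: dominated_weights_def)
  have "(l a)\<^sup>2 = (\<Sum>i<n. (a i / sqrt (w i)) * (sqrt (w i) * y i))\<^sup>2"
    unfolding y(2)[symmetric] dot_def
    by (intro arg_cong[of _ _ "\<lambda>x. x\<^sup>2"] sum.cong) (use w(2) in \<open>auto simp: less_imp_neq[symmetric]\<close>)
  also have "\<dots> \<le> (\<Sum>i<n. (a i / sqrt (w i))\<^sup>2) * (\<Sum>i<n. (sqrt (w i) * y i)\<^sup>2)"
    by (rule Cauchy_Schwarz_ineq_sum)
  also have "(\<Sum>i<n. (a i / sqrt (w i))\<^sup>2) = (\<Sum>i<n. (a i)\<^sup>2 / w i)"
    by (intro sum.cong) (use w(2) in \<open>auto simp: power_divide less_imp_le\<close>)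
  also have "(\<Sum>i<n. (sqrt (w i) * y i)\<^sup>2) = dot n w (\<lambda>i. (y i)\<^sup>2)"
    unfolding dot_def by (intro sum.cong) (use w(2) in \<open>auto simp: power_mult_distrib less_imp_le\<close>)
  also have "(\<Sum>i<n. (a i)\<^sup>2 / w i) * \<dots> \<le> (\<Sum>i<n. (a i)\<^sup>2 / w i) * 1"
    by (intro mult_left_mono sum_nonneg) (use w(2) \<open>dot n w _ \<le> 1\<close> in \<open>auto simp: less_imp_le\<close>)
  finally show ?thesis by simp
qed

text \<open>The weights attaining \<open>l b\<close> are \<open>\<bar>b\<^sub>i\<bar> / (\<bar>x\<^sub>i\<bar> l b)\<close>, where \<open>x\<close> supports \<open>l\<close> at \<open>b\<close>; that
  they are dominated by \<open>\<Phi>\<close> is the first-order optimality condition for \<open>x\<close>.\<close>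

lemma Q'_norm_sq_ge_weighted:
  assumes l: "is_norm n l" and n: "0 < n" and \<Phi>: "is_norm n \<Phi>"
    and dual: "\<And>x. x \<in> Rn n \<Longrightarrow> dual_norm n l x = sqrt (\<Phi> (\<lambda>i. (x i)\<^sup>2))"
    and b: "b \<in> Rn n" and b_nz: "\<And>i. i < n \<Longrightarrow> b i \<noteq> 0"
  obtains w where "\<And>i. i < n \<Longrightarrow> 0 < w i" "dominated_weights n \<Phi> w"
    "(\<Sum>i<n. (b i)\<^sup>2 / w i) \<le> (l b)\<^sup>2"
proof -
  obtain x where x: "x \<in> Rn n" "dot n b x = l b" "\<And>v. v \<in> Rn n \<Longrightarrow> dot n v x \<le> l v"
    using is_norm_supporting_functional[OF l b] by blast
  define \<xi> where "\<xi> i = \<bar>x i\<bar>" for i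
  define \<beta> where "\<beta> i = \<bar>b i\<bar>" for i
  have \<beta>: "0 < \<beta> i" if "i < n" for i using b_nz[OF that] by (simp add: \<beta>_def)
  have \<xi>Rn: "\<xi> \<in> Rn n" using x(1) by (simp add: \<xi>_def Rn_def)
  have \<xi>2: "(\<lambda>i. (\<xi> i)\<^sup>2) \<in> Rn n" using \<xi>Rn by (simp add: Rn_def)
  have \<Phi>\<xi>: "\<Phi> (\<lambda>i. (\<xi> i)\<^sup>2) \<le> 1"
    using dual_norm_le_1[OF l n x(3)] dual[OF x(1)] by (simp add: \<xi>_def)
  have "b \<noteq> (\<lambda>_. 0)" using b_nz[OF n] by auto
  then have lb: "0 < l b"
    using is_norm_eq_0_iff[OF l b] is_norm_nonneg[OF l b] by auto
  \<comment> \<open>Signs are harmless: multiplying \<open>u\<close> by the signs of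
    \<open>b\<close> does not change the squares seen by \<open>\<Phi>\<close>.\<close>
  have D: "dot n \<beta> u \<le> l b * sqrt (\<Phi> (\<lambda>i. (u i)\<^sup>2))" if u: "u \<in> Rn n" for u
  proof -
    have su: "(\<lambda>i. sgn (b i) * u i) \<in> Rn n" using u by (simp add: Rn_def)
    have "dot n \<beta> u = dot n b (\<lambda>i. sgn (b i) * u i)"
      unfolding dot_def \<beta>_def by (intro sum.cong) (auto simp: abs_sgn)
    also have "\<dots> \<le> l b * sqrt (\<Phi> (\<lambda>i. (sgn (b i) * u i)\<^sup>2))"
      using dot_le_dual_norm[OF l b su] dual[OF su] by simp
    also have "(\<lambda>i. (sgn (b i) * u i)\<^sup>2) = (\<lambda>i. (u i)\<^sup>2)"
    proof
      fix i show "(sgn (b i) * u i)\<^sup>2 = (u i)\<^sup>2"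
        using b_nz[of i] u by (cases "i < n") (auto simp: Rn_def sgn_if)
    qed
    finally show ?thesis .
  qed
  have lb_le: "l b \<le> dot n \<beta> \<xi>"
    unfolding x(2)[symmetric] dot_def \<beta>_def \<xi>_def by (intro sum_mono) (metis abs_ge_self abs_mult)
  \<comment> \<open>If \<open>\<xi> k\<close> vanished, moving \<open>\<xi>\<close> by
    \<open>s\<close> along axis \<open>k\<close> would gain \<open>s * \<beta> k\<close> on the left
    of \<open>D\<close> and cost only order \<open>s\<^sup>2\<close> on the right.\<close>
  have \<xi>_pos: "0 < \<xi> k" if k: "k < n" for k
  proof (rule ccontr)
    assume "\<not> 0 < \<xi> k"
    then have \<xi>k: "\<xi> k = 0" by (simp add: \<xi>_def)
    define P where "P = \<Phi> (axis_vec k)"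
    have P: "0 \<le> P" unfolding P_def by (rule is_norm_nonneg[OF \<Phi> axis_vec_Rn[OF k]])
    have "\<beta> k \<le> 0 + s * (l b * P / 2)" if s: "0 < s" for s
    proof -
      define u where "u i = \<xi> i + s * axis_vec k i" for i
      have eRn: "(\<lambda>i. s\<^sup>2 * axis_vec k i) \<in> Rn n" using axis_vec_Rn[OF k] by (simp add: Rn_def)
      have "u \<in> Rn n" using axis_vec_Rn[OF k] \<xi>Rn by (simp add: u_def Rn_def)
      have "(\<lambda>i. (u i)\<^sup>2) = (\<lambda>i. (\<xi> i)\<^sup>2 + s\<^sup>2 * axis_vec k i)"
        using \<xi>k by (auto simp: u_def axis_vec_def fun_eq_iff)
      then have "\<Phi> (\<lambda>i. (u i)\<^sup>2) \<le> 1 + s\<^sup>2 * P"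
        using is_norm_triangle[OF \<Phi> \<xi>2 eRn] \<Phi>\<xi> is_norm_scale[OF \<Phi> axis_vec_Rn[OF k], of "s\<^sup>2"]
        by (simp add: P_def)
      then have "sqrt (\<Phi> (\<lambda>i. (u i)\<^sup>2)) \<le> 1 + s\<^sup>2 * P / 2"
        using P by (intro sqrt_le_if_le) auto
      then have "dot n \<beta> u \<le> l b * (1 + s\<^sup>2 * P / 2)"
        using D[OF \<open>u \<in> Rn n\<close>] lb by (meson less_imp_le mult_left_mono order_trans)
      moreover have "dot n \<beta> u = dot n \<beta> \<xi> + s * \<beta> k"
      proof -
        have "dot n \<beta> u = dot n \<beta> \<xi> + (\<Sum>i<n. s * \<beta> i * axis_vec k i)"
          by (simp add: dot_def u_def distrib_left sum.distrib ac_simps)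
        also have "(\<Sum>i<n. s * \<beta> i * axis_vec k i) = s * \<beta> k"
          using k by (simp add: axis_vec_def if_distrib cong: if_cong)
        finally show ?thesis .
      qed
      ultimately have "s * \<beta> k \<le> s * (s * (l b * P / 2))"
        using lb_le by (simp add: algebra_simps power2_eq_square)
      then show ?thesis using s by simp
    qed
    then have "\<beta> k \<le> 0" by (rule le_if_le_plus_small)
    then show False using \<beta>[OF k] by simp
  qed
  define w where "w i = \<beta> i / (\<xi> i * l b)" for i
  have w: "0 < w i" if "i < n" for i
    using \<beta>[OF that] \<xi>_pos[OF that] lb by (simp add: w_def)
  moreover have "dominated_weights n \<Phi> w"
    unfolding dominated_weights_def
  proof (intro ballI impI)
    fix z assume z: "z \<in> Rn n" "\<forall>i. 0 \<le> z i"
    define r where "r i = (z i)\<^sup>2 / (\<xi> i)\<^sup>2" for i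
    have r: "r \<in> Rn n" using z(1) by (simp add: r_def Rn_def)
    have "dot n w z \<le> \<Phi> z + s * (\<Phi> r / 2)" if s: "0 < s" for s
    proof -
      \<comment> \<open>The direction is chosen so that the squares change by
        \<open>2 * s * z\<close> to first order. The terms of first order in \<open>D\<close> then
        give exactly \<open>dot n w z \<le> \<Phi> z\<close>.\<close>
      define u where "u i = \<xi> i + s * (z i / \<xi> i)" for i
      have "u \<in> Rn n" using z(1) \<xi>Rn by (simp add: u_def Rn_def)
      have u2: "(\<lambda>i. (u i)\<^sup>2) = (\<lambda>i. (\<xi> i)\<^sup>2 + ((2 * s) * z i + s\<^sup>2 * r i))"
      proof
        fix i show "(u i)\<^sup>2 = (\<xi> i)\<^sup>2 + ((2 * s) * z i + s\<^sup>2 * r i)"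
        proof (cases "i < n")
          case True
          then show ?thesis using \<xi>_pos[OF True]
            by (simp add: u_def r_def field_simps power2_eq_square)
        qed (use z(1) \<xi>Rn in \<open>simp add: u_def r_def Rn_def\<close>)
      qed
      have sRn: "(\<lambda>i. 2 * s * z i) \<in> Rn n" "(\<lambda>i. s\<^sup>2 * r i) \<in> Rn n"
        "(\<lambda>i. (2 * s) * z i + s\<^sup>2 * r i) \<in> Rn n"
        using z(1) r by (simp_all add: Rn_def)
      have "\<Phi> (\<lambda>i. (u i)\<^sup>2) \<le> 1 + (2 * s * \<Phi> z + s\<^sup>2 * \<Phi> r)"
        unfolding u2 using is_norm_triangle[OF \<Phi> \<xi>2 sRn(3)] is_norm_triangle[OF \<Phi> sRn(1,2)] \<Phi>\<xi>
          is_norm_scale[OF \<Phi> z(1), of "2 * s"] is_norm_scale[OF \<Phi> r, of "s\<^sup>2"] s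
        by simp
      moreover have "0 \<le> \<Phi> z" "0 \<le> \<Phi> r" using is_norm_nonneg[OF \<Phi>] z(1) r by auto
      ultimately have "sqrt (\<Phi> (\<lambda>i. (u i)\<^sup>2)) \<le> 1 + (s * \<Phi> z + s\<^sup>2 * \<Phi> r / 2)"
        using s by (intro sqrt_le_if_le) auto
      then have "dot n \<beta> u \<le> l b * (1 + (s * \<Phi> z + s\<^sup>2 * \<Phi> r / 2))"
        using D[OF \<open>u \<in> Rn n\<close>] lb by (meson less_imp_le mult_left_mono order_trans)
      moreover have "dot n \<beta> u = dot n \<beta> \<xi> + s * (l b * dot n w z)"
        unfolding dot_def u_def w_def using lb
        by (simp add: algebra_simps sum.distrib sum_distrib_left)
      ultimately have "(s * l b) * dot n w z \<le> (s * l b) * (\<Phi> z + s * (\<Phi> r / 2))"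
        using lb_le by (simp add: algebra_simps power2_eq_square)
      then show ?thesis using s lb by simp
    qed
    then show "dot n w z \<le> \<Phi> z" by (rule le_if_le_plus_small)
  qed
  moreover have "(\<Sum>i<n. (b i)\<^sup>2 / w i) \<le> (l b)\<^sup>2"
  proof -
    have "(\<Sum>i<n. (b i)\<^sup>2 / w i) = l b * dot n \<beta> \<xi>"
      unfolding dot_def sum_distrib_left
    proof (rule sum.cong)
      fix i assume "i \<in> {..<n}"
      then have "0 < \<beta> i" "0 < \<xi> i" using \<beta> \<xi>_pos by auto
      moreover have "(b i)\<^sup>2 = (\<beta> i)\<^sup>2" by (simp add: \<beta>_def)
      ultimately show "(b i)\<^sup>2 / w i = l b * (\<beta> i * \<xi> i)"
        using lb by (simp add: w_def field_simps power2_eq_square)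
    qed simp
    also have "dot n \<beta> \<xi> \<le> l b * sqrt (\<Phi> (\<lambda>i. (\<xi> i)\<^sup>2))" by (rule D[OF \<xi>Rn])
    also have "\<dots> \<le> l b * 1" using \<Phi>\<xi> lb by (intro mult_left_mono) auto
    finally show ?thesis using lb by (simp add: power2_eq_square)
  qed
  ultimately show ?thesis by (rule that)
qed

section \<open>Stretching weights and comparing Q'-norms\<close>

text \<open>The clamped term is the length of the part of \<open>[0, s]\<close> in the cell
  \<open>[i, i + 1]\<close>.\<close>

lemma sum_clamp:
  fixes s :: real
  assumes "0 \<le> s"
  shows "(\<Sum>i<n. max 0 (min 1 (s - real i))) = min s (real n)"
  by (induction n) (use assms in auto)

text \<open>Fractional knapsack: relative to the threshold \<open>w m\<close>, mass on an index
  below \<open>m\<close> brings a nonnegative surplus and mass on a later index brings none.\<close>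

lemma sum_fractional_le_prefix:
  fixes e w :: "nat \<Rightarrow> real"
  assumes w: "antimono_on {..<n} w" "\<And>j. j < n \<Longrightarrow> 0 \<le> w j"
    and e: "\<And>j. j < n \<Longrightarrow> 0 \<le> e j" "\<And>j. j < n \<Longrightarrow> e j \<le> 1"
    and sum: "(\<Sum>j<n. e j) \<le> real m" and m: "m \<le> n"
  shows "(\<Sum>j<n. e j * w j) \<le> (\<Sum>j<m. w j)"
proof (cases "m = n")
  case True
  have "e j * w j \<le> w j" if "j < n" for j using w(2) e that by (simp add: mult_left_le_one_le)
  then show ?thesis unfolding True by (intro sum_mono) auto
next
  case False
  with m have "m < n" by simp
  have "(\<Sum>j<n. e j * w j) \<le> (\<Sum>j<n. of_bool (j < m) * w j + (e j - of_bool (j < m)) * w m)"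
  proof (rule sum_mono)
    fix j assume j: "j \<in> {..<n}"
    show "e j * w j \<le> of_bool (j < m) * w j + (e j - of_bool (j < m)) * w m"
    proof (cases "j < m")
      case True
      then have "w m \<le> w j" using monotone_onD[OF w(1), of j m] j \<open>m < n\<close> by auto
      then have "0 \<le> (1 - e j) * (w j - w m)" using e(2)[of j] j by (intro mult_nonneg_nonneg) auto
      then show ?thesis using True by (simp add: algebra_simps)
    next
      case False
      then have "w j \<le> w m" using monotone_onD[OF w(1), of m j] j \<open>m < n\<close> by auto
      then show ?thesis using False e(1)[of j] j by (simp add: mult_left_mono)
    qed
  qed
  also have "\<dots> = (\<Sum>j<n. of_bool (j < m) * w j) + ((\<Sum>j<n. e j) - (\<Sum>j<n. of_bool (j < m))) * w m"
    unfolding sum.distrib sum_distrib_right[symmetric] sum_subtractf ..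
  also have "(\<Sum>j<n. of_bool (j < m) * w j) = (\<Sum>j<m. w j)"
    using m by (intro sum.mono_neutral_cong_right) auto
  also have "(\<Sum>j<n. of_bool (j < m)) = (\<Sum>j<m. 1 :: real)"
    using m by (intro sum.mono_neutral_cong_right) auto
  also have "((\<Sum>j<n. e j) - (\<Sum>j<m. 1 :: real)) * w m \<le> 0"
    using sum w(2)[OF \<open>m < n\<close>] by (intro mult_nonpos_nonneg) auto
  finally show ?thesis by simp
qed

text \<open>The weights \<open>w'\<close> arise from the step function with values \<open>w\<close> by stretching it by the
  factor \<open>\<kappa>\<close>, averaging over unit cells, and dividing by \<open>\<kappa>\<close>; \<open>D i j\<close> is the length of the overlap
  of \<open>[i, i + 1]\<close> and \<open>[\<kappa> j, \<kappa> (j + 1)]\<close>.\<close>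

lemma stretched_weights:
  fixes A B w :: "nat \<Rightarrow> real"
  assumes \<kappa>: "1 \<le> \<kappa>"
    and A: "antimono_on {..<n} A" "\<And>i. i < n \<Longrightarrow> 0 \<le> A i"
    and B: "\<And>i. i < n \<Longrightarrow> 0 \<le> B i"
    and w: "antimono_on {..<n} w" "\<And>i. i < n \<Longrightarrow> 0 < w i"
    and trunc: "\<And>T. 0 \<le> T \<Longrightarrow> (\<Sum>i<n. min (A i) T) \<le> \<kappa> * (\<Sum>i<n. min (B i) T)"
  obtains w' where "\<And>i. i < n \<Longrightarrow> 0 < w' i"
    "\<And>I. I \<subseteq> {..<n} \<Longrightarrow> (\<Sum>i\<in>I. w' i) \<le> (\<Sum>i<card I. w i)"
    "(\<Sum>i<n. A i / w' i) \<le> \<kappa>\<^sup>2 * (\<Sum>i<n. B i / w i)"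
proof -
  \<comment> \<open>\<open>c k i\<close> is the length of the part of \<open>[i, i + 1]\<close> in
    \<open>[0, \<kappa> * k]\<close>. Since \<open>\<kappa> \<ge> 1\<close>, the stretched cells
    cover \<open>[0, n]\<close>, so the rows of \<open>D\<close> sum to 1.\<close>
  define c where "c k i = max 0 (min 1 (\<kappa> * real k - real i))" for k i :: nat
  define D where "D i j = c (Suc j) i - c j i" for i j
  define X where "X i = (\<Sum>j<n. D i j * w j)" for i
  define G where "G i = (\<Sum>j<n. D i j * (1 / w j))" for i
  define w' where "w' i = X i / \<kappa>" for i
  have \<kappa>k: "real k \<le> \<kappa> * real k" for k using mult_right_mono[of 1 \<kappa> "real k"] \<kappa> by simp
  have D0: "0 \<le> D i j" for i j
    using \<kappa> unfolding D_def c_def by (simp add: algebra_simps le_max_iff_disj min_def)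
  have c0: "c 0 i = 0" for i by (simp add: c_def)
  have c1: "c k i = 1" if "real n \<le> \<kappa> * real k" "i < n" for k i
  proof -
    have "real i + 1 \<le> real n" using that(2) by linarith
    then show ?thesis using that(1) by (simp add: c_def)
  qed
  have cn: "c n i = 1" if "i < n" for i by (rule c1[OF \<kappa>k that])
  have row: "(\<Sum>j<n. D i j) = 1" if "i < n" for i
    unfolding D_def using sum_Suc_diff'[of 0 n "\<lambda>j. c j i"] c0 cn[OF that] by (simp add: atLeast0LessThan)
  have csum: "(\<Sum>i<n. c k i) = min (\<kappa> * real k) (real n)" for k
    unfolding c_def by (rule sum_clamp) (use \<kappa> in simp)
  have col: "(\<Sum>i<n. D i j) \<le> \<kappa>" for j
    unfolding D_def sum_subtractf csum using \<kappa> by (simp add: algebra_simps min_def)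
  \<comment> \<open>Cauchy-Schwarz on one cell: \<open>X i\<close> and \<open>G i\<close> are the
    means of \<open>w\<close> and of \<open>1 / w\<close> under the probability weights
    \<open>D i j\<close>. Hence \<open>1 / w' i \<le> \<kappa> * G i\<close>.\<close>
  have XG: "1 \<le> X i * G i" if i: "i < n" for i
  proof -
    have "(1::real) = (\<Sum>j<n. sqrt (D i j * w j) * sqrt (D i j * (1 / w j)))\<^sup>2"
    proof -
      have "(\<Sum>j<n. sqrt (D i j * w j) * sqrt (D i j * (1 / w j))) = (\<Sum>j<n. D i j)"
        by (intro sum.cong refl) (use D0 w(2) in \<open>simp add: real_sqrt_mult[symmetric] less_imp_neq[symmetric]\<close>)
      then show ?thesis using row[OF i] by simp
    qed
    also have "\<dots> \<le> (\<Sum>j<n. (sqrt (D i j * w j))\<^sup>2) * (\<Sum>j<n. (sqrt (D i j * (1 / w j)))\<^sup>2)"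
      by (rule Cauchy_Schwarz_ineq_sum)
    also have "\<dots> = X i * G i"
      unfolding X_def G_def by (intro arg_cong2[of _ _ _ _ "(*)"] sum.cong refl)
        (use D0 w(2) in \<open>auto simp: less_imp_le\<close>)
    finally show ?thesis .
  qed
  have "0 \<le> X i" for i unfolding X_def by (intro sum_nonneg mult_nonneg_nonneg) (use D0 w(2) in \<open>auto simp: less_imp_le\<close>)
  then have Xpos: "0 < X i" if "i < n" for i using XG[OF that] by (metis less_le mult_zero_left not_one_le_zero)
  show ?thesis
  proof (rule that)
    show "0 < w' i" if "i < n" for i using Xpos[OF that] \<kappa> by (simp add: w'_def)
  next
    fix I assume I: "I \<subseteq> {..<n}"
    then have "finite I" by (rule finite_subset) simp
    \<comment> \<open>Dividing by \<open>\<kappa>\<close> brings each column of \<open>D\<close>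
      down to at most 1, so the cells in \<open>I\<close> amount to a fractional choice of weights
      of total mass at most \<open>card I\<close>.\<close>
    define e where "e j = (\<Sum>i\<in>I. D i j) / \<kappa>" for j
    have "(\<Sum>i\<in>I. w' i) = (\<Sum>j<n. e j * w j)"
      unfolding w'_def X_def e_def sum_divide_distrib sum_distrib_right
      by (subst sum.swap) (simp add: mult.commute)
    also have "\<dots> \<le> (\<Sum>j<card I. w j)"
    proof (rule sum_fractional_le_prefix[OF w(1)])
      show "0 \<le> e j" for j unfolding e_def using D0 \<kappa> by (auto intro!: divide_nonneg_nonneg sum_nonneg)
      have "(\<Sum>i\<in>I. D i j) \<le> (\<Sum>i<n. D i j)" for j by (rule sum_mono2) (use I D0 in auto)
      then show "e j \<le> 1"
        for j unfolding e_def using \<kappa> order.trans[OF _ col, of "\<Sum>i\<in>I. D i j" j] by simp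
      have "(\<Sum>j<n. e j) = (\<Sum>i\<in>I. \<Sum>j<n. D i j) / \<kappa>"
        unfolding e_def sum_divide_distrib[symmetric] by (subst sum.swap) simp
      also have "(\<Sum>i\<in>I. \<Sum>j<n. D i j) = (\<Sum>i\<in>I. 1)" using I row by (intro sum.cong) auto
      also have "(\<Sum>i\<in>I. 1) / \<kappa> \<le> real (card I)"
        using \<kappa> mult_left_mono[of 1 \<kappa> "real (card I)"] by (simp add: divide_le_eq)
      finally show "(\<Sum>j<n. e j) \<le> real (card I)" .
      show "card I \<le> n" using card_mono[OF _ I] by simp
    qed (use w(2) in \<open>auto simp: less_imp_le\<close>)
    finally show "(\<Sum>i\<in>I. w' i) \<le> (\<Sum>i<card I. w i)" .
  next
    define u where "u j = (\<Sum>i<n. A i * D i j)" for j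
    have "(\<Sum>i<n. A i / w' i) \<le> (\<Sum>i<n. \<kappa> * (A i * G i))"
    proof (rule sum_mono)
      fix i assume "i \<in> {..<n}"
      then have i: "i < n" by simp
      have "1 / w' i \<le> \<kappa> * G i"
        using XG[OF i] Xpos[OF i] \<kappa> by (simp add: w'_def divide_le_eq mult.commute)
      then have "A i * (1 / w' i) \<le> A i * (\<kappa> * G i)" by (rule mult_left_mono) (rule A(2)[OF i])
      then show "A i / w' i \<le> \<kappa> * (A i * G i)" by (simp add: mult.left_commute)
    qed
    also have "\<dots> = \<kappa> * (\<Sum>j<n. u j * (1 / w j))"
      unfolding u_def G_def sum_distrib_left sum_distrib_right by (subst sum.swap) (simp add: mult.assoc)
    also have "(\<Sum>j<n. u j * (1 / w j)) \<le> (\<Sum>j<n. \<kappa> * B j * (1 / w j))"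
    proof -
      \<comment> \<open>Since \<open>1 / w\<close> increases, summation by parts leaves only the
        tail sums from each \<open>k\<close> on to be compared.\<close>
      have "0 \<le> (\<Sum>j<n. (\<kappa> * B j - u j) * (1 / w j))"
      proof (rule abel_nonneg_mono)
        show "mono_on {..<n} (\<lambda>j. 1 / w j)"
        proof (rule monotone_onI)
          fix i j assume "i \<in> {..<n}" "j \<in> {..<n}" "i \<le> j"
          then show "1 / w i \<le> 1 / w j"
            using monotone_onD[OF w(1), of i j] w(2)[of j] by (intro divide_left_mono) (auto simp: w(2))
        qed
        show "0 \<le> 1 / w i" if "i < n" for i using w(2)[OF that] by simp
        fix k assume k: "k \<le> n"
        have "(\<Sum>j=k..<n. u j) = (\<Sum>i<n. A i * (1 - c k i))"
        proof -
          have "(\<Sum>j=k..<n. u j) = (\<Sum>i<n. A i * (\<Sum>j=k..<n. D i j))"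
            unfolding u_def sum_distrib_left by (rule sum.swap)
          also have "\<dots> = (\<Sum>i<n. A i * (1 - c k i))"
          proof (intro sum.cong refl)
            fix i assume "i \<in> {..<n}"
            then show "A i * (\<Sum>j=k..<n. D i j) = A i * (1 - c k i)"
              unfolding D_def using sum_Suc_diff'[OF k, of "\<lambda>j. c j i"] cn[of i] by simp
          qed
          finally show ?thesis .
        qed
        also have "\<dots> \<le> (\<Sum>j=k..<n. \<kappa> * B j)"
        proof (cases "real n \<le> \<kappa> * real k")
          case True
          then have "(\<Sum>i<n. A i * (1 - c k i)) = 0" using c1 by (intro sum.neutral) auto
          then show ?thesis using B \<kappa> by (auto intro!: sum_nonneg)
        next
          case False
          \<comment> \<open>The tail from \<open>k\<close> is the integral beyond
            \<open>\<kappa> * k\<close> of the step function with values \<open>A\<close>.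
            Truncation at the value \<open>T\<close> taken at this cut leaves the part beyond the
            cut unchanged and turns the part before it into \<open>\<kappa> * k * T\<close>. The
            hypothesis on truncated sums is used at this \<open>T\<close>.\<close>
          define m where "m = nat \<lfloor>\<kappa> * real k\<rfloor>"
          have "0 \<le> \<kappa> * real k" using \<kappa> by simp
          then have "real m = of_int \<lfloor>\<kappa> * real k\<rfloor>" by (simp add: m_def)
          then have m1: "real m \<le> \<kappa> * real k" and m2: "\<kappa> * real k < real m + 1" by linarith+
          have "m < n" using m1 False by linarith
          define T where "T = A m"
          have "A i * (1 - c k i) \<le> min (A i) T - c k i * T" if i: "i < n" for i
          proof -
            consider "i < m" | "i = m" | "m < i" by linarith
            then show ?thesis
            proof cases
              case 1
              then have "T \<le> A i" using monotone_onD[OF A(1), of i m] \<open>m < n\<close> by (auto simp: T_def)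
              moreover have "real i + 1 \<le> real m" using 1 by linarith
              then have "c k i = 1" using m1 by (simp add: c_def)
              ultimately show ?thesis by simp
            next
              case 2
              then show ?thesis by (simp add: T_def algebra_simps)
            next
              case 3
              then have "A i \<le> T" using monotone_onD[OF A(1), of m i] \<open>m < n\<close> i by (auto simp: T_def)
              moreover have "real m + 1 \<le> real i" using 3 by linarith
              then have "c k i = 0" using m2 by (simp add: c_def)
              ultimately show ?thesis by simp
            qed
          qed
          then have "(\<Sum>i<n. A i * (1 - c k i)) \<le> (\<Sum>i<n. min (A i) T - c k i * T)"
            by (intro sum_mono) auto
          also have "\<dots> = (\<Sum>i<n. min (A i) T) - \<kappa> * real k * T"
            unfolding sum_subtractf sum_distrib_right[symmetric] csum using False by simp
          also have "\<dots> \<le> \<kappa> * (\<Sum>i<n. min (B i) T) - \<kappa> * real k * T"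
            using trunc[of T] A(2)[OF \<open>m < n\<close>] by (simp add: T_def)
          also have "(\<Sum>i<n. min (B i) T) = (\<Sum>i<k. min (B i) T) + (\<Sum>i=k..<n. min (B i) T)"
            using sum.atLeastLessThan_concat[of 0 k n "\<lambda>i. min (B i) T"] k by (simp add: atLeast0LessThan)
          also have "\<kappa> * \<dots> - \<kappa> * real k * T \<le> \<kappa> * (real k * T + (\<Sum>i=k..<n. B i)) - \<kappa> * real k * T"
          proof -
            \<comment> \<open>Any \<open>k\<close> entries truncated at \<open>T\<close> sum to at
              most \<open>k * T\<close>; this cancels the part before the cut.\<close>
            have "(\<Sum>i<k. min (B i) T) \<le> (\<Sum>i<k. T)" by (intro sum_mono) auto
            moreover have "(\<Sum>i=k..<n. min (B i) T) \<le> (\<Sum>i=k..<n. B i)" by (intro sum_mono) auto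
            ultimately show ?thesis using \<kappa> by (intro diff_right_mono mult_left_mono add_mono) auto
          qed
          also have "\<dots> = (\<Sum>j=k..<n. \<kappa> * B j)" by (simp add: algebra_simps sum_distrib_left)
          finally show ?thesis .
        qed
        finally show "0 \<le> (\<Sum>j=k..<n. \<kappa> * B j - u j)" by (simp add: sum_subtractf)
      qed
      then show ?thesis by (simp add: sum_subtractf left_diff_distrib diff_divide_distrib)
    qed
    also have "\<kappa> * (\<Sum>j<n. \<kappa> * B j * (1 / w j)) = \<kappa>\<^sup>2 * (\<Sum>i<n. B i / w i)"
      by (simp add: sum_distrib_left power2_eq_square mult.assoc)
    finally show "(\<Sum>i<n. A i / w' i) \<le> \<kappa>\<^sup>2 * (\<Sum>i<n. B i / w i)" using \<kappa> by (simp add: mult_left_mono)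
  qed
qed

lemma sum_permute_lessThan:
  "\<pi> permutes {..<n} \<Longrightarrow> (\<Sum>i<n. f (\<pi> i)) = (\<Sum>i<n. f i)"
  using sum.permute[of \<pi> "{..<n}" f] by (simp add: o_def)

theorem Q'_norm_le_if_truncated_sums_le:
  assumes Q: "Q'_norm n l" and n: "0 < n" and a: "a \<in> Rn n" and b: "b \<in> Rn n" and \<kappa>: "1 \<le> \<kappa>"
    and trunc: "\<And>T. 0 \<le> T \<Longrightarrow> (\<Sum>i<n. min ((a i)\<^sup>2) T) \<le> \<kappa> * (\<Sum>i<n. min ((b i)\<^sup>2) T)"
  shows "l a \<le> \<kappa> * l b"
proof -
  have l: "is_norm n l" using Q by (simp add: Q'_norm_def)
  obtain \<Phi> where sym: "symmetric_norm n \<Phi>"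
      and dual: "\<And>x. x \<in> Rn n \<Longrightarrow> dual_norm n l x = sqrt (\<Phi> (\<lambda>i. (x i)\<^sup>2))"
    using Q unfolding Q'_norm_def Q_norm_def by blast
  have \<Phi>: "is_norm n \<Phi>" using sym by (simp add: symmetric_norm_def)
  \<comment> \<open>The attaining weights were constructed for vectors without zero coordinates, so
    \<open>b\<close> is first replaced by such a vector \<open>d\<close> that dominates it.\<close>
  have main: "l a \<le> \<kappa> * l d"
    if d: "d \<in> Rn n" "\<And>i. i < n \<Longrightarrow> d i \<noteq> 0" "\<And>i. i < n \<Longrightarrow> \<bar>b i\<bar> \<le> \<bar>d i\<bar>" for d
  proof -
    obtain w where w: "\<And>i. i < n \<Longrightarrow> 0 < w i" "dominated_weights n \<Phi> w"
      "(\<Sum>i<n. (d i)\<^sup>2 / w i) \<le> (l d)\<^sup>2"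
      using Q'_norm_sq_ge_weighted[OF l n \<Phi> dual d(1,2)] by blast
    \<comment> \<open>The squares of \<open>d\<close> are carried along with the sorted weights,
      while the squares of \<open>a\<close> get an order of their own. Symmetry of
      \<open>\<Phi>\<close> permits both reorderings.\<close>
    obtain \<rho> where \<rho>: "\<rho> permutes {..<n}" "antimono_on {..<n} (w \<circ> \<rho>)"
      by (rule permutation_antimono)
    obtain \<pi> where \<pi>: "\<pi> permutes {..<n}" "antimono_on {..<n} ((\<lambda>i. (a i)\<^sup>2) \<circ> \<pi>)"
      by (rule permutation_antimono)
    have lt: "\<rho> i < n" "\<pi> i < n" "inv \<pi> i < n" if "i < n" for i
      using permutes_in_image[OF \<rho>(1), of i] permutes_in_image[OF \<pi>(1), of i]
        permutes_in_image[OF permutes_inv[OF \<pi>(1)], of i] that by auto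
    obtain w' where w': "\<And>i. i < n \<Longrightarrow> 0 < w' i"
      "\<And>I. I \<subseteq> {..<n} \<Longrightarrow> (\<Sum>i\<in>I. w' i) \<le> (\<Sum>i<card I. (w \<circ> \<rho>) i)"
      "(\<Sum>i<n. ((\<lambda>i. (a i)\<^sup>2) \<circ> \<pi>) i / w' i) \<le> \<kappa>\<^sup>2 * (\<Sum>i<n. ((\<lambda>i. (d i)\<^sup>2) \<circ> \<rho>) i / (w \<circ> \<rho>) i)"
    proof (rule stretched_weights[OF \<kappa> \<pi>(2) _ _ \<rho>(2), of "(\<lambda>i. (d i)\<^sup>2) \<circ> \<rho>"])
      fix T :: real assume T: "0 \<le> T"
      have "(\<Sum>i<n. min (((\<lambda>i. (a i)\<^sup>2) \<circ> \<pi>) i) T) = (\<Sum>i<n. min ((a i)\<^sup>2) T)"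
        using sum_permute_lessThan[OF \<pi>(1), of "\<lambda>i. min ((a i)\<^sup>2) T"] by simp
      also have "\<dots> \<le> \<kappa> * (\<Sum>i<n. min ((b i)\<^sup>2) T)" by (rule trunc[OF T])
      also have "\<dots> \<le> \<kappa> * (\<Sum>i<n. min ((d i)\<^sup>2) T)"
        using d(3) \<kappa> by (intro mult_left_mono sum_mono min.mono) (auto simp: abs_le_square_iff)
      also have "(\<Sum>i<n. min ((d i)\<^sup>2) T) = (\<Sum>i<n. min (((\<lambda>i. (d i)\<^sup>2) \<circ> \<rho>) i) T)"
        using sum_permute_lessThan[OF \<rho>(1), of "\<lambda>i. min ((d i)\<^sup>2) T"] by simp
      finally show "(\<Sum>i<n. min (((\<lambda>i. (a i)\<^sup>2) \<circ> \<pi>) i) T)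
          \<le> \<kappa> * (\<Sum>i<n. min (((\<lambda>i. (d i)\<^sup>2) \<circ> \<rho>) i) T)" .
    qed (use w(1) lt in auto)
    have "dominated_weights n \<Phi> (w \<circ> \<rho>)" by (rule dominated_weights_permute[OF sym w(2) \<rho>(1)])
    then have "dominated_weights n \<Phi> w'" by (rule dominated_weights_majorize[OF sym _ w'(2)])
    then have "dominated_weights n \<Phi> (w' \<circ> inv \<pi>)"
      by (rule dominated_weights_permute[OF sym _ permutes_inv[OF \<pi>(1)]])
    then have "(l a)\<^sup>2 \<le> (\<Sum>i<n. (a i)\<^sup>2 / (w' \<circ> inv \<pi>) i)"
      by (intro Q'_norm_sq_le_weighted[OF l n \<Phi> dual _ _ a]) (use w'(1) lt in \<open>auto simp: o_def\<close>)
    also have "\<dots> = (\<Sum>i<n. ((\<lambda>i. (a i)\<^sup>2) \<circ> \<pi>) i / w' i)"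
      using sum_permute_lessThan[OF \<pi>(1), of "\<lambda>i. (a i)\<^sup>2 / (w' \<circ> inv \<pi>) i"]
      by (simp add: permutes_inverses[OF \<pi>(1)])
    also have "\<dots> \<le> \<kappa>\<^sup>2 * (\<Sum>i<n. ((\<lambda>i. (d i)\<^sup>2) \<circ> \<rho>) i / (w \<circ> \<rho>) i)" by (rule w'(3))
    also have "(\<Sum>i<n. ((\<lambda>i. (d i)\<^sup>2) \<circ> \<rho>) i / (w \<circ> \<rho>) i) = (\<Sum>i<n. (d i)\<^sup>2 / w i)"
      using sum_permute_lessThan[OF \<rho>(1), of "\<lambda>i. (d i)\<^sup>2 / w i"] by simp
    also have "\<kappa>\<^sup>2 * \<dots> \<le> \<kappa>\<^sup>2 * (l d)\<^sup>2" using w(3) by (intro mult_left_mono) auto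
    finally have "(l a)\<^sup>2 \<le> (\<kappa> * l d)\<^sup>2" by (simp add: power_mult_distrib)
    then show ?thesis by (rule power2_le_imp_le) (use \<kappa> is_norm_nonneg[OF l d(1)] in simp)
  qed
  \<comment> \<open>Adding \<open>s * \<sigma>\<close> pushes every coordinate of \<open>b\<close>
    away from 0, zero coordinates upwards. Letting \<open>s\<close> tend to 0 removes the
    perturbation.\<close>
  define \<sigma> where "\<sigma> i = (if i < n then if 0 \<le> b i then 1 else - 1 else 0 :: real)" for i
  have \<sigma>: "\<sigma> \<in> Rn n" by (simp add: \<sigma>_def Rn_def)
  have "l a \<le> \<kappa> * l b + s * (\<kappa> * l \<sigma>)" if s: "0 < s" for s
  proof -
    have s\<sigma>: "(\<lambda>i. s * \<sigma> i) \<in> Rn n" using \<sigma> by (simp add: Rn_def)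
    have "l a \<le> \<kappa> * l (\<lambda>i. b i + s * \<sigma> i)"
      by (rule main) (use s b \<sigma> in \<open>auto simp: \<sigma>_def Rn_def\<close>)
    also have "l (\<lambda>i. b i + s * \<sigma> i) \<le> l b + s * l \<sigma>"
      using is_norm_triangle[OF l b s\<sigma>] is_norm_scale[OF l \<sigma>, of s] s by simp
    finally show ?thesis using \<kappa> by (simp add: algebra_simps mult_left_mono)
  qed
  then show ?thesis by (rule le_if_le_plus_small)
qed

section \<open>A smoothed truncation of the square\<close>

text \<open>The middle parabola has its vertex at \<open>1 + \<eta>\<close> with value
  \<open>1 + \<eta>\<close>, and it meets the square at 1 with equal value and slope 2. Concavity in
  the square of the argument gives the upper bound on sketch means; a second derivative of at least
  \<open>- 2 / \<eta>\<close> gives the lower bound.\<close>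

definition smooth_trunc :: "real \<Rightarrow> real \<Rightarrow> real" where
  "smooth_trunc \<eta> z = (if \<bar>z\<bar> \<le> 1 then z\<^sup>2
     else if \<bar>z\<bar> \<le> 1 + \<eta> then 1 + \<eta> - (1 + \<eta> - \<bar>z\<bar>)\<^sup>2 / \<eta> else 1 + \<eta>)"

lemma smooth_trunc_uminus [simp]: "smooth_trunc \<eta> (- z) = smooth_trunc \<eta> z"
  and smooth_trunc_abs [simp]: "smooth_trunc \<eta> \<bar>z\<bar> = smooth_trunc \<eta> z"
  and smooth_trunc_0 [simp]: "smooth_trunc \<eta> 0 = 0"
  by (simp_all add: smooth_trunc_def)

context
  fixes \<eta> :: real
  assumes \<eta>: "0 < \<eta>"
begin

lemma smooth_trunc_middle:
  assumes "1 \<le> \<bar>z\<bar>" "\<bar>z\<bar> \<le> 1 + \<eta>"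
  shows "smooth_trunc \<eta> z = 1 + \<eta> - (1 + \<eta> - \<bar>z\<bar>)\<^sup>2 / \<eta>"
proof (cases "\<bar>z\<bar> = 1")
  case True
  then have "z\<^sup>2 = 1" by (metis power2_abs one_power2)
  then show ?thesis using True \<eta> by (simp add: smooth_trunc_def power2_eq_square)
qed (use assms in \<open>simp add: smooth_trunc_def\<close>)

lemma smooth_trunc_outer: "1 + \<eta> \<le> \<bar>z\<bar> \<Longrightarrow> smooth_trunc \<eta> z = 1 + \<eta>"
  using \<eta> by (simp add: smooth_trunc_def)

lemma smooth_trunc_le: "smooth_trunc \<eta> z \<le> 1 + \<eta>"
proof -
  have "z\<^sup>2 \<le> 1" if "\<bar>z\<bar> \<le> 1" using that by (simp add: abs_square_le_1)
  then show ?thesis using \<eta> by (fastforce simp: smooth_trunc_def)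
qed

lemma smooth_trunc_ge_1: "1 \<le> \<bar>z\<bar> \<Longrightarrow> 1 \<le> smooth_trunc \<eta> z"
proof (cases "\<bar>z\<bar> \<le> 1 + \<eta>")
  case True
  assume z: "1 \<le> \<bar>z\<bar>"
  have "(1 + \<eta> - \<bar>z\<bar>)\<^sup>2 \<le> \<eta>\<^sup>2" using True z \<eta> by (intro power_mono) auto
  then have "(1 + \<eta> - \<bar>z\<bar>)\<^sup>2 / \<eta> \<le> \<eta>" using \<eta> by (simp add: divide_le_eq power2_eq_square)
  then show ?thesis using smooth_trunc_middle[OF z True] by simp
qed (use \<eta> in \<open>simp add: smooth_trunc_outer\<close>)

lemma smooth_trunc_ge: "min (z\<^sup>2) 1 \<le> smooth_trunc \<eta> z"
  using smooth_trunc_ge_1[of z] by (cases "\<bar>z\<bar> \<le> 1") (auto simp: smooth_trunc_def)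

lemma smooth_trunc_nonneg: "0 \<le> smooth_trunc \<eta> z"
  by (rule order.trans[OF _ smooth_trunc_ge]) simp

lemma smooth_trunc_le_min: "smooth_trunc \<eta> z \<le> (1 + \<eta>) * min (z\<^sup>2) 1"
proof (cases "\<bar>z\<bar> \<le> 1")
  case True
  then have "smooth_trunc \<eta> z = 1 * z\<^sup>2" "min (z\<^sup>2) 1 = z\<^sup>2"
    by (auto simp: smooth_trunc_def abs_square_le_1)
  then show ?thesis using \<eta> mult_right_mono[of 1 "1 + \<eta>" "z\<^sup>2"] by simp
next
  case False
  then have "1 \<le> z\<^sup>2" using abs_square_le_1[of z] by linarith
  then show ?thesis using smooth_trunc_le by simp
qed

lemma smooth_trunc_le_square: "smooth_trunc \<eta> z \<le> z\<^sup>2"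
proof -
  consider "\<bar>z\<bar> \<le> 1" | "1 \<le> \<bar>z\<bar>" "\<bar>z\<bar> \<le> 1 + \<eta>" | "1 + \<eta> \<le> \<bar>z\<bar>" by linarith
  then show ?thesis
  proof cases
    case 2
    define s where "s = \<bar>z\<bar> - 1"
    have "z\<^sup>2 = (1 + s)\<^sup>2" by (simp add: s_def)
    moreover have "(1 + \<eta> - \<bar>z\<bar>)\<^sup>2 / \<eta> = \<eta> - 2 * s + s\<^sup>2 / \<eta>"
      using \<eta> by (simp add: s_def field_simps power2_eq_square)
    moreover have "0 \<le> s\<^sup>2 / \<eta>" using \<eta> by simp
    moreover have "(1 + s)\<^sup>2 = 1 + 2 * s + s\<^sup>2" by (simp add: power2_sum)
    ultimately show ?thesis
      using smooth_trunc_middle[OF 2] zero_le_power2[of s] by linarith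
  next
    case 3
    have "1 + \<eta> \<le> (1 + \<eta>) * (1 + \<eta>)" using \<eta> by (simp add: algebra_simps)
    also have "\<dots> \<le> \<bar>z\<bar> * \<bar>z\<bar>" using 3 \<eta> by (intro mult_mono) auto
    finally show ?thesis using smooth_trunc_outer[OF 3] by (simp add: power2_eq_square)
  qed (simp add: smooth_trunc_def)
qed

text \<open>\<open>smooth_trunc \<eta>\<close> is a concave function of the square of its argument.\<close>

lemma smooth_trunc_tangent:
  assumes x: "0 \<le> x"
  shows "\<exists>\<beta>. (\<forall>z. smooth_trunc \<eta> z \<le> smooth_trunc \<eta> x + \<beta> * (z\<^sup>2 - x\<^sup>2)) \<and>
    (\<forall>y. 0 \<le> y \<longrightarrow> y \<le> x \<longrightarrow> \<beta> * y\<^sup>2 \<le> smooth_trunc \<eta> y)"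
proof -
  consider "x \<le> 1" | "1 \<le> x" "x \<le> 1 + \<eta>" | "1 + \<eta> \<le> x" by linarith
  then show ?thesis
  proof cases
    case 1
    show ?thesis
      by (rule exI[of _ 1]) (use 1 x smooth_trunc_le_square in \<open>auto simp: smooth_trunc_def\<close>)
  next
    case 2
    define b where "b = 1 + \<eta>"
    \<comment> \<open>The derivative of \<open>smooth_trunc \<eta>\<close> at \<open>x\<close> with
      respect to the square of its argument.\<close>
    define \<beta> where "\<beta> = (b - x) / (\<eta> * x)"
    have \<beta>0: "0 \<le> \<beta>" using 2 \<eta> by (simp add: \<beta>_def b_def)
    have "b \<le> b * x" using 2 \<eta> mult_left_mono[of 1 x b] by (simp add: b_def)
    then have \<beta>1: "\<beta> \<le> 1" using 2 \<eta> by (simp add: \<beta>_def b_def divide_le_eq algebra_simps)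
    have hx: "smooth_trunc \<eta> x = b - (b - x)\<^sup>2 / \<eta>"
      using smooth_trunc_middle[of x] 2 by (simp add: b_def)
    have mid: "b - (b - z)\<^sup>2 / \<eta> \<le> smooth_trunc \<eta> x + \<beta> * (z\<^sup>2 - x\<^sup>2)" for z
    proof -
      have "smooth_trunc \<eta> x + \<beta> * (z\<^sup>2 - x\<^sup>2) - (b - (b - z)\<^sup>2 / \<eta>) = b * (z - x)\<^sup>2 / (\<eta> * x)"
        unfolding hx \<beta>_def using 2 \<eta> by (simp add: divide_simps) (simp add: power2_eq_square algebra_simps)
      moreover have "0 \<le> b * (z - x)\<^sup>2 / (\<eta> * x)" using 2 \<eta> by (simp add: b_def)
      ultimately show ?thesis by linarith
    qed
    have "smooth_trunc \<eta> z \<le> smooth_trunc \<eta> x + \<beta> * (z\<^sup>2 - x\<^sup>2)" for z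
    proof -
      consider "\<bar>z\<bar> \<le> 1" | "1 \<le> \<bar>z\<bar>" "\<bar>z\<bar> \<le> b" | "b \<le> \<bar>z\<bar>" by linarith
      then show ?thesis
      proof cases
        case 1
        then have "z\<^sup>2 \<le> 1" by (simp add: abs_square_le_1)
        then have "(1 - \<beta>) * z\<^sup>2 \<le> (1 - \<beta>) * 1" using \<beta>1 by (intro mult_left_mono) auto
        moreover have "1 \<le> smooth_trunc \<eta> x + \<beta> * (1 - x\<^sup>2)"
          using mid[of 1] \<eta> by (simp add: b_def power2_eq_square)
        ultimately show ?thesis using 1 by (simp add: smooth_trunc_def algebra_simps)
      next
        case 2
        then show ?thesis using mid[of "\<bar>z\<bar>"] smooth_trunc_middle[of z] by (simp add: b_def)
      next
        case 3
        then have "b\<^sup>2 \<le> z\<^sup>2" using \<eta> by (metis abs_le_square_iff abs_of_pos b_def add_pos_pos zero_less_one)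
        then have "\<beta> * (b\<^sup>2 - x\<^sup>2) \<le> \<beta> * (z\<^sup>2 - x\<^sup>2)" using \<beta>0 by (intro mult_left_mono) auto
        then show ?thesis using mid[of b] smooth_trunc_outer[of z] 3 by (simp add: b_def)
      qed
    qed
    \<comment> \<open>Concavity and the value 0 at 0: the slope at \<open>x\<close> is at most the
      slope of the chord from 0 to any smaller \<open>y\<close>.\<close>
    moreover have "\<beta> * y\<^sup>2 \<le> smooth_trunc \<eta> y" if y: "0 \<le> y" "y \<le> x" for y
    proof (cases "y \<le> 1")
      case True
      then show ?thesis using y \<beta>1 mult_right_mono[of \<beta> 1 "y\<^sup>2"] by (simp add: smooth_trunc_def)
    next
      case False
      have "\<beta> * y\<^sup>2 = ((b - x) * y) * (y / x) / \<eta>" by (simp add: \<beta>_def power2_eq_square ac_simps)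
      also have "\<dots> \<le> ((b - x) * y) * 1 / \<eta>"
        using y 2 \<eta> by (intro divide_right_mono mult_left_mono) (auto simp: b_def)
      also have "\<dots> \<le> (b - y) * y / \<eta>"
        using y 2 \<eta> by (intro divide_right_mono) (auto simp: b_def intro!: mult_right_mono)
      also have "\<dots> = b * (b - y) / \<eta> - (b - y)\<^sup>2 / \<eta>"
        by (simp add: power2_eq_square diff_divide_distrib[symmetric] algebra_simps)
      also have "b * (b - y) / \<eta> \<le> b"
        using False \<eta> mult_left_mono[of "b - y" \<eta> b] by (simp add: divide_le_eq b_def)
      finally show ?thesis using smooth_trunc_middle[of y] y False 2 by (simp add: b_def)
    qed
    ultimately show ?thesis by blast
  next
    case 3
    show ?thesis
      by (rule exI[of _ 0]) (use 3 smooth_trunc_le smooth_trunc_nonneg smooth_trunc_outer[of x] \<eta> in auto)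
  qed
qed

text \<open>The tangent at the larger argument \<open>\<bar>x\<bar>\<close> is evaluated at
  \<open>x + y\<close> and \<open>x - y\<close>. Their squares exceed \<open>x\<^sup>2\<close> by
  \<open>2 * y\<^sup>2\<close> in total, and the slope times \<open>y\<^sup>2\<close> is at most the
  value at \<open>y\<close>.\<close>

lemma smooth_trunc_add_le:
  "smooth_trunc \<eta> (x + y) + smooth_trunc \<eta> (x - y) \<le> 2 * (smooth_trunc \<eta> x + smooth_trunc \<eta> y)"
proof -
  have *: "smooth_trunc \<eta> (x + y) + smooth_trunc \<eta> (x - y) \<le> 2 * (smooth_trunc \<eta> x + smooth_trunc \<eta> y)"
    if "\<bar>y\<bar> \<le> \<bar>x\<bar>" for x y
  proof -
    obtain \<beta> where \<beta>: "\<And>z. smooth_trunc \<eta> z \<le> smooth_trunc \<eta> \<bar>x\<bar> + \<beta> * (z\<^sup>2 - \<bar>x\<bar>\<^sup>2)"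
        "\<And>y. 0 \<le> y \<Longrightarrow> y \<le> \<bar>x\<bar> \<Longrightarrow> \<beta> * y\<^sup>2 \<le> smooth_trunc \<eta> y"
      using smooth_trunc_tangent[OF abs_ge_zero[of x]] by blast
    define P where "P = (x + y)\<^sup>2 - x\<^sup>2"
    define N where "N = (x - y)\<^sup>2 - x\<^sup>2"
    have "\<beta> * P + \<beta> * N = 2 * (\<beta> * y\<^sup>2)"
      by (simp add: P_def N_def power2_eq_square algebra_simps)
    moreover have "\<beta> * y\<^sup>2 \<le> smooth_trunc \<eta> y" using \<beta>(2)[of "\<bar>y\<bar>"] that by simp
    moreover have "smooth_trunc \<eta> (x + y) \<le> smooth_trunc \<eta> x + \<beta> * P"
      "smooth_trunc \<eta> (x - y) \<le> smooth_trunc \<eta> x + \<beta> * N"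
      using \<beta>(1)[of "x + y"] \<beta>(1)[of "x - y"] by (simp_all add: P_def N_def)
    ultimately show ?thesis by argo
  qed
  show ?thesis
  proof (cases "\<bar>y\<bar> \<le> \<bar>x\<bar>")
    case False
    then show ?thesis
      using *[of x y] smooth_trunc_uminus[of \<eta> "x - y"] by (simp add: add.commute)
  qed (rule *)
qed

text \<open>\<open>\<lambda>z. smooth_trunc \<eta> z + z\<^sup>2 / \<eta>\<close> is convex.\<close>

lemma smooth_trunc_parabola:
  assumes x: "0 \<le> x"
  shows "\<exists>d. \<forall>z. smooth_trunc \<eta> x + d * (z - x) - (z - x)\<^sup>2 / \<eta> \<le> smooth_trunc \<eta> z"
proof -
  define b where "b = 1 + \<eta>"
  have inner: "b - (b - z)\<^sup>2 / \<eta> \<le> z\<^sup>2" for z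
  proof -
    have "z\<^sup>2 - (b - (b - z)\<^sup>2 / \<eta>) = b * (1 - z)\<^sup>2 / \<eta>"
      using \<eta> by (simp add: b_def divide_simps) (simp add: power2_eq_square algebra_simps)
    moreover have "0 \<le> b * (1 - z)\<^sup>2 / \<eta>" using \<eta> by (simp add: b_def)
    ultimately show ?thesis by linarith
  qed
  \<comment> \<open>A nonnegative slope that works on the half-line works everywhere: by evenness
    \<open>z\<close> may be replaced by \<open>\<bar>z\<bar>\<close>, which is at least
    \<open>z\<close> and no farther from \<open>x\<close>.\<close>
  have nonneg: "\<exists>d\<ge>0. \<forall>z\<ge>0. smooth_trunc \<eta> x + d * (z - x) - (z - x)\<^sup>2 / \<eta> \<le> smooth_trunc \<eta> z"
  proof -
    consider "x \<le> 1" | "1 \<le> x" "x \<le> b" | "b \<le> x" by linarith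
    then show ?thesis
    proof cases
      case 1
      have hx: "smooth_trunc \<eta> x = x\<^sup>2" using 1 x by (simp add: smooth_trunc_def)
      have slope: "0 \<le> b - x - \<eta> * x" using mult_left_mono[OF 1, of "1 + \<eta>"] \<eta> by (simp add: b_def algebra_simps)
      have "x\<^sup>2 + 2 * x * (z - x) - (z - x)\<^sup>2 / \<eta> \<le> smooth_trunc \<eta> z" if z: "0 \<le> z" for z
      proof -
        have "0 \<le> (z - x)\<^sup>2 / \<eta>" using \<eta> by simp
        consider "z \<le> 1" | "1 \<le> z" "z \<le> b" | "b \<le> z" by linarith
        then show ?thesis
        proof cases
          case 1
          have "x\<^sup>2 + 2 * x * (z - x) \<le> z\<^sup>2"
            using zero_le_power2[of "z - x"] by (simp add: power2_eq_square algebra_simps)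
          then show ?thesis using 1 z \<open>0 \<le> (z - x)\<^sup>2 / \<eta>\<close> by (simp add: smooth_trunc_def)
        next
          case 2
          have "b - (b - z)\<^sup>2 / \<eta> - (x\<^sup>2 + 2 * x * (z - x) - (z - x)\<^sup>2 / \<eta>)
              = (1 - x)\<^sup>2 * b / \<eta> + 2 * (b - x - \<eta> * x) * (z - 1) / \<eta>"
            using \<eta> by (simp add: b_def divide_simps) (simp add: power2_eq_square algebra_simps)
          moreover have "0 \<le> (1 - x)\<^sup>2 * b / \<eta>" "0 \<le> 2 * (b - x - \<eta> * x) * (z - 1) / \<eta>"
            using \<eta> slope 2 by (auto simp: b_def intro!: divide_nonneg_nonneg mult_nonneg_nonneg)
          moreover have "smooth_trunc \<eta> z = b - (b - z)\<^sup>2 / \<eta>"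
            using smooth_trunc_middle[of z] 2 z by (simp add: b_def)
          ultimately show ?thesis by linarith
        next
          case 3
          have "b - (x\<^sup>2 + 2 * x * (z - x) - (z - x)\<^sup>2 / \<eta>)
              = (1 - x)\<^sup>2 * b / \<eta> + 2 * (b - x - \<eta> * x) * (z - 1) / \<eta> + (b - z)\<^sup>2 / \<eta>"
            using \<eta> by (simp add: b_def divide_simps) (simp add: power2_eq_square algebra_simps)
          moreover have "1 \<le> z" using 3 \<eta> by (simp add: b_def)
          then have "0 \<le> (1 - x)\<^sup>2 * b / \<eta>" "0 \<le> 2 * (b - x - \<eta> * x) * (z - 1) / \<eta>" "0 \<le> (b - z)\<^sup>2 / \<eta>"
            using \<eta> slope by (auto simp: b_def intro!: divide_nonneg_nonneg mult_nonneg_nonneg)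
          moreover have "smooth_trunc \<eta> z = b" using smooth_trunc_outer[of z] 3 z by (simp add: b_def)
          ultimately show ?thesis by linarith
        qed
      qed
      then show ?thesis using x hx by (intro exI[of _ "2 * x"]) auto
    next
      case 2
      have hx: "smooth_trunc \<eta> x = b - (b - x)\<^sup>2 / \<eta>"
        using smooth_trunc_middle[of x] 2 x by (simp add: b_def)
      have eq: "smooth_trunc \<eta> x + 2 * (b - x) / \<eta> * (z - x) - (z - x)\<^sup>2 / \<eta> = b - (b - z)\<^sup>2 / \<eta>" for z
        unfolding hx using \<eta> by (simp add: divide_simps) (simp add: power2_eq_square algebra_simps)
      have "b - (b - z)\<^sup>2 / \<eta> \<le> smooth_trunc \<eta> z" if z: "0 \<le> z" for z
      proof -
        consider "z \<le> 1" | "1 \<le> z" "z \<le> b" | "b \<le> z" by linarith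
        then show ?thesis
        proof cases
          case 1
          then show ?thesis using inner[of z] z by (simp add: smooth_trunc_def)
        next
          case 2
          then show ?thesis using smooth_trunc_middle[of z] z by (simp add: b_def)
        next
          case 3
          then show ?thesis using smooth_trunc_outer[of z] z \<eta> by (simp add: b_def)
        qed
      qed
      moreover have "0 \<le> 2 * (b - x) / \<eta>" using 2 \<eta> by simp
      ultimately show ?thesis unfolding eq[symmetric] by blast
    next
      case 3
      have hx: "smooth_trunc \<eta> x = b" using smooth_trunc_outer[of x] 3 x by (simp add: b_def)
      have "b - (z - x)\<^sup>2 / \<eta> \<le> smooth_trunc \<eta> z" if z: "0 \<le> z" for z
      proof (cases "b \<le> z")
        case True
        then show ?thesis using smooth_trunc_outer[of z] z \<eta> by (simp add: b_def)
      next
        case False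
        then have "(b - z)\<^sup>2 \<le> (x - z)\<^sup>2" using 3 by (intro power_mono) auto
        then have "(b - z)\<^sup>2 / \<eta> \<le> (z - x)\<^sup>2 / \<eta>" using \<eta> by (simp add: divide_right_mono power2_commute)
        moreover have "b - (b - z)\<^sup>2 / \<eta> \<le> smooth_trunc \<eta> z"
          using inner[of z] smooth_trunc_middle[of z] z False
          by (cases "z \<le> 1") (auto simp: smooth_trunc_def b_def)
        ultimately show ?thesis by linarith
      qed
      then show ?thesis using hx by (intro exI[of _ 0]) auto
    qed
  qed
  then obtain d where d: "0 \<le> d"
    "\<And>z. 0 \<le> z \<Longrightarrow> smooth_trunc \<eta> x + d * (z - x) - (z - x)\<^sup>2 / \<eta> \<le> smooth_trunc \<eta> z" by blast
  have "smooth_trunc \<eta> x + d * (z - x) - (z - x)\<^sup>2 / \<eta> \<le> smooth_trunc \<eta> z" for z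
  proof -
    have "d * (z - x) \<le> d * (\<bar>z\<bar> - x)" using d(1) by (intro mult_left_mono) auto
    moreover have "(\<bar>z\<bar> - x)\<^sup>2 \<le> (z - x)\<^sup>2" using x by (intro abs_le_square_iff[THEN iffD1]) auto
    then have "(\<bar>z\<bar> - x)\<^sup>2 / \<eta> \<le> (z - x)\<^sup>2 / \<eta>" using \<eta> by (simp add: divide_right_mono)
    ultimately show ?thesis using d(2)[of "\<bar>z\<bar>"] by simp
  qed
  then show ?thesis by blast
qed

lemma smooth_trunc_add_ge_parabola:
  "2 * (smooth_trunc \<eta> x - y\<^sup>2 / \<eta>) \<le> smooth_trunc \<eta> (x + y) + smooth_trunc \<eta> (x - y)"
proof -
  have *: "2 * (smooth_trunc \<eta> x - y\<^sup>2 / \<eta>) \<le> smooth_trunc \<eta> (x + y) + smooth_trunc \<eta> (x - y)"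
    if x: "0 \<le> x" for x y
  proof -
    obtain d where d: "\<And>z. smooth_trunc \<eta> x + d * (z - x) - (z - x)\<^sup>2 / \<eta> \<le> smooth_trunc \<eta> z"
      using smooth_trunc_parabola[OF x] by blast
    show ?thesis using d[of "x + y"] d[of "x - y"] by simp
  qed
  show ?thesis
  proof (cases "0 \<le> x")
    case False
    then show ?thesis
      using *[of "- x" y] smooth_trunc_uminus[of \<eta> "x + y"] smooth_trunc_uminus[of \<eta> "x - y"]
      by (simp add: add.commute)
  qed (rule *)
qed

text \<open>Additivity up to a product. Let \<open>\<bar>y\<bar> \<le> \<bar>x\<bar>\<close>. Near 0
  the parallelogram law is exact. For \<open>\<bar>x\<bar> \<ge> 1 / 2\<close> the value at
  \<open>x\<close> is at least \<open>1 / 4\<close>, and \<open>C\<close> is chosen so that the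
  product term then pays for both \<open>y\<^sup>2\<close> and the parabola loss
  \<open>y\<^sup>2 / \<eta>\<close>. If both arguments are at least 1 in absolute value, the left
  side is not positive.\<close>

lemma smooth_trunc_add_ge:
  fixes C :: real
  defines "C \<equiv> 4 * (1 + 1 / \<eta>)"
  shows "2 * (smooth_trunc \<eta> x + smooth_trunc \<eta> y - C * smooth_trunc \<eta> x * smooth_trunc \<eta> y)
    \<le> smooth_trunc \<eta> (x + y) + smooth_trunc \<eta> (x - y)"
proof -
  have C: "4 \<le> C" using \<eta> by (simp add: C_def)
  have *: "2 * (smooth_trunc \<eta> x + smooth_trunc \<eta> y - C * (smooth_trunc \<eta> x * smooth_trunc \<eta> y))
      \<le> smooth_trunc \<eta> (x + y) + smooth_trunc \<eta> (x - y)" if yx: "\<bar>y\<bar> \<le> \<bar>x\<bar>" for x y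
  proof -
    define X where "X = smooth_trunc \<eta> x"
    define Y where "Y = smooth_trunc \<eta> y"
    have XY: "0 \<le> X" "0 \<le> Y" unfolding X_def Y_def by (rule smooth_trunc_nonneg)+
    consider "\<bar>x\<bar> + \<bar>y\<bar> \<le> 1" | "1 / 2 \<le> \<bar>x\<bar>" "\<bar>y\<bar> \<le> 1" | "1 \<le> \<bar>y\<bar>" using yx by linarith
    then show ?thesis
    proof cases
      case 1
      then have "\<bar>x + y\<bar> \<le> 1" "\<bar>x - y\<bar> \<le> 1" "\<bar>x\<bar> \<le> 1" "\<bar>y\<bar> \<le> 1" by linarith+
      then have "smooth_trunc \<eta> (x + y) + smooth_trunc \<eta> (x - y) = (x + y)\<^sup>2 + (x - y)\<^sup>2"
          "X = x\<^sup>2" "Y = y\<^sup>2"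
        by (simp_all only: X_def Y_def smooth_trunc_def if_True)
      then have "smooth_trunc \<eta> (x + y) + smooth_trunc \<eta> (x - y) = 2 * (X + Y)"
        by (simp add: power2_eq_square algebra_simps)
      moreover have "0 \<le> C * (X * Y)" using C XY by simp
      ultimately show ?thesis unfolding X_def Y_def by argo
    next
      case 2
      have "(1 / 2)\<^sup>2 \<le> \<bar>x\<bar>\<^sup>2" using 2 by (intro power_mono) auto
      then have "1 / 4 \<le> min (x\<^sup>2) 1" by (simp add: power2_eq_square)
      then have "1 / 4 \<le> X" unfolding X_def using smooth_trunc_ge order.trans by blast
      then have "C * (1 / 4) * Y \<le> C * X * Y" using C XY by (intro mult_mono) auto
      moreover have "Y = y\<^sup>2" using 2 by (simp add: Y_def smooth_trunc_def)
      moreover have "C * (1 / 4) * y\<^sup>2 = y\<^sup>2 + y\<^sup>2 / \<eta>" by (simp add: C_def algebra_simps)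
      ultimately have "X + Y - C * (X * Y) \<le> X - y\<^sup>2 / \<eta>" by (simp add: mult.assoc)
      then show ?thesis using smooth_trunc_add_ge_parabola[of x y] unfolding X_def Y_def by argo
    next
      case 3
      have "1 \<le> X" "1 \<le> Y" unfolding X_def Y_def using 3 yx by (auto intro: smooth_trunc_ge_1)
      then have "X \<le> X * Y" "Y \<le> X * Y" using XY by (auto simp: mult_le_cancel_left1 mult_le_cancel_right1)
      moreover have "4 * (X * Y) \<le> C * (X * Y)" using C XY by (intro mult_right_mono) auto
      moreover have "0 \<le> X * Y" using XY by simp
      ultimately have "X + Y - C * (X * Y) \<le> 0" by linarith
      moreover have "0 \<le> smooth_trunc \<eta> (x + y) + smooth_trunc \<eta> (x - y)"
        by (intro add_nonneg_nonneg smooth_trunc_nonneg)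
      ultimately show ?thesis unfolding X_def Y_def by argo
    qed
  qed
  show ?thesis
  proof (cases "\<bar>y\<bar> \<le> \<bar>x\<bar>")
    case True
    then show ?thesis using *[of y x] by (simp add: mult.assoc)
  next
    case False
    then show ?thesis
      using *[of x y] smooth_trunc_uminus[of \<eta> "x - y"] by (simp add: ac_simps)
  qed
qed

end

section \<open>Sparse random signs\<close>

definition sparse_sign :: "real \<Rightarrow> int pmf" where
  "sparse_sign p =
     map_pmf (\<lambda>(b, s). if b then if s then 1 else - 1 else 0) (pair_pmf (bernoulli_pmf p) (bernoulli_pmf (1 / 2)))"

lemma set_sparse_sign: "set_pmf (sparse_sign p) \<subseteq> {- 1, 0, 1}"
  by (auto simp: sparse_sign_def split: if_splits)

lemma expectation_bind_pmf_finite: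
  fixes h :: "'b \<Rightarrow> real"
  assumes "finite (set_pmf p)" "\<And>x. x \<in> set_pmf p \<Longrightarrow> finite (set_pmf (f x))"
  shows "measure_pmf.expectation (bind_pmf p f) h
    = measure_pmf.expectation p (\<lambda>x. measure_pmf.expectation (f x) h)"
  by (subst pmf_expectation_bind[OF assms(1) _ order.refl], use assms(2) in blast,
      subst integral_measure_pmf[OF assms(1)]) auto

lemma expectation_sparse_sign:
  fixes g :: "int \<Rightarrow> real"
  assumes "0 \<le> p" "p \<le> 1"
  shows "measure_pmf.expectation (sparse_sign p) g = (1 - p) * g 0 + p * ((g 1 + g (- 1)) / 2)"
proof -
  have "measure_pmf.expectation (sparse_sign p) g
    = measure_pmf.expectation (bernoulli_pmf p) (\<lambda>b. measure_pmf.expectation (bernoulli_pmf (1 / 2))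
        (\<lambda>s. g (if b then if s then 1 else - 1 else 0)))"
    unfolding sparse_sign_def pair_pmf_def
    by (simp add: expectation_bind_pmf_finite del: integral_bernoulli_pmf)
  then show ?thesis using assms by (simp add: field_simps)
qed

abbreviation sparse_sign_vec :: "nat \<Rightarrow> real \<Rightarrow> (nat \<Rightarrow> int) pmf" where
  "sparse_sign_vec n p \<equiv> Pi_pmf {..<n} 0 (\<lambda>_. sparse_sign p)"

lemma set_sparse_sign_vec: "c \<in> set_pmf (sparse_sign_vec n p) \<Longrightarrow> \<bar>c i\<bar> \<le> 1"
  using set_sparse_sign[of p] by (cases "i < n") (fastforce simp: set_Pi_pmf PiE_dflt_def)+

lemma finite_set_sparse_sign_vec: "finite (set_pmf (sparse_sign_vec n p))"
  by (auto simp: set_Pi_pmf intro!: finite_PiE_dflt finite_subset[OF set_sparse_sign])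

definition sketch_mean :: "real \<Rightarrow> nat \<Rightarrow> real \<Rightarrow> (nat \<Rightarrow> real) \<Rightarrow> real" where
  "sketch_mean \<eta> n p a =
     measure_pmf.expectation (sparse_sign_vec n p) (\<lambda>c. smooth_trunc \<eta> (\<Sum>i<n. real_of_int (c i) * a i))"

context
  fixes \<eta> p :: real and a :: "nat \<Rightarrow> real"
  assumes \<eta>: "0 < \<eta>" and p: "0 \<le> p" "p \<le> 1"
begin

text \<open>Conditioning on all signs but the last, the step of both inductions below.\<close>

lemma sketch_mean_Suc:
  "sketch_mean \<eta> (Suc n) p a = measure_pmf.expectation (sparse_sign_vec n p)
     (\<lambda>c. let z = (\<Sum>i<n. real_of_int (c i) * a i) in
        (1 - p) * smooth_trunc \<eta> z + p * ((smooth_trunc \<eta> (z + a n) + smooth_trunc \<eta> (z - a n)) / 2))"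
proof -
  define Z where "Z c = (\<Sum>i<n. real_of_int (c i) * a i)" for c
  have "sparse_sign_vec (Suc n) p
      = bind_pmf (sparse_sign_vec n p) (\<lambda>c. map_pmf (\<lambda>y. c(n := y)) (sparse_sign p))"
    unfolding lessThan_Suc map_pmf_def by (subst Pi_pmf_insert') (auto simp: bind_commute_pmf[of "sparse_sign p"])
  then have "sketch_mean \<eta> (Suc n) p a = measure_pmf.expectation (sparse_sign_vec n p)
      (\<lambda>c. measure_pmf.expectation (sparse_sign p)
        (\<lambda>y. smooth_trunc \<eta> (\<Sum>i<Suc n. real_of_int ((c(n := y)) i) * a i)))"
    unfolding sketch_mean_def
    by (simp add: expectation_bind_pmf_finite finite_set_sparse_sign_vec finite_subset[OF set_sparse_sign]
        del: sum.lessThan_Suc)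
  moreover have "(\<Sum>i<Suc n. real_of_int ((c(n := y)) i) * a i) = Z c + real_of_int y * a n" for c y
    by (simp add: Z_def)
  ultimately show ?thesis
    by (simp add: expectation_sparse_sign[OF p] Let_def flip: Z_def)
qed

lemma integrable_sparse_sign_vec [simp]:
  "integrable (measure_pmf (sparse_sign_vec n p)) (f :: _ \<Rightarrow> real)"
  by (rule integrable_measure_pmf_finite[OF finite_set_sparse_sign_vec])

lemma sketch_mean_le: "sketch_mean \<eta> n p a \<le> p * (\<Sum>i<n. smooth_trunc \<eta> (a i))"
proof (induction n)
  case 0
  then show ?case by (simp add: sketch_mean_def)
next
  case (Suc n)
  have "sketch_mean \<eta> (Suc n) p a \<le> measure_pmf.expectation (sparse_sign_vec n p)
     (\<lambda>c. smooth_trunc \<eta> (\<Sum>i<n. real_of_int (c i) * a i) + p * smooth_trunc \<eta> (a n))"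
    unfolding sketch_mean_Suc
  proof (rule integral_mono)
    fix c
    define z where "z = (\<Sum>i<n. real_of_int (c i) * a i)"
    have "p * ((smooth_trunc \<eta> (z + a n) + smooth_trunc \<eta> (z - a n)) / 2)
        \<le> p * (smooth_trunc \<eta> z + smooth_trunc \<eta> (a n))"
      using smooth_trunc_add_le[OF \<eta>, of z "a n"] p by (intro mult_left_mono) auto
    then show "(let z = (\<Sum>i<n. real_of_int (c i) * a i) in
        (1 - p) * smooth_trunc \<eta> z + p * ((smooth_trunc \<eta> (z + a n) + smooth_trunc \<eta> (z - a n)) / 2))
      \<le> smooth_trunc \<eta> (\<Sum>i<n. real_of_int (c i) * a i) + p * smooth_trunc \<eta> (a n)"
      unfolding z_def[symmetric] Let_def by (simp add: algebra_simps)
  qed simp_all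
  also have "\<dots> = sketch_mean \<eta> n p a + p * smooth_trunc \<eta> (a n)"
    by (simp add: sketch_mean_def)
  finally show ?case using Suc by (simp add: distrib_left)
qed

text \<open>Coordinate \<open>n\<close> loses at most \<open>p * C * h\<close> times the current
  sketch mean, which is at most \<open>p * S n\<close> by the upper bound. The accumulated losses
  are cross terms in the expansion of \<open>C * (p * S n)\<^sup>2\<close>.\<close>

lemma sketch_mean_ge:
  fixes C :: real and n :: nat
  defines "C \<equiv> 4 * (1 + 1 / \<eta>)" and "S \<equiv> \<lambda>n. \<Sum>i<n. smooth_trunc \<eta> (a i)"
  shows "p * S n - C * (p * S n)\<^sup>2 \<le> sketch_mean \<eta> n p a"
proof (induction n)
  case 0
  then show ?case by (simp add: S_def sketch_mean_def)
next
  case (Suc n)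
  define h where "h = smooth_trunc \<eta> (a n)"
  have h: "0 \<le> h" unfolding h_def by (rule smooth_trunc_nonneg[OF \<eta>])
  have S: "0 \<le> S n" unfolding S_def by (intro sum_nonneg smooth_trunc_nonneg \<eta>)
  have C: "0 \<le> C" using \<eta> by (simp add: C_def)
  have SSuc: "S (Suc n) = S n + h" by (simp add: S_def h_def)
  have "sketch_mean \<eta> n p a + p * h - p * C * h * sketch_mean \<eta> n p a
    = measure_pmf.expectation (sparse_sign_vec n p)
     (\<lambda>c. smooth_trunc \<eta> (\<Sum>i<n. real_of_int (c i) * a i) + p * h
        - p * C * h * smooth_trunc \<eta> (\<Sum>i<n. real_of_int (c i) * a i))"
    by (simp add: sketch_mean_def)
  also have "\<dots> \<le> sketch_mean \<eta> (Suc n) p a"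
    unfolding sketch_mean_Suc
  proof (rule integral_mono)
    fix c
    define z where "z = (\<Sum>i<n. real_of_int (c i) * a i)"
    have "p * (smooth_trunc \<eta> z + h - C * smooth_trunc \<eta> z * h)
        \<le> p * ((smooth_trunc \<eta> (z + a n) + smooth_trunc \<eta> (z - a n)) / 2)"
      using smooth_trunc_add_ge[OF \<eta>, of z "a n"] p by (intro mult_left_mono) (auto simp: C_def h_def)
    moreover have "p * (smooth_trunc \<eta> z + h - C * smooth_trunc \<eta> z * h)
        = p * smooth_trunc \<eta> z + p * h - p * C * h * smooth_trunc \<eta> z"
      by (simp add: algebra_simps)
    moreover have "(1 - p) * smooth_trunc \<eta> z = smooth_trunc \<eta> z - p * smooth_trunc \<eta> z"
      by (simp add: left_diff_distrib)
    ultimately show "smooth_trunc \<eta> (\<Sum>i<n. real_of_int (c i) * a i) + p * h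
        - p * C * h * smooth_trunc \<eta> (\<Sum>i<n. real_of_int (c i) * a i)
      \<le> (let z = (\<Sum>i<n. real_of_int (c i) * a i) in
        (1 - p) * smooth_trunc \<eta> z + p * ((smooth_trunc \<eta> (z + a n) + smooth_trunc \<eta> (z - a n)) / 2))"
      unfolding z_def[symmetric] Let_def by linarith
  qed simp_all
  finally have step: "sketch_mean \<eta> n p a + p * h - p * C * h * sketch_mean \<eta> n p a
      \<le> sketch_mean \<eta> (Suc n) p a" .
  have "p * C * h * sketch_mean \<eta> n p a \<le> p * C * h * (p * S n)"
    unfolding S_def using p C h by (intro mult_left_mono sketch_mean_le) auto
  moreover have "(p * S (Suc n))\<^sup>2 = (p * S n)\<^sup>2 + 2 * (p * h * (p * S n)) + (p * h)\<^sup>2"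
    unfolding SSuc by (simp add: power2_eq_square algebra_simps)
  then have "C * (p * S n)\<^sup>2 + C * (p * h * (p * S n)) + (C * (p * h * (p * S n)) + C * (p * h)\<^sup>2)
      = C * (p * S (Suc n))\<^sup>2"
    by (simp add: algebra_simps)
  moreover have "0 \<le> C * (p * h * (p * S n)) + C * (p * h)\<^sup>2" using C p h S by simp
  moreover have "p * C * h * (p * S n) = C * (p * h * (p * S n))" by simp
  moreover have "p * S (Suc n) = p * S n + p * h" by (simp add: SSuc distrib_left)
  ultimately show ?case using Suc step by linarith
qed

end

section \<open>From sketch means back to truncated sums\<close>

text \<open>Only the lower bound for the means of \<open>w\<close> and the upper bound for those of
  \<open>v\<close> enter, so the rate can be adapted to \<open>w\<close> alone. The denominator
  \<open>1 - 2 * \<eta>\<close> pays for bias and statistical error; of the three factors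
  \<open>1 + \<eta>\<close> one is due to smoothing and two to rounding \<open>T\<close> up to a
  grid of squares.\<close>

lemma truncated_sums_le_of_means_close:
  fixes v w :: "nat \<Rightarrow> int" and \<eta> M :: real
  assumes \<eta>: "0 < \<eta>" "\<eta> \<le> 1 / 4"
    and w: "\<And>i. i < n \<Longrightarrow> \<bar>real_of_int (w i)\<bar> \<le> M" and J: "M \<le> (1 + \<eta>) ^ J"
    and R: "2 * real n \<le> 2 ^ R * (\<eta>\<^sup>2 / 8)"
    and close: "\<And>r j. r \<le> R \<Longrightarrow> j \<le> J \<Longrightarrow>
      sketch_mean \<eta> n (1 / 2 ^ r) (\<lambda>i. real_of_int (w i) / (1 + \<eta>) ^ j)
      \<le> sketch_mean \<eta> n (1 / 2 ^ r) (\<lambda>i. real_of_int (v i) / (1 + \<eta>) ^ j) + 2 * (\<eta> ^ 3 / 32)"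
    and T: "0 \<le> T"
  shows "(\<Sum>i<n. min ((real_of_int (w i))\<^sup>2) T)
    \<le> (1 + \<eta>) ^ 3 / (1 - 2 * \<eta>) * (\<Sum>i<n. min ((real_of_int (v i))\<^sup>2) T)"
proof -
  \<comment> \<open>For \<open>s = p * S w j\<close> between \<open>\<tau> / 2\<close> and
    \<open>\<tau>\<close>, the bias \<open>C * s\<^sup>2\<close> is at most
    \<open>\<eta> * s\<close> because \<open>C * \<tau> \<le> \<eta>\<close>, and the statistical
    error \<open>\<eta> ^ 3 / 16\<close> is at most \<open>\<eta> * s\<close> as well.\<close>
  define \<tau> where "\<tau> = \<eta>\<^sup>2 / 8"
  define t where "t j = (1 + \<eta>) ^ j" for j :: nat
  define S where "S u j = (\<Sum>i<n. smooth_trunc \<eta> (real_of_int (u i) / t j))" for u j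
  define f where "f u T = (\<Sum>i<n. min ((real_of_int (u i))\<^sup>2) T)" for u T
  have \<tau>: "0 < \<tau>" "\<tau> < 1 / 4"
  proof -
    have "\<eta>\<^sup>2 \<le> 1\<^sup>2" using \<eta> by (intro power_mono) auto
    then show "0 < \<tau>" "\<tau> < 1 / 4" using \<eta> by (auto simp: \<tau>_def)
  qed
  have t: "1 \<le> t j" for j using \<eta> by (simp add: t_def)
  have tSuc: "t (Suc j) = (1 + \<eta>) * t j" for j by (simp add: t_def)
  have f_mono: "f u T \<le> f u T'" if "T \<le> T'" for u T T'
    unfolding f_def using that by (intro sum_mono) auto
  have f_nonneg: "0 \<le> f u T" if "0 \<le> T" for u T
    unfolding f_def using that by (intro sum_nonneg) auto
  have f_scale: "f u (c * T) \<le> c * f u T" if "1 \<le> c" "0 \<le> T" for u c T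
    unfolding f_def sum_distrib_left
  proof (rule sum_mono)
    fix i
    have "(real_of_int (u i))\<^sup>2 \<le> c * (real_of_int (u i))\<^sup>2"
      using that mult_right_mono[of 1 c "(real_of_int (u i))\<^sup>2"] by simp
    moreover have "T \<le> c * T" using that mult_right_mono[of 1 c T] by simp
    ultimately show "min ((real_of_int (u i))\<^sup>2) (c * T) \<le> c * min ((real_of_int (u i))\<^sup>2) T"
      using that by (auto simp: min_def intro: mult_left_mono)
  qed
  have S_nonneg: "0 \<le> S u j" for u j
    unfolding S_def by (intro sum_nonneg smooth_trunc_nonneg \<eta>)
  have S_f: "f u ((t j)\<^sup>2) \<le> (t j)\<^sup>2 * S u j" "(t j)\<^sup>2 * S u j \<le> (1 + \<eta>) * f u ((t j)\<^sup>2)" for u j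
  proof -
    have min: "min ((real_of_int (u i))\<^sup>2) ((t j)\<^sup>2) = (t j)\<^sup>2 * min ((real_of_int (u i) / t j)\<^sup>2) 1" for i
      using t[of j] by (auto simp: min_def power_divide divide_le_eq not_le less_divide_eq)
    show "f u ((t j)\<^sup>2) \<le> (t j)\<^sup>2 * S u j"
      unfolding f_def S_def min sum_distrib_left
      by (intro sum_mono mult_left_mono smooth_trunc_ge \<eta>) auto
    have "(t j)\<^sup>2 * smooth_trunc \<eta> (real_of_int (u i) / t j)
        \<le> (1 + \<eta>) * ((t j)\<^sup>2 * min ((real_of_int (u i) / t j)\<^sup>2) 1)" for i
      using mult_left_mono[OF smooth_trunc_le_min[OF \<eta>(1), of "real_of_int (u i) / t j"], of "(t j)\<^sup>2"]
      by (simp add: ac_simps)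
    then show "(t j)\<^sup>2 * S u j \<le> (1 + \<eta>) * f u ((t j)\<^sup>2)"
      unfolding f_def S_def min sum_distrib_left by (intro sum_mono)
  qed
  have S_le: "S u j \<le> 2 * real n" for u j
  proof -
    have "S u j \<le> (\<Sum>i<n. 2)"
      unfolding S_def by (intro sum_mono order.trans[OF smooth_trunc_le[OF \<eta>(1)]]) (use \<eta>(2) in auto)
    then show ?thesis by simp
  qed

  have direct: "(1 - 2 * \<eta>) * S w j \<le> S v j" if j: "j \<le> J" and big: "\<tau> \<le> S w j" for j
  proof -
    \<comment> \<open>The first halving that brings the mass to at most \<open>\<tau>\<close> leaves
      at least \<open>\<tau> / 2\<close>. It occurs by step \<open>R\<close> because the mass is at
      most \<open>2 * n\<close>.\<close>
    have "\<exists>r\<le>R. \<tau> / 2 \<le> S w j / 2 ^ r \<and> S w j / 2 ^ r \<le> \<tau>"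
    proof -
      have "S w j / 2 ^ R \<le> \<tau>"
        using order.trans[OF S_le R] by (simp add: divide_le_eq \<tau>_def mult.commute)
      then obtain r where r: "r \<le> R" "S w j / 2 ^ r \<le> \<tau>" "\<And>q. q < r \<Longrightarrow> \<not> S w j / 2 ^ q \<le> \<tau>"
        using ex_least_nat_le[of "\<lambda>r. S w j / 2 ^ r \<le> \<tau>" R] by blast
      have "\<tau> / 2 \<le> S w j / 2 ^ r"
      proof (cases r)
        case 0
        then show ?thesis using big \<tau> by simp
      next
        case (Suc q)
        then show ?thesis using r(3)[of q] by simp
      qed
      then show ?thesis using r by blast
    qed
    then obtain r where r: "r \<le> R" "\<tau> / 2 \<le> S w j / 2 ^ r" "S w j / 2 ^ r \<le> \<tau>" by blast
    define p where "p = (1 / 2 ^ r :: real)"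
    have p: "0 < p" "p \<le> 1" by (simp_all add: p_def)
    define s where "s = p * S w j"
    have s: "\<tau> / 2 \<le> s" "s \<le> \<tau>" using r by (simp_all add: s_def p_def)
    define C where "C = 4 * (1 + 1 / \<eta>)"
    have "C * s \<le> C * \<tau>" using s \<eta> by (intro mult_left_mono) (auto simp: C_def)
    also have "\<dots> \<le> \<eta>" using \<eta> by (simp add: C_def \<tau>_def field_simps power2_eq_square)
    finally have "C * s * s \<le> \<eta> * s" using s \<tau> by (intro mult_right_mono) auto
    moreover have "s - C * s\<^sup>2 \<le> sketch_mean \<eta> n p (\<lambda>i. real_of_int (w i) / t j)"
      unfolding s_def C_def S_def by (rule sketch_mean_ge) (use \<eta> p in auto)
    moreover have "sketch_mean \<eta> n p (\<lambda>i. real_of_int (w i) / t j)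
        \<le> sketch_mean \<eta> n p (\<lambda>i. real_of_int (v i) / t j) + 2 * (\<eta> ^ 3 / 32)"
      using close[OF r(1) j] by (simp add: p_def t_def)
    moreover have "sketch_mean \<eta> n p (\<lambda>i. real_of_int (v i) / t j) \<le> p * S v j"
      unfolding S_def by (rule sketch_mean_le) (use \<eta> p in auto)
    moreover have "2 * (\<eta> ^ 3 / 32) \<le> \<eta> * s"
      using mult_left_mono[OF s(1), of \<eta>] \<eta> by (simp add: \<tau>_def power2_eq_square power3_eq_cube)
    ultimately have "s - 2 * (\<eta> * s) \<le> p * S v j" by (simp add: power2_eq_square mult.assoc)
    then have "p * ((1 - 2 * \<eta>) * S w j) \<le> p * S v j" by (simp add: s_def algebra_simps)
    then show ?thesis using p by simp
  qed

  define \<kappa>1 where "\<kappa>1 = (1 + \<eta>) / (1 - 2 * \<eta>)"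
  have \<kappa>1: "1 \<le> \<kappa>1" using \<eta> by (simp add: \<kappa>1_def)
  have grid: "f w ((t j)\<^sup>2) \<le> \<kappa>1 * f v ((t j)\<^sup>2)" if "j \<le> J" for j
    using that
  proof (induction j)
    have *: "f w ((t j)\<^sup>2) \<le> \<kappa>1 * f v ((t j)\<^sup>2)" if "j \<le> J" "\<tau> \<le> S w j" for j
    proof -
      have "(1 - 2 * \<eta>) * f w ((t j)\<^sup>2) \<le> (1 - 2 * \<eta>) * ((t j)\<^sup>2 * S w j)"
        using S_f(1) \<eta> by (intro mult_left_mono) auto
      also have "\<dots> = (t j)\<^sup>2 * ((1 - 2 * \<eta>) * S w j)" by simp
      also have "\<dots> \<le> (t j)\<^sup>2 * S v j" using direct[OF that] by (intro mult_left_mono) auto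
      also have "\<dots> \<le> (1 + \<eta>) * f v ((t j)\<^sup>2)" by (rule S_f(2))
      finally show ?thesis using \<eta> by (simp add: \<kappa>1_def field_simps)
    qed
    {
      case 0
      \<comment> \<open>Integrality starts the induction: at scale 1 a nonzero \<open>w\<close>
        already has mass at least 1.\<close>
      show ?case
      proof (cases "\<exists>i<n. w i \<noteq> 0")
        case True
        then obtain k where k: "k < n" "w k \<noteq> 0" by blast
        then have "1 \<le> \<bar>real_of_int (w k) / t 0\<bar>" by (simp add: t_def)
        then have "1 \<le> smooth_trunc \<eta> (real_of_int (w k) / t 0)" by (rule smooth_trunc_ge_1[OF \<eta>(1)])
        also have "\<dots> \<le> S w 0"
          unfolding S_def by (rule member_le_sum) (use k smooth_trunc_nonneg[OF \<eta>(1)] in auto)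
        finally show ?thesis using * \<tau> by auto
      next
        case False
        then have "f w ((t 0)\<^sup>2) = 0" unfolding f_def by (intro sum.neutral) auto
        then show ?thesis using f_nonneg[of "(t 0)\<^sup>2" v] \<kappa>1 by simp
      qed
    next
      case (Suc j)
      show ?case
      proof (cases "\<tau> \<le> S w (Suc j)")
        case True
        then show ?thesis using * Suc by blast
      next
        \<comment> \<open>Mass below \<open>1 / 4\<close> forces every entry of \<open>w\<close> to
          at most half of \<open>t (Suc j)\<close>, hence to at most \<open>t j\<close>. The
          truncated sum of \<open>w\<close> is then the same at both scales.\<close>
        case False
        have sq: "(real_of_int (w i))\<^sup>2 \<le> (t j)\<^sup>2" if i: "i < n" for i
        proof -
          have "min ((real_of_int (w i) / t (Suc j))\<^sup>2) 1 \<le> smooth_trunc \<eta> (real_of_int (w i) / t (Suc j))"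
            by (rule smooth_trunc_ge[OF \<eta>(1)])
          also have "\<dots> \<le> S w (Suc j)"
            unfolding S_def by (rule member_le_sum) (use i smooth_trunc_nonneg[OF \<eta>(1)] in auto)
          also have "\<dots> < 1 / 4" using False \<tau> by simp
          finally have "(real_of_int (w i) / t (Suc j))\<^sup>2 \<le> (1 / 2)\<^sup>2"
            by (simp add: min_def power2_eq_square split: if_splits)
          then have "\<bar>real_of_int (w i) / t (Suc j)\<bar> \<le> 1 / 2" by (simp add: abs_le_square_iff[symmetric])
          then have "\<bar>real_of_int (w i)\<bar> \<le> t (Suc j) / 2"
            using t[of "Suc j"] by (simp add: abs_divide divide_le_eq)
          also have "\<dots> \<le> t j"
            unfolding tSuc using \<eta> t[of j] mult_right_mono[of "1 + \<eta>" 2 "t j"] by simp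
          finally show ?thesis using t[of j] by (simp add: abs_le_square_iff[symmetric])
        qed
        have tt: "(t j)\<^sup>2 \<le> (t (Suc j))\<^sup>2"
          using t[of j] \<eta> by (intro power_mono) (auto simp: tSuc)
        have "f w ((t (Suc j))\<^sup>2) = f w ((t j)\<^sup>2)"
          unfolding f_def using sq tt by (intro sum.cong) (auto simp: min_def dest: order.trans)
        also have "\<dots> \<le> \<kappa>1 * f v ((t j)\<^sup>2)" using Suc by simp
        also have "\<dots> \<le> \<kappa>1 * f v ((t (Suc j))\<^sup>2)" using \<kappa>1 f_mono[OF tt] by (intro mult_left_mono) auto
        finally show ?thesis .
      qed
    }
  qed

  have "1 \<le> (1 + \<eta>)\<^sup>2" using \<eta> by (intro one_le_power) auto
  have \<kappa>: "\<kappa>1 * ((1 + \<eta>)\<^sup>2 * x) = (1 + \<eta>) ^ 3 / (1 - 2 * \<eta>) * x" for x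
    by (simp add: \<kappa>1_def power2_eq_square power3_eq_cube)
  have weaken: "\<kappa>1 * x \<le> \<kappa>1 * ((1 + \<eta>)\<^sup>2 * x)" if "0 \<le> x" for x
    using \<kappa>1 mult_right_mono[OF \<open>1 \<le> (1 + \<eta>)\<^sup>2\<close> that] by (intro mult_left_mono) auto
  have "f w T \<le> \<kappa>1 * ((1 + \<eta>)\<^sup>2 * f v T)"
  proof -
    consider "T \<le> 1" | "(t J)\<^sup>2 \<le> T" | "1 \<le> T" "T \<le> (t J)\<^sup>2" by linarith
    then show ?thesis
    proof cases
      case 1
      \<comment> \<open>A threshold of at most 1 truncates every nonzero integer entry, so truncated
        sums are linear in \<open>T\<close> there.\<close>
      have lin: "f u T = T * f u 1" for u :: "nat \<Rightarrow> int"
        unfolding f_def sum_distrib_left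
      proof (intro sum.cong refl)
        fix i
        show "min ((real_of_int (u i))\<^sup>2) T = T * min ((real_of_int (u i))\<^sup>2) 1"
        proof (cases "u i = 0")
          case False
          then have "1 \<le> \<bar>real_of_int (u i)\<bar>" by simp
          then have "1 \<le> (real_of_int (u i))\<^sup>2" using one_le_power[of "\<bar>real_of_int (u i)\<bar>" 2] by simp
          then show ?thesis using 1 by simp
        qed (use T in simp)
      qed
      have "f w T \<le> T * (\<kappa>1 * f v 1)"
        unfolding lin[of w] using grid[of 0] T by (intro mult_left_mono) (auto simp: t_def)
      also have "\<dots> = \<kappa>1 * f v T" unfolding lin[of v] by simp
      finally show ?thesis using weaken[OF f_nonneg[OF T]] order.trans by blast
    next
      case 2
      have "(real_of_int (w i))\<^sup>2 \<le> (t J)\<^sup>2" if "i < n" for i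
      proof -
        have "\<bar>real_of_int (w i)\<bar> \<le> \<bar>t J\<bar>" using order.trans[OF w[OF that] J] by (simp add: t_def)
        then show ?thesis by (simp add: abs_le_square_iff)
      qed
      then have "f w T = f w ((t J)\<^sup>2)"
        unfolding f_def using 2 by (intro sum.cong) (auto simp: min_def dest: order.trans)
      also have "\<dots> \<le> \<kappa>1 * f v ((t J)\<^sup>2)" by (rule grid) simp
      also have "\<dots> \<le> \<kappa>1 * f v T" using f_mono[OF 2] \<kappa>1 by (intro mult_left_mono) auto
      finally show ?thesis using weaken[OF f_nonneg[OF T]] order.trans by blast
    next
      case 3
      then obtain j where j: "j \<le> J" "T \<le> (t j)\<^sup>2" "\<And>q. q < j \<Longrightarrow> \<not> T \<le> (t q)\<^sup>2"
        using ex_least_nat_le[of "\<lambda>j. T \<le> (t j)\<^sup>2" J] by blast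
      have "(t j)\<^sup>2 \<le> (1 + \<eta>)\<^sup>2 * T"
      proof (cases j)
        case 0
        then show ?thesis using mult_mono[OF \<open>1 \<le> (1 + \<eta>)\<^sup>2\<close> 3(1)] by (simp add: t_def)
      next
        case (Suc q)
        then have "(t q)\<^sup>2 \<le> T" using j(3)[of q] by simp
        then show ?thesis using mult_left_mono[of "(t q)\<^sup>2" T "(1 + \<eta>)\<^sup>2"]
          by (simp add: Suc tSuc power_mult_distrib)
      qed
      have "f w T \<le> f w ((t j)\<^sup>2)" by (rule f_mono[OF j(2)])
      also have "\<dots> \<le> \<kappa>1 * f v ((t j)\<^sup>2)" by (rule grid[OF j(1)])
      also have "\<dots> \<le> \<kappa>1 * f v ((1 + \<eta>)\<^sup>2 * T)"
        using f_mono[OF \<open>(t j)\<^sup>2 \<le> (1 + \<eta>)\<^sup>2 * T\<close>] \<kappa>1 by (intro mult_left_mono) auto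
      also have "\<dots> \<le> \<kappa>1 * ((1 + \<eta>)\<^sup>2 * f v T)"
        using f_scale[OF \<open>1 \<le> (1 + \<eta>)\<^sup>2\<close> T] \<kappa>1 by (intro mult_left_mono) auto
      finally show ?thesis .
    qed
  qed
  then show ?thesis unfolding \<kappa> f_def .
qed

section \<open>Concentration and fixed seeds\<close>

lemma Pi_pmf_mean_concentration:
  fixes f :: "'i \<Rightarrow> 's \<Rightarrow> real"
  assumes "finite I" "J \<subseteq> I" "J \<noteq> {}" and b: "0 < b"
    and f: "\<And>i x. i \<in> J \<Longrightarrow> 0 \<le> f i x" "\<And>i x. i \<in> J \<Longrightarrow> f i x \<le> b" and \<delta>: "0 \<le> \<delta>"
  shows "measure_pmf.prob (Pi_pmf I d p)
      {\<omega>. real (card J) * \<delta> \<le> \<bar>(\<Sum>i\<in>J. f i (\<omega> i)) - (\<Sum>i\<in>J. measure_pmf.expectation (p i) (f i))\<bar>}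
    \<le> 2 * exp (- 2 * real (card J) * \<delta>\<^sup>2 / b\<^sup>2)"
proof -
  have "finite J" using assms(1,2) by (rule finite_subset[rotated])
  have mean: "(\<Sum>i\<in>J. measure_pmf.expectation (p i) (f i))
      = (\<Sum>i\<in>J. measure_pmf.expectation (Pi_pmf I d p) (\<lambda>\<omega>. f i (\<omega> i)))"
  proof (rule sum.cong[OF refl])
    fix i assume "i \<in> J"
    then have "map_pmf (\<lambda>\<omega>. \<omega> i) (Pi_pmf I d p) = p i"
      using Pi_pmf_component[OF assms(1), of i d p] assms(2) by (simp add: subset_iff)
    then show "measure_pmf.expectation (p i) (f i) = measure_pmf.expectation (Pi_pmf I d p) (\<lambda>\<omega>. f i (\<omega> i))"
      by (metis integral_map_pmf)
  qed
  interpret Hoeffding_ineq "measure_pmf (Pi_pmf I d p)" J "\<lambda>i \<omega>. f i (\<omega> i)" "\<lambda>_. 0" "\<lambda>_. b"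
    "\<Sum>i\<in>J. measure_pmf.expectation (p i) (f i)"
  proof unfold_locales
    show "finite J" by fact
    show "prob_space.indep_vars (measure_pmf (Pi_pmf I d p)) (\<lambda>_. borel) (\<lambda>i \<omega>. f i (\<omega> i)) J"
      by (rule prob_space.indep_vars_compose2[OF measure_pmf.prob_space_axioms
            prob_space.indep_vars_subset[OF measure_pmf.prob_space_axioms
              indep_vars_Pi_pmf[OF assms(1)] assms(2)]]) simp
  qed (use f mean in \<open>auto simp: eq_reflection\<close>)
  have "0 < card J" using \<open>finite J\<close> assms(3) by (simp add: card_gt_0_iff)
  then have pos: "0 < (\<Sum>i\<in>J. (b - 0)\<^sup>2)" using b by simp
  have "measure_pmf.prob (Pi_pmf I d p) {\<omega>. real (card J) * \<delta>
      \<le> \<bar>(\<Sum>i\<in>J. f i (\<omega> i)) - (\<Sum>i\<in>J. measure_pmf.expectation (p i) (f i))\<bar>}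
    \<le> 2 * exp (- 2 * (real (card J) * \<delta>)\<^sup>2 / (\<Sum>i\<in>J. (b - 0)\<^sup>2))"
    using Hoeffding_ineq_abs_ge[of "real (card J) * \<delta>"] \<delta> pos by simp
  also have "- 2 * (real (card J) * \<delta>)\<^sup>2 / (\<Sum>i\<in>J. (b - 0)\<^sup>2) = - 2 * real (card J) * \<delta>\<^sup>2 / b\<^sup>2"
    using \<open>0 < card J\<close> b by (simp add: power2_eq_square)
  finally show ?thesis .
qed

text \<open>Newman's argument: a fixed list of \<open>N\<close> seeds can replace the true randomness, so that only
  the index of a seed has to be stored.\<close>

lemma fixed_seeds_exist:
  fixes M :: "'s pmf" and good :: "'v \<Rightarrow> 's \<Rightarrow> bool"
  assumes V: "finite V" and N: "0 < N"
    and bad: "\<And>v. v \<in> V \<Longrightarrow> measure_pmf.prob M {x. \<not> good v x} \<le> 1 / 1000"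
    and few: "2 * real (card V) * exp (- real N / 10000) < 1"
  obtains \<omega> :: "nat \<Rightarrow> 's" where "\<And>s. s < N \<Longrightarrow> \<omega> s \<in> set_pmf M"
    "\<And>v. v \<in> V \<Longrightarrow> 99 / 100 * real N \<le> real (card {s\<in>{..<N}. good v (\<omega> s)})"
proof -
  define P where "P = Pi_pmf {..<N} undefined (\<lambda>_. M)"
  define q where "q v = measure_pmf.prob M {x. \<not> good v x}" for v
  define X where "X v \<omega> = (\<Sum>s<N. indicat_real {x. \<not> good v x} (\<omega> s))" for v and \<omega> :: "nat \<Rightarrow> 's"
  \<comment> \<open>The failure probability \<open>1 / 1000\<close> and a deviation of
    \<open>9 / 1000\<close> add up to the permitted \<open>1 / 100\<close>. The Hoeffding rate
    \<open>2 * (9 / 1000)\<^sup>2\<close> exceeds \<open>1 / 10000\<close>.\<close>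
  define B where "B v = {\<omega>. real N * (9 / 1000) \<le> \<bar>X v \<omega> - real N * q v\<bar>}" for v
  have "{..<N} \<noteq> {}" using N by auto
  have "measure_pmf.prob P (B v) \<le> 2 * exp (- real N / 10000)" for v
  proof -
    have "measure_pmf.prob P (B v) \<le> 2 * exp (- 2 * real N * (9 / 1000)\<^sup>2 / 1\<^sup>2)"
      using Pi_pmf_mean_concentration[of "{..<N}" "{..<N}" 1
          "\<lambda>_. indicat_real {x. \<not> good v x}" "9 / 1000" undefined "\<lambda>_. M"] \<open>{..<N} \<noteq> {}\<close>
      by (simp add: P_def B_def X_def q_def)
    also have "\<dots> \<le> 2 * exp (- real N / 10000)" by (simp add: power2_eq_square)
    finally show ?thesis .
  qed
  then have "(\<Sum>v\<in>V. measure_pmf.prob P (B v)) \<le> (\<Sum>v\<in>V. 2 * exp (- real N / 10000))"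
    by (intro sum_mono)
  moreover have "measure_pmf.prob P (\<Union>v\<in>V. B v) \<le> (\<Sum>v\<in>V. measure_pmf.prob P (B v))"
    by (rule measure_pmf.finite_measure_subadditive_finite) (use V in auto)
  ultimately have "measure_pmf.prob P (\<Union>v\<in>V. B v) < 1" using few by simp
  then have "\<not> set_pmf P \<subseteq> (\<Union>v\<in>V. B v)"
    by (metis less_irrefl measure_pmf.prob_eq_1 AE_measure_pmf_iff UNIV_I sets_measure_pmf subsetD)
  then obtain \<omega> where \<omega>: "\<omega> \<in> set_pmf P" "\<And>v. v \<in> V \<Longrightarrow> \<omega> \<notin> B v" by blast
  show ?thesis
  proof (rule that)
    show "\<omega> s \<in> set_pmf M" if "s < N" for s
      using \<omega>(1) that by (auto simp: P_def set_Pi_pmf PiE_dflt_def)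
    fix v assume v: "v \<in> V"
    have "X v \<omega> < real N * (9 / 1000) + real N * q v" using \<omega>(2)[OF v] unfolding B_def mem_Collect_eq by linarith
    moreover have "real N * q v \<le> real N * (1 / 1000)"
      using bad[OF v] by (intro mult_left_mono) (auto simp: q_def)
    moreover have "real (card {s\<in>{..<N}. good v (\<omega> s)}) + X v \<omega> = real N"
    proof -
      have "(\<Sum>s<N. indicat_real {x. good v x} (\<omega> s)) = (\<Sum>s\<in>{s\<in>{..<N}. good v (\<omega> s)}. 1)"
        by (intro sum.mono_neutral_cong_right) auto
      then have "real (card {s\<in>{..<N}. good v (\<omega> s)}) + X v \<omega>
          = (\<Sum>s<N. indicat_real {x. good v x} (\<omega> s) + indicat_real {x. \<not> good v x} (\<omega> s))"
        by (simp add: X_def sum.distrib)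
      also have "\<dots> = (\<Sum>s<N. 1)" by (intro sum.cong) (auto simp: indicator_def)
      finally show ?thesis by simp
    qed
    ultimately show "99 / 100 * real N \<le> real (card {s\<in>{..<N}. good v (\<omega> s)})" by linarith
  qed
qed

section \<open>Linear sketches and their empirical means\<close>

definition lin_sketch :: "nat \<Rightarrow> ('k \<Rightarrow> nat \<Rightarrow> int) \<Rightarrow> (nat \<Rightarrow> int) \<Rightarrow> 'k \<Rightarrow> int" where
  "lin_sketch n c v x = (\<Sum>i<n. c x i * v i)"

definition empirical_mean :: "real \<Rightarrow> nat \<Rightarrow> (nat \<times> nat \<Rightarrow> int) \<Rightarrow> nat \<Rightarrow> nat \<Rightarrow> real" where
  "empirical_mean \<eta> K z r j = (\<Sum>k<K. smooth_trunc \<eta> (real_of_int (z (r, k)) / (1 + \<eta>) ^ j)) / real K"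

text \<open>No random signs occur here, so a candidate vector can be tested against counter values
  \<open>z\<close> without knowledge of the seed that produced them.\<close>

definition means_close ::
    "real \<Rightarrow> real \<Rightarrow> nat \<Rightarrow> nat \<Rightarrow> nat \<Rightarrow> nat \<Rightarrow> (nat \<times> nat \<Rightarrow> int) \<Rightarrow> (nat \<Rightarrow> int) \<Rightarrow> bool" where
  "means_close \<eta> \<delta> n R J K z v \<longleftrightarrow> (\<forall>r\<le>R. \<forall>j\<le>J.
     \<bar>empirical_mean \<eta> K z r j - sketch_mean \<eta> n (1 / 2 ^ r) (\<lambda>i. real_of_int (v i) / (1 + \<eta>) ^ j)\<bar> \<le> \<delta>)"

definition seed_pmf :: "nat \<Rightarrow> nat \<Rightarrow> nat \<Rightarrow> (nat \<times> nat \<Rightarrow> nat \<Rightarrow> int) pmf" where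
  "seed_pmf n R K = Pi_pmf ({..R} \<times> {..<K}) (\<lambda>_. 0) (\<lambda>(r, k). sparse_sign_vec n (1 / 2 ^ r))"

lemma set_seed_pmf:
  assumes "c \<in> set_pmf (seed_pmf n R K)"
  shows "\<bar>c x i\<bar> \<le> 1"
proof (cases "x \<in> {..R} \<times> {..<K}")
  case True
  have "c \<in> PiE_dflt ({..R} \<times> {..<K}) (\<lambda>_. 0) (\<lambda>(r, k). set_pmf (sparse_sign_vec n (1 / 2 ^ r)))"
    using assms by (simp add: seed_pmf_def set_Pi_pmf o_def case_prod_unfold)
  with True have "c x \<in> set_pmf (sparse_sign_vec n (1 / 2 ^ fst x))"
    by (simp only: PiE_dflt_def mem_Collect_eq if_True case_prod_unfold)
  then show ?thesis by (rule set_sparse_sign_vec)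
next
  case False
  have fin: "finite ({..R} \<times> {..<K})" by simp
  from subsetD[OF set_Pi_pmf_subset[OF fin] assms[unfolded seed_pmf_def]] False
  have "c x = (\<lambda>_. 0)" by blast
  then show ?thesis by simp
qed

text \<open>Hoeffding over the \<open>K\<close> copies for each rate and scale, then a union bound
  over the pairs. The same copies serve all scales \<open>j\<close>.\<close>

lemma prob_not_means_close:
  assumes \<eta>: "0 < \<eta>" and K: "0 < K" and \<delta>: "0 < \<delta>"
  shows "measure_pmf.prob (seed_pmf n R K) {c. \<not> means_close \<eta> \<delta> n R J K (lin_sketch n c v) v}
    \<le> 2 * (real R + 1) * (real J + 1) * exp (- 2 * real K * \<delta>\<^sup>2 / (1 + \<eta>)\<^sup>2)"
proof -
  define bad where "bad = (\<lambda>(r, j). {c. \<delta> < \<bar>empirical_mean \<eta> K (lin_sketch n c v) r j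
     - sketch_mean \<eta> n (1 / 2 ^ r) (\<lambda>i. real_of_int (v i) / (1 + \<eta>) ^ j)\<bar>})"
  have "measure_pmf.prob (seed_pmf n R K) (bad x) \<le> 2 * exp (- 2 * real K * \<delta>\<^sup>2 / (1 + \<eta>)\<^sup>2)"
    if x: "x \<in> {..R} \<times> {..J}" for x
  proof -
    obtain r j where rj: "x = (r, j)" "r \<le> R" "j \<le> J" using x by auto
    define a where "a = (\<lambda>i. real_of_int (v i) / (1 + \<eta>) ^ j)"
    define f where "f c = smooth_trunc \<eta> (\<Sum>i<n. real_of_int (c i) * a i)" for c :: "nat \<Rightarrow> int"
    define I where "I = {r} \<times> {..<K}"
    have "I \<subseteq> {..R} \<times> {..<K}" "card I = K" "I \<noteq> {}" using rj K by (auto simp: I_def card_cartesian_product)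
    have sum_I: "(\<Sum>y\<in>I. g y) = (\<Sum>k<K. g (r, k))" for g :: "nat \<times> nat \<Rightarrow> real"
    proof -
      have "I = Pair r ` {..<K}" by (auto simp: I_def)
      then show ?thesis by (simp add: sum.reindex inj_on_def)
    qed
    have emp: "empirical_mean \<eta> K (lin_sketch n c v) r j = (\<Sum>y\<in>I. f (c y)) / real K" for c
      unfolding empirical_mean_def sum_I f_def lin_sketch_def a_def
      by (simp add: sum_divide_distrib)
    have mean: "(\<Sum>y\<in>I. measure_pmf.expectation ((\<lambda>(r, k). sparse_sign_vec n (1 / 2 ^ r)) y) f)
        = real K * sketch_mean \<eta> n (1 / 2 ^ r) a"
      unfolding sum_I sketch_mean_def f_def by simp
    have "bad x \<subseteq> {c. real (card I) * \<delta> \<le> \<bar>(\<Sum>y\<in>I. f (c y))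
        - (\<Sum>y\<in>I. measure_pmf.expectation ((\<lambda>(r, k). sparse_sign_vec n (1 / 2 ^ r)) y) f)\<bar>}"
    proof
      fix c assume "c \<in> bad x"
      then have "\<delta> < \<bar>(\<Sum>y\<in>I. f (c y)) / real K - sketch_mean \<eta> n (1 / 2 ^ r) a\<bar>"
        by (simp add: bad_def rj emp a_def)
      then have "real K * \<delta> \<le> real K * \<bar>(\<Sum>y\<in>I. f (c y)) / real K - sketch_mean \<eta> n (1 / 2 ^ r) a\<bar>"
        by (intro mult_left_mono) auto
      also have "\<dots> = \<bar>real K * ((\<Sum>y\<in>I. f (c y)) / real K - sketch_mean \<eta> n (1 / 2 ^ r) a)\<bar>"
        by (simp add: abs_mult)
      also have "real K * ((\<Sum>y\<in>I. f (c y)) / real K - sketch_mean \<eta> n (1 / 2 ^ r) a)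
          = (\<Sum>y\<in>I. f (c y)) - real K * sketch_mean \<eta> n (1 / 2 ^ r) a"
        using K by (simp add: right_diff_distrib)
      finally show "c \<in> {c. real (card I) * \<delta> \<le> \<bar>(\<Sum>y\<in>I. f (c y))
        - (\<Sum>y\<in>I. measure_pmf.expectation ((\<lambda>(r, k). sparse_sign_vec n (1 / 2 ^ r)) y) f)\<bar>}"
        unfolding mean \<open>card I = K\<close> by simp
    qed
    then have "measure_pmf.prob (seed_pmf n R K) (bad x)
      \<le> measure_pmf.prob (seed_pmf n R K) {c. real (card I) * \<delta> \<le> \<bar>(\<Sum>y\<in>I. f (c y))
        - (\<Sum>y\<in>I. measure_pmf.expectation ((\<lambda>(r, k). sparse_sign_vec n (1 / 2 ^ r)) y) f)\<bar>}"
      by (intro measure_pmf.finite_measure_mono) auto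
    also have "\<dots> \<le> 2 * exp (- 2 * real (card I) * \<delta>\<^sup>2 / (1 + \<eta>)\<^sup>2)"
      unfolding seed_pmf_def
      by (rule Pi_pmf_mean_concentration[where f = "\<lambda>_. f"])
        (use \<open>I \<subseteq> _\<close> \<open>I \<noteq> {}\<close> \<eta> \<delta> smooth_trunc_nonneg[OF \<eta>] smooth_trunc_le[OF \<eta>] in \<open>auto simp: f_def\<close>)
    finally show ?thesis unfolding \<open>card I = K\<close> .
  qed
  then have "(\<Sum>x\<in>{..R} \<times> {..J}. measure_pmf.prob (seed_pmf n R K) (bad x))
      \<le> (\<Sum>x\<in>{..R} \<times> {..J}. 2 * exp (- 2 * real K * \<delta>\<^sup>2 / (1 + \<eta>)\<^sup>2))"
    by (rule sum_mono)
  moreover have "measure_pmf.prob (seed_pmf n R K) (\<Union>x\<in>{..R} \<times> {..J}. bad x)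
      \<le> (\<Sum>x\<in>{..R} \<times> {..J}. measure_pmf.prob (seed_pmf n R K) (bad x))"
    by (rule measure_pmf.finite_measure_subadditive_finite) auto
  moreover have "{c. \<not> means_close \<eta> \<delta> n R J K (lin_sketch n c v) v} = (\<Union>x\<in>{..R} \<times> {..J}. bad x)"
    by (auto simp: means_close_def bad_def not_le)
  ultimately show ?thesis by (simp add: card_cartesian_product algebra_simps)
qed

section \<open>From finite-state machines to bit strings\<close>

text \<open>This reduces the construction to a deterministic automaton with a random initial state,
  whose states are encoded injectively as bit strings.\<close>

lemma streaming_alg_of_machine:
  fixes init :: "'q pmf" and step :: "nat \<times> int \<Rightarrow> 'q \<Rightarrow> 'q"
  assumes Q: "finite Q" "card Q \<le> 2 ^ s" and init: "set_pmf init \<subseteq> Q"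
    and step: "\<And>u q. u \<in> {..<n} \<times> {-1, 1} \<Longrightarrow> q \<in> Q \<Longrightarrow> step u q \<in> Q"
    and query: "\<And>q. q \<in> Q \<Longrightarrow> query q \<in> Rn n"
  obtains A where "space_bounded n s A"
    "\<And>orc us. turnstile_stream n us \<Longrightarrow>
       run_alg A orc us = map_pmf (\<lambda>q. out (fold step us q) (orc (query (fold step us q)))) init"
proof -
  have "card {m :: bool list. length m = s} = 2 ^ s"
    using card_lists_length_eq[of "UNIV :: bool set" s] by simp
  moreover have "finite {m :: bool list. length m = s}"
    using finite_lists_length_eq[of "UNIV :: bool set" s] by simp
  ultimately obtain enc where enc: "enc ` Q \<subseteq> {m :: bool list. length m = s}" "inj_on enc Q"
    using card_le_inj[OF Q(1)] Q(2) by metis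
  define dec where "dec = inv_into Q enc"
  have dec: "dec (enc q) = q" if "q \<in> Q" for q using enc(2) that by (simp add: dec_def)
  \<comment> \<open>\<open>space_bounded\<close> quantifies over all strings of length
    \<open>s\<close>, so strings that encode no state need defaults: they stay put and answer with
    the zero vector.\<close>
  define A where "A = \<lparr>alg_init = map_pmf enc init,
    alg_update = (\<lambda>u m. return_pmf (if m \<in> enc ` Q then enc (step u (dec m)) else m)),
    alg_query = (\<lambda>m. if m \<in> enc ` Q then query (dec m) else (\<lambda>_. 0)),
    alg_output = (\<lambda>m z. return_pmf (out (dec m) z))\<rparr>"
  show ?thesis
  proof (rule that)
    show "space_bounded n s A"
      unfolding space_bounded_def A_def
      using enc(1) init step query dec by (auto simp: Rn_def) blast+
    fix orc :: "(nat \<Rightarrow> real) \<Rightarrow> real" and us assume us: "turnstile_stream n us"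
    have in_Q: "fold step us q \<in> Q" if "q \<in> Q" for q
      using us that by (induction us arbitrary: q) (auto simp: turnstile_stream_def intro: step)
    have "foldl (\<lambda>M u. bind_pmf M (alg_update A u)) (map_pmf enc M) us = map_pmf (\<lambda>q. enc (fold step us q)) M"
      if "set_pmf M \<subseteq> Q" for M
      using us that
    proof (induction us arbitrary: M)
      case (Cons u us)
      have u: "u \<in> {..<n} \<times> {-1, 1}" and us: "turnstile_stream n us"
        using Cons.prems(1) by (auto simp: turnstile_stream_def)
      have "bind_pmf (map_pmf enc M) (alg_update A u) = bind_pmf M (\<lambda>q. return_pmf (enc (step u q)))"
        unfolding bind_map_pmf
      proof (rule bind_pmf_cong[OF refl])
        fix q assume "q \<in> set_pmf M"
        then have "q \<in> Q" using Cons.prems(2) by blast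
        then show "alg_update A u (enc q) = return_pmf (enc (step u q))" by (simp add: A_def dec)
      qed
      then have "bind_pmf (map_pmf enc M) (alg_update A u) = map_pmf enc (map_pmf (step u) M)"
        by (simp add: map_pmf_def bind_assoc_pmf bind_return_pmf)
      moreover have "set_pmf (map_pmf (step u) M) \<subseteq> Q" using Cons.prems(2) step[OF u] by auto
      ultimately show ?case
        using Cons.IH[OF us, of "map_pmf (step u) M"] by (simp add: pmf.map_comp o_def)
    qed simp
    then have "final_memory A us = map_pmf (\<lambda>q. enc (fold step us q)) init"
      using init by (simp add: final_memory_def A_def)
    then have "run_alg A orc us = bind_pmf init (\<lambda>q. alg_output A (enc (fold step us q))
        (orc (alg_query A (enc (fold step us q)))))"
      by (simp add: run_alg_def bind_map_pmf)
    also have "\<dots> = bind_pmf init (\<lambda>q. return_pmf (out (fold step us q) (orc (query (fold step us q)))))"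
    proof (rule bind_pmf_cong[OF refl])
      fix q assume "q \<in> set_pmf init"
      then have "fold step us q \<in> Q" using init in_Q by blast
      then show "alg_output A (enc (fold step us q)) (orc (alg_query A (enc (fold step us q))))
          = return_pmf (out (fold step us q) (orc (query (fold step us q))))"
        by (simp add: A_def dec)
    qed
    finally show "run_alg A orc us = map_pmf (\<lambda>q. out (fold step us q) (orc (query (fold step us q)))) init"
      by (simp add: map_pmf_def)
  qed
qed

section \<open>The streaming algorithm\<close>

lemma centered_mod:
  fixes x h :: int
  assumes "\<bar>x\<bar> < h"
  shows "(x mod (2 * h) + h) mod (2 * h) - h = x"
proof -
  have "(x mod (2 * h) + h) mod (2 * h) = (x + h) mod (2 * h)" by (simp add: mod_add_left_eq)
  also have "\<dots> = x + h" using assms by (intro mod_pos_pos_trivial) auto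
  finally show ?thesis by simp
qed

text \<open>A memory state consists of the index of a seed and of counters modulo \<open>m\<close>. Intermediate
  vectors of the stream are unbounded, so the counters are allowed to wrap around.\<close>

definition counter_step ::
    "'k set \<Rightarrow> int \<Rightarrow> (nat \<Rightarrow> 'k \<Rightarrow> nat \<Rightarrow> int) \<Rightarrow> nat \<times> int \<Rightarrow> nat \<times> ('k \<Rightarrow> int) \<Rightarrow> nat \<times> ('k \<Rightarrow> int)" where
  "counter_step X m \<omega> u q =
     (fst q, \<lambda>x\<in>X. (snd q x + snd u * \<omega> (fst q) x (fst u)) mod m)"

lemma stream_vec_Nil [simp]: "stream_vec [] = (\<lambda>_. 0)"
  and stream_vec_snoc: "stream_vec (us @ [u]) i = stream_vec us i + (if fst u = i then snd u else 0)"
  by (auto simp: stream_vec_def split: prod.split)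

lemma stream_vec_outside:
  assumes "turnstile_stream n us" "n \<le> i"
  shows "stream_vec us i = 0"
  using assms
proof (induction us rule: rev_induct)
  case (snoc u us)
  then show ?case by (cases u) (auto simp: stream_vec_snoc turnstile_stream_def)
qed simp

text \<open>Reduction modulo \<open>m\<close> is compatible with the linear updates, so wrap-around
  during the stream leaves no trace in the final residues.\<close>

lemma fold_counter_step:
  assumes "turnstile_stream n us"
  shows "fold (counter_step X m \<omega>) us (s, \<lambda>x\<in>X. 0)
    = (s, \<lambda>x\<in>X. lin_sketch n (\<omega> s) (stream_vec us) x mod m)"
  using assms
proof (induction us rule: rev_induct)
  case Nil
  show ?case by (simp add: lin_sketch_def)
next
  case (snoc u us)
  then have "turnstile_stream n us" and u: "fst u < n" by (auto simp: turnstile_stream_def)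
  have "lin_sketch n (\<omega> s) (stream_vec (us @ [u])) x
      = lin_sketch n (\<omega> s) (stream_vec us) x + snd u * \<omega> s x (fst u)" for x
  proof -
    have "lin_sketch n (\<omega> s) (stream_vec (us @ [u])) x
      = lin_sketch n (\<omega> s) (stream_vec us) x + (\<Sum>i<n. if fst u = i then snd u * \<omega> s x (fst u) else 0)"
      unfolding lin_sketch_def sum.distrib[symmetric]
      by (intro sum.cong) (auto simp: stream_vec_snoc algebra_simps)
    then show ?thesis using u by simp
  qed
  then show ?case using snoc.IH[OF \<open>turnstile_stream n us\<close>]
    by (simp add: counter_step_def restrict_def fun_eq_iff mod_add_left_eq)
qed

definition bounded_vecs :: "nat \<Rightarrow> int \<Rightarrow> (nat \<Rightarrow> int) set" where
  "bounded_vecs n M = PiE_dflt {..<n} 0 (\<lambda>_. {- M..M})"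

lemma bounded_vecs_iff: "v \<in> bounded_vecs n M \<longleftrightarrow> (\<forall>i<n. \<bar>v i\<bar> \<le> M) \<and> (\<forall>i\<ge>n. v i = 0)"
  by (auto simp: bounded_vecs_def PiE_dflt_def abs_le_iff minus_le_iff not_less)

lemma card_bounded_vecs: "0 \<le> M \<Longrightarrow> card (bounded_vecs n M) = nat (2 * M + 1) ^ n"
  by (simp add: bounded_vecs_def card_PiE_dflt)

text \<open>Both vectors are close to the same \<open>z\<close>, so the norm comparison applies in
  both directions. Multiplying the value at \<open>w\<close> by \<open>\<kappa>\<close> makes it an
  upper bound for the value at \<open>v\<close>.\<close>

lemma Q'_norm_approx_if_means_close:
  fixes v w :: "nat \<Rightarrow> int" and \<eta> :: real
  defines "\<kappa> \<equiv> (1 + \<eta>) ^ 3 / (1 - 2 * \<eta>)"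
  assumes Q: "Q'_norm n l" and n: "0 < n" and \<eta>: "0 < \<eta>" "\<eta> \<le> 1 / 4"
    and v: "v \<in> bounded_vecs n M" and w: "w \<in> bounded_vecs n M"
    and J: "real_of_int M \<le> (1 + \<eta>) ^ J" and R: "2 * real n \<le> 2 ^ R * (\<eta>\<^sup>2 / 8)"
    and close: "means_close \<eta> (\<eta> ^ 3 / 32) n R J K z v" "means_close \<eta> (\<eta> ^ 3 / 32) n R J K z w"
  shows "is_D_approx (\<kappa>\<^sup>2) (l (\<lambda>i. real_of_int (v i))) (\<kappa> * l (\<lambda>i. real_of_int (w i)))"
proof -
  have "1 - 2 * \<eta> \<le> 1" using \<eta> by simp
  also have "1 \<le> (1 + \<eta>) ^ 3" using \<eta> by (intro one_le_power) simp
  finally have \<kappa>: "1 \<le> \<kappa>" using \<eta> by (simp add: \<kappa>_def)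
  have le: "l (\<lambda>i. real_of_int (a i)) \<le> \<kappa> * l (\<lambda>i. real_of_int (b i))"
    if a: "a \<in> bounded_vecs n M" and b: "b \<in> bounded_vecs n M"
      and ca: "means_close \<eta> (\<eta> ^ 3 / 32) n R J K z a" and cb: "means_close \<eta> (\<eta> ^ 3 / 32) n R J K z b"
    for a b
  proof (rule Q'_norm_le_if_truncated_sums_le[OF Q n _ _ \<kappa>])
    show "(\<lambda>i. real_of_int (a i)) \<in> Rn n" "(\<lambda>i. real_of_int (b i)) \<in> Rn n"
      using a b by (auto simp: bounded_vecs_iff Rn_def)
    fix T :: real assume T: "0 \<le> T"
    show "(\<Sum>i<n. min ((real_of_int (a i))\<^sup>2) T) \<le> \<kappa> * (\<Sum>i<n. min ((real_of_int (b i))\<^sup>2) T)"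
      unfolding \<kappa>_def
    proof (rule truncated_sums_le_of_means_close[OF \<eta> _ J R _ T])
      show "\<bar>real_of_int (a i)\<bar> \<le> real_of_int M" if "i < n" for i
        using a that by (simp add: bounded_vecs_iff flip: of_int_abs)
      fix r j assume "r \<le> R" "j \<le> J"
      then have "\<bar>empirical_mean \<eta> K z r j - sketch_mean \<eta> n (1 / 2 ^ r) (\<lambda>i. real_of_int (a i) / (1 + \<eta>) ^ j)\<bar> \<le> \<eta> ^ 3 / 32"
        "\<bar>empirical_mean \<eta> K z r j - sketch_mean \<eta> n (1 / 2 ^ r) (\<lambda>i. real_of_int (b i) / (1 + \<eta>) ^ j)\<bar> \<le> \<eta> ^ 3 / 32"
        using ca cb by (auto simp: means_close_def)
      then show "sketch_mean \<eta> n (1 / 2 ^ r) (\<lambda>i. real_of_int (a i) / (1 + \<eta>) ^ j)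
        \<le> sketch_mean \<eta> n (1 / 2 ^ r) (\<lambda>i. real_of_int (b i) / (1 + \<eta>) ^ j) + 2 * (\<eta> ^ 3 / 32)"
        by linarith
    qed
  qed
  have "\<kappa> * l (\<lambda>i. real_of_int (w i)) \<le> \<kappa> * (\<kappa> * l (\<lambda>i. real_of_int (v i)))"
    using \<kappa> by (intro mult_left_mono le w v close) auto
  then show ?thesis
    using le[OF v w close] by (simp add: is_D_approx_def power2_eq_square mult.assoc)
qed

text \<open>The memory holds \<open>q\<close> bits for the index of the seed and
  \<open>B + 1\<close> bits for each of the \<open>(R + 1) * K\<close> counters.\<close>

lemma streaming_alg_for_parameters:
  fixes \<eta> :: real and M :: int
  defines "\<kappa> \<equiv> (1 + \<eta>) ^ 3 / (1 - 2 * \<eta>)"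
  assumes Q: "Q'_norm n l" and n: "0 < n" and \<eta>: "0 < \<eta>" "\<eta> \<le> 1 / 4"
    and M: "0 \<le> M" and J: "real_of_int M \<le> (1 + \<eta>) ^ J" and R: "2 * real n \<le> 2 ^ R * (\<eta>\<^sup>2 / 8)"
    and K: "0 < K" "2 * (real R + 1) * (real J + 1) * exp (- 2 * real K * (\<eta> ^ 3 / 32)\<^sup>2 / (1 + \<eta>)\<^sup>2) \<le> 1 / 1000"
    and B: "int n * M < 2 ^ B"
    and q: "10000 * (2 * real n * real_of_int M + 1) \<le> 2 ^ q"
  obtains A where "space_bounded n (q + (B + 1) * ((R + 1) * K)) A"
    "\<And>us. turnstile_stream n us \<Longrightarrow> (\<And>i. i < n \<Longrightarrow> \<bar>stream_vec us i\<bar> \<le> M) \<Longrightarrow>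
       99 / 100 \<le> measure_pmf.prob (run_alg A l us)
         {z. is_D_approx (\<kappa>\<^sup>2) (l (\<lambda>i. real_of_int (stream_vec us i))) z}"
proof -
  define \<delta> where "\<delta> = \<eta> ^ 3 / 32"
  define h where "h = (2 ^ B :: int)"
  define X where "X = {..R} \<times> {..<K}"
  define N where "N = (2 ^ q :: nat)"
  define good where "good v c = means_close \<eta> \<delta> n R J K (lin_sketch n c v) v" for v and c :: "nat \<times> nat \<Rightarrow> nat \<Rightarrow> int"
  have \<delta>: "0 < \<delta>" using \<eta> by (simp add: \<delta>_def)

  \<comment> \<open>There are at most \<open>exp (2 * n * M)\<close> admissible vectors, so a number
    of seeds of order \<open>n * M + 1\<close> is enough for the union bound, and an index needs
    only logarithmically many bits.\<close>
  have "2 * real (card (bounded_vecs n M)) * exp (- real N / 10000) < 1"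
  proof -
    have "real (card (bounded_vecs n M)) = (1 + 2 * real_of_int M) ^ n"
      using M by (simp add: card_bounded_vecs add.commute)
    also have "\<dots> \<le> exp (2 * real_of_int M) ^ n"
      using M by (intro power_mono exp_ge_add_one_self) auto
    also have "\<dots> = exp (2 * real n * real_of_int M)" by (simp add: exp_of_nat_mult[symmetric] ac_simps)
    finally have "2 * real (card (bounded_vecs n M)) * exp (- real N / 10000)
        \<le> 2 * exp (2 * real n * real_of_int M) * exp (- real N / 10000)"
      by (intro mult_right_mono) auto
    also have "\<dots> \<le> 2 * exp (2 * real n * real_of_int M) * exp (- (2 * real n * real_of_int M + 1))"
      using q by (intro mult_left_mono) (auto simp: N_def)
    also have "\<dots> = 2 * exp (- 1)" by (simp add: mult.assoc flip: exp_add)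
    also have "\<dots> < 1"
    proof -
      have "(2::real) < exp 1" using exp_lower_Taylor_quadratic[of "1::real"] by simp
      then show ?thesis by (simp add: exp_minus field_simps)
    qed
    finally show ?thesis .
  qed
  moreover have "measure_pmf.prob (seed_pmf n R K) {c. \<not> good v c} \<le> 1 / 1000" for v
    unfolding good_def by (rule order.trans[OF prob_not_means_close[OF \<eta>(1) K(1) \<delta>]]) (use K(2) in \<open>simp add: \<delta>_def\<close>)
  moreover have "finite (bounded_vecs n M)" by (simp add: bounded_vecs_def finite_PiE_dflt)
  moreover have "0 < N" by (simp add: N_def)
  ultimately obtain \<omega> where seeds: "\<And>s. s < N \<Longrightarrow> \<omega> s \<in> set_pmf (seed_pmf n R K)"
    and most: "\<And>v. v \<in> bounded_vecs n M \<Longrightarrow> 99 / 100 * real N \<le> real (card {s\<in>{..<N}. good v (\<omega> s)})"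
    using fixed_seeds_exist[of "bounded_vecs n M" N "seed_pmf n R K" good] by blast

  define decode where "decode z x = (if x \<in> X then (z x + h) mod (2 * h) - h else 0)" for z :: "nat \<times> nat \<Rightarrow> int" and x
  define consistent where "consistent z w \<longleftrightarrow> w \<in> bounded_vecs n M \<and> means_close \<eta> \<delta> n R J K z w" for z w
  \<comment> \<open>The exhaustive search costs no memory and looks at the counters only. A good
    seed guarantees a solution, namely \<open>v\<close>; otherwise the zero vector is a harmless
    default that still lies in \<open>Rn n\<close>.\<close>
  define guess where "guess z = (if \<exists>w. consistent z w then SOME w. consistent z w else (\<lambda>_. 0))" for z
  define query where "query p i = real_of_int (guess (decode (snd p)) i)" for p :: "nat \<times> (nat \<times> nat \<Rightarrow> int)" and i
  define start where "start s = (s, \<lambda>x\<in>X. 0 :: int)" for s :: nat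
  define St where "St = {..<N} \<times> PiE X (\<lambda>_. {0..<2 * h})"
  have h: "0 < h" by (simp add: h_def)
  have consistent_guess: "consistent z (guess z)" if "consistent z w" for z w
    using that someI[of "consistent z" w] by (auto simp: guess_def)
  have query_Rn: "query p \<in> Rn n" for p
  proof -
    have "guess z i = 0" if "n \<le> i" for z i
    proof (cases "\<exists>w. consistent z w")
      case True
      then have "guess z \<in> bounded_vecs n M" using consistent_guess by (auto simp: consistent_def)
      then show ?thesis using that by (simp add: bounded_vecs_iff)
    qed (simp add: guess_def)
    then show ?thesis by (simp add: query_def Rn_def)
  qed
  have "finite X" "card X = (R + 1) * K" by (auto simp: X_def card_cartesian_product)
  have St: "finite St" "card St = 2 ^ (q + (B + 1) * ((R + 1) * K))"
  proof -
    show "finite St" using \<open>finite X\<close> by (auto simp: St_def intro: finite_PiE)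
    have "card {0..<2 * h} = 2 ^ (B + 1)" by (simp add: h_def nat_mult_distrib nat_power_eq)
    then have "card St = 2 ^ q * (2 ^ (B + 1)) ^ ((R + 1) * K)"
      using \<open>finite X\<close> \<open>card X = _\<close> by (simp only: St_def card_cartesian_product card_PiE prod_constant card_lessThan N_def)
    then show "card St = 2 ^ (q + (B + 1) * ((R + 1) * K))"
      by (simp only: power_mult[symmetric] power_add[symmetric])
  qed
  obtain A where A: "space_bounded n (q + (B + 1) * ((R + 1) * K)) A"
    "\<And>orc us. turnstile_stream n us \<Longrightarrow> run_alg A orc us = map_pmf (\<lambda>p.
        (\<lambda>_ y. \<kappa> * y) (fold (counter_step X (2 * h) \<omega>) us p) (orc (query (fold (counter_step X (2 * h) \<omega>) us p))))
      (map_pmf start (pmf_of_set {..<N}))"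
  proof (rule streaming_alg_of_machine[of St "q + (B + 1) * ((R + 1) * K)"
        "map_pmf start (pmf_of_set {..<N})" n "counter_step X (2 * h) \<omega>" query "\<lambda>_ y. \<kappa> * y"])
    show "set_pmf (map_pmf start (pmf_of_set {..<N})) \<subseteq> St"
      using \<open>0 < N\<close> h by (subst set_map_pmf, subst set_pmf_of_set) (auto simp: start_def St_def)
    show "counter_step X (2 * h) \<omega> u p \<in> St" if "p \<in> St" for u p
      using that h by (auto simp: St_def counter_step_def)
  qed (use St query_Rn in auto)
  show ?thesis
  proof (rule that[OF A(1)])
    fix us assume us: "turnstile_stream n us" and bound: "\<And>i. i < n \<Longrightarrow> \<bar>stream_vec us i\<bar> \<le> M"
    define v where "v = stream_vec us"
    have v: "v \<in> bounded_vecs n M"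
      using bound stream_vec_outside[OF us] by (simp add: v_def bounded_vecs_iff)
    define fin where "fin s = fold (counter_step X (2 * h) \<omega>) us (start s)" for s
    define ok where "ok = {z. is_D_approx (\<kappa>\<^sup>2) (l (\<lambda>i. real_of_int (v i))) z}"
    have run: "run_alg A l us = map_pmf (\<lambda>s. \<kappa> * l (query (fin s))) (pmf_of_set {..<N})"
      using A(2)[OF us, of l] by (simp add: pmf.map_comp o_def fin_def)
    have "\<kappa> * l (query (fin s)) \<in> ok" if s: "s < N" and g: "good v (\<omega> s)" for s
    proof -
      \<comment> \<open>A final sketch value is a sum of \<open>n\<close> terms of absolute value at
        most \<open>M\<close>, hence below \<open>h\<close>, so its centred residue is
        exact.\<close>
      have dec: "decode (snd (fin s)) x = (if x \<in> X then lin_sketch n (\<omega> s) v x else 0)" for x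
      proof (cases "x \<in> X")
        case True
        have "\<bar>lin_sketch n (\<omega> s) v x\<bar> \<le> (\<Sum>i<n. \<bar>\<omega> s x i * v i\<bar>)"
          unfolding lin_sketch_def by (rule sum_abs)
        also have "\<dots> \<le> (\<Sum>i<n. M)"
        proof (rule sum_mono)
          fix i assume "i \<in> {..<n}"
          then have "\<bar>\<omega> s x i\<bar> * \<bar>v i\<bar> \<le> 1 * M"
            using set_seed_pmf[OF seeds[OF s]] v by (intro mult_mono) (auto simp: bounded_vecs_iff)
          then show "\<bar>\<omega> s x i * v i\<bar> \<le> M" by (simp add: abs_mult)
        qed
        also have "\<dots> < h" using B by (simp add: h_def)
        finally show ?thesis
          using True fold_counter_step[OF us, of X "2 * h" \<omega> s] centered_mod[of "lin_sketch n (\<omega> s) v x" h]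
          by (simp add: decode_def fin_def start_def v_def)
      qed (simp add: decode_def)
      have "means_close \<eta> \<delta> n R J K (decode (snd (fin s))) v"
      proof -
        have "empirical_mean \<eta> K (decode (snd (fin s))) r j = empirical_mean \<eta> K (lin_sketch n (\<omega> s) v) r j"
          if "r \<le> R" for r j
          unfolding empirical_mean_def dec by (rule arg_cong2[of _ _ _ _ "(/)"], rule sum.cong) (use that in \<open>auto simp: X_def\<close>)
        then show ?thesis using g by (simp add: good_def means_close_def)
      qed
      then have "consistent (decode (snd (fin s))) v" using v by (simp add: consistent_def)
      from consistent_guess[OF this] have w: "guess (decode (snd (fin s))) \<in> bounded_vecs n M"
        "means_close \<eta> \<delta> n R J K (decode (snd (fin s))) (guess (decode (snd (fin s))))"
        by (auto simp: consistent_def)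
      have "query (fin s) = (\<lambda>i. real_of_int (guess (decode (snd (fin s))) i))" by (simp add: query_def fun_eq_iff)
      then show ?thesis
        using Q'_norm_approx_if_means_close[OF Q n \<eta> v w(1) J R, of K "decode (snd (fin s))"]
          w(2) \<open>means_close \<eta> \<delta> n R J K (decode (snd (fin s))) v\<close>
        by (simp add: ok_def \<delta>_def \<kappa>_def)
    qed
    then have "{s\<in>{..<N}. good v (\<omega> s)} \<subseteq> {..<N} \<inter> (\<lambda>s. \<kappa> * l (query (fin s))) -` ok" by auto
    then have "card {s\<in>{..<N}. good v (\<omega> s)} \<le> card ({..<N} \<inter> (\<lambda>s. \<kappa> * l (query (fin s))) -` ok)"
      by (intro card_mono) auto
    with most[OF v] have "99 / 100 * real N \<le> real (card ({..<N} \<inter> (\<lambda>s. \<kappa> * l (query (fin s))) -` ok))"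
      by linarith
    moreover have "measure_pmf.prob (run_alg A l us) ok
        = real (card ({..<N} \<inter> (\<lambda>s. \<kappa> * l (query (fin s))) -` ok)) / real N"
      unfolding run measure_map_pmf by (subst measure_pmf_of_set) (use \<open>0 < N\<close> in auto)
    ultimately have "99 / 100 \<le> measure_pmf.prob (run_alg A l us) ok"
      using \<open>0 < N\<close> by (simp add: le_divide_eq)
    then show "99 / 100 \<le> measure_pmf.prob (run_alg A l us)
         {z. is_D_approx (\<kappa>\<^sup>2) (l (\<lambda>i. real_of_int (stream_vec us i))) z}"
      unfolding ok_def v_def .
  qed
qed

section \<open>Choice of parameters\<close>

lemma less_two_power_real: "real k \<le> 2 ^ k"
  using less_exp[of k] by (metis less_imp_le of_nat_le_iff of_nat_numeral of_nat_power)

text \<open>To first order the left side is \<open>1 + 5 * \<eta>\<close>; the slack up to 8 absorbs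
  the higher powers.\<close>

lemma stretch_factor_le:
  fixes \<eta> :: real
  assumes "0 < \<eta>" "\<eta> \<le> 1 / 60"
  shows "(1 + \<eta>) ^ 3 / (1 - 2 * \<eta>) \<le> 1 + 8 * \<eta>"
proof -
  have "\<eta> * \<eta> \<le> \<eta> * (1 / 60)" using assms by (intro mult_left_mono) auto
  moreover have "\<eta> * (\<eta> * \<eta>) \<le> \<eta> * \<eta> * 1"
    using assms mult_left_mono[of \<eta> 1 "\<eta> * \<eta>"] by (simp add: mult.assoc)
  moreover have "(1 + 8 * \<eta>) * (1 - 2 * \<eta>) - (1 + \<eta>) ^ 3 = 3 * \<eta> - 19 * (\<eta> * \<eta>) - \<eta> * (\<eta> * \<eta>)"
    by (simp add: power3_eq_cube algebra_simps)
  ultimately have "(1 + \<eta>) ^ 3 \<le> (1 + 8 * \<eta>) * (1 - 2 * \<eta>)" using assms by linarith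
  then show ?thesis using assms by (simp add: divide_le_eq)
qed

lemma run_alg_approx_mono:
  assumes "D \<le> D'" "0 \<le> t"
  shows "measure_pmf.prob P {z. is_D_approx D t z} \<le> measure_pmf.prob P {z. is_D_approx D' t z}"
proof (rule measure_pmf.finite_measure_mono)
  have "D * t \<le> D' * t" using assms by (rule mult_right_mono)
  then show "{z. is_D_approx D t z} \<subseteq> {z. is_D_approx D' t z}" by (auto simp: is_D_approx_def)
qed simp

text \<open>Here \<open>h\<close> bounds both \<open>log n\<close> and \<open>1 / \<epsilon>\<close>, and the entries of the vector are bounded by
  \<open>2 ^ (c * h)\<close>.\<close>

lemma streaming_alg_polynomial_space:
  fixes c h n :: nat and \<epsilon> :: real
  assumes Q: "Q'_norm n l" and n: "0 < n" "n \<le> 2 ^ h" and h: "2 \<le> h" and \<epsilon>: "1 / real h \<le> \<epsilon>" "\<epsilon> \<le> 1 / 2"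
  obtains A s where "space_bounded n s A"
    "real s \<le> (real c + 17 + (real c + 3) * 18 * (2000 * 18 * (30 * real c + 1) * 864000\<^sup>2)) * real h ^ 11"
    "\<And>us. turnstile_stream n us \<Longrightarrow> (\<And>i. i < n \<Longrightarrow> \<bar>stream_vec us i\<bar> \<le> 2 ^ (c * h)) \<Longrightarrow>
       99 / 100 \<le> measure_pmf.prob (run_alg A l us)
         {z. is_D_approx (1 + \<epsilon>) (l (\<lambda>i. real_of_int (stream_vec us i))) z}"
proof -
  \<comment> \<open>The factor \<open>1 + 8 * \<eta>\<close> is at most
    \<open>1 + \<epsilon> / 3\<close>, and the square of the latter is at most
    \<open>1 + \<epsilon>\<close>. For \<open>J\<close>, Bernoulli gives
    \<open>(1 + \<eta>) ^ (30 * h) \<ge> 2\<close>. For \<open>R\<close>, the ratio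
    \<open>16 * n / \<eta>\<^sup>2\<close> is \<open>14400 * h\<^sup>2 * n\<close>, at most
    \<open>2 ^ 14\<close> times three factors \<open>2 ^ h\<close>.\<close>
  define \<eta> where "\<eta> = 1 / (30 * real h)"
  define J where "J = 30 * h * (c * h)"
  define R where "R = 14 + 3 * h"
  define D where "D = 864000 * h ^ 3"
  \<comment> \<open>\<open>D\<close> is the inverse of the tolerance \<open>\<eta> ^ 3 / 32\<close>.
    As \<open>(1 + \<eta>)\<^sup>2 \<le> 2\<close>, the Hoeffding exponent is at least
    \<open>K / D\<^sup>2\<close>. The crude bound \<open>exp (- X) \<le> 1 / X\<close> avoids
    logarithms at the price of a larger \<open>K\<close>.\<close>
  define K where "K = 2000 * (R + 1) * (J + 1) * D\<^sup>2"
  define B where "B = h + c * h + 1"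
  define q where "q = 16 + h + c * h"
  define s where "s = q + (B + 1) * ((R + 1) * K)"
  have l: "is_norm n l" using Q by (simp add: Q'_norm_def)
  have \<eta>: "0 < \<eta>" "\<eta> \<le> 1 / 60" using h by (auto simp: \<eta>_def divide_le_eq)
  have nh: "real n \<le> 2 ^ h" using n(2) by (metis of_nat_le_iff of_nat_numeral of_nat_power)
  have ch: "1 \<le> (2::real) ^ (c * h)" by simp
  have 1: "real_of_int (2 ^ (c * h)) \<le> (1 + \<eta>) ^ J"
  proof -
    have "1 + real (30 * h) * \<eta> \<le> (1 + \<eta>) ^ (30 * h)" using \<eta> by (intro Bernoulli_inequality) simp
    also have "1 + real (30 * h) * \<eta> = 2" using h by (simp add: \<eta>_def)
    finally have "2 ^ (c * h) \<le> ((1 + \<eta>) ^ (30 * h)) ^ (c * h)" by (intro power_mono) auto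
    then show ?thesis by (simp add: J_def power_mult)
  qed
  have 2: "2 * real n \<le> 2 ^ R * (\<eta>\<^sup>2 / 8)"
  proof -
    have "14400 * (real h)\<^sup>2 * real n \<le> 2 ^ 14 * (2 ^ h)\<^sup>2 * 2 ^ h"
      using nh less_two_power_real[of h] by (intro mult_mono power_mono) auto
    also have "\<dots> = 2 ^ R" by (simp add: R_def power_add mult.commute[of 3] power_mult power2_eq_square power3_eq_cube)
    finally show ?thesis using h by (simp add: \<eta>_def power_mult_distrib power_divide field_simps)
  qed
  have K: "0 < K" using h by (simp add: K_def D_def)
  have 3: "2 * (real R + 1) * (real J + 1) * exp (- 2 * real K * (\<eta> ^ 3 / 32)\<^sup>2 / (1 + \<eta>)\<^sup>2) \<le> 1 / 1000"
  proof -
    define X where "X = 2000 * (real R + 1) * (real J + 1)"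
    have X: "0 < X" by (simp add: X_def add_nonneg_pos)
    have "\<eta> ^ 3 / 32 = 1 / real D" by (simp add: \<eta>_def D_def power_divide power_mult_distrib)
    moreover have "real K = X * (real D)\<^sup>2" by (simp add: K_def X_def algebra_simps)
    moreover have "real D \<noteq> 0" using h by (simp add: D_def)
    ultimately have KX: "real K * (\<eta> ^ 3 / 32)\<^sup>2 = X" by (simp add: power_divide)
    have "(1 + \<eta>)\<^sup>2 \<le> (5 / 4)\<^sup>2" using \<eta> by (intro power_mono) auto
    then have "(1 + \<eta>)\<^sup>2 \<le> 2" by (simp add: power2_eq_square)
    then have "X * (1 + \<eta>)\<^sup>2 \<le> X * 2" using X by (intro mult_left_mono) auto
    then have "X \<le> 2 * X / (1 + \<eta>)\<^sup>2" using \<eta> by (simp add: le_divide_eq)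
    moreover have "- 2 * real K * (\<eta> ^ 3 / 32)\<^sup>2 / (1 + \<eta>)\<^sup>2 = - (2 * X / (1 + \<eta>)\<^sup>2)"
      unfolding KX[symmetric] by simp
    ultimately have "exp (- 2 * real K * (\<eta> ^ 3 / 32)\<^sup>2 / (1 + \<eta>)\<^sup>2) \<le> exp (- X)"
      by (simp only: exp_le_cancel_iff neg_le_iff_le)
    also have "\<dots> \<le> 1 / X"
    proof -
      have "X \<le> exp X" using exp_ge_add_one_self[of X] by linarith
      then show ?thesis using X by (simp add: exp_minus field_simps)
    qed
    finally have "2 * (real R + 1) * (real J + 1) * exp (- 2 * real K * (\<eta> ^ 3 / 32)\<^sup>2 / (1 + \<eta>)\<^sup>2)
        \<le> 2 * (real R + 1) * (real J + 1) * (1 / X)"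
      by (intro mult_left_mono) auto
    also have "\<dots> = 1 / 1000"
    proof -
      have "2 * (real R + 1) * (real J + 1) = X / 1000" by (simp add: X_def)
      then show ?thesis using X by (simp only:) simp
    qed
    finally show ?thesis .
  qed
  have 4: "int n * 2 ^ (c * h) < 2 ^ B"
  proof -
    have "int n \<le> 2 ^ h" using n(2) by (metis of_nat_le_iff of_nat_numeral of_nat_power)
    then have "int n * 2 ^ (c * h) \<le> 2 ^ h * 2 ^ (c * h)" by (intro mult_right_mono) auto
    also have "\<dots> < 2 ^ B" by (simp add: B_def power_add)
    finally show ?thesis .
  qed
  have 5: "10000 * (2 * real n * real_of_int (2 ^ (c * h)) + 1) \<le> 2 ^ q"
  proof -
    have "real n * 2 ^ (c * h) \<le> 2 ^ h * 2 ^ (c * h)" using nh by (intro mult_right_mono) auto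
    moreover have "1 \<le> (2::real) ^ h * 2 ^ (c * h)" by (simp flip: power_add)
    moreover have "10000 * (2 * real n * real_of_int (2 ^ (c * h)) + 1) = 20000 * (real n * 2 ^ (c * h)) + 10000"
      by simp
    ultimately have "10000 * (2 * real n * real_of_int (2 ^ (c * h)) + 1) \<le> 65536 * (2 ^ h * 2 ^ (c * h))"
      by linarith
    also have "\<dots> = 2 ^ q" by (simp add: q_def power_add)
    finally show ?thesis .
  qed
  obtain A where A: "space_bounded n s A"
    "\<And>us. turnstile_stream n us \<Longrightarrow> (\<And>i. i < n \<Longrightarrow> \<bar>stream_vec us i\<bar> \<le> 2 ^ (c * h)) \<Longrightarrow>
       99 / 100 \<le> measure_pmf.prob (run_alg A l us)
         {z. is_D_approx (((1 + \<eta>) ^ 3 / (1 - 2 * \<eta>))\<^sup>2) (l (\<lambda>i. real_of_int (stream_vec us i))) z}"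
    using streaming_alg_for_parameters[OF Q n(1) \<eta>(1) _ _ 1 2 K 3 4 5] \<eta>(2) unfolding s_def by auto
  have factor: "((1 + \<eta>) ^ 3 / (1 - 2 * \<eta>))\<^sup>2 \<le> 1 + \<epsilon>"
  proof -
    have "8 * \<eta> \<le> \<epsilon> / 3" using \<epsilon>(1) h by (simp add: \<eta>_def field_simps)
    then have "(1 + \<eta>) ^ 3 / (1 - 2 * \<eta>) \<le> 1 + \<epsilon> / 3" using stretch_factor_le[OF \<eta>] by linarith
    then have "((1 + \<eta>) ^ 3 / (1 - 2 * \<eta>))\<^sup>2 \<le> (1 + \<epsilon> / 3)\<^sup>2" using \<eta> by (intro power_mono) auto
    also have "\<dots> \<le> 1 + \<epsilon>"
    proof -
      have "0 \<le> \<epsilon>" using \<epsilon>(1) by (meson of_nat_0_le_iff order_trans zero_le_divide_1_iff)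
      then have "\<epsilon> * \<epsilon> \<le> \<epsilon> * 1" using \<epsilon>(2) by (intro mult_left_mono) auto
      then show ?thesis using \<open>0 \<le> \<epsilon>\<close> by (simp add: power2_eq_square algebra_simps)
    qed
    finally show ?thesis .
  qed
  show ?thesis
  proof (rule that[OF A(1)])
    show "99 / 100 \<le> measure_pmf.prob (run_alg A l us)
         {z. is_D_approx (1 + \<epsilon>) (l (\<lambda>i. real_of_int (stream_vec us i))) z}"
      if us: "turnstile_stream n us" "\<And>i. i < n \<Longrightarrow> \<bar>stream_vec us i\<bar> \<le> 2 ^ (c * h)" for us
    proof (rule order.trans[OF A(2)[OF us] run_alg_approx_mono[OF factor]])
      have "(\<lambda>i. real_of_int (stream_vec us i)) \<in> Rn n" using stream_vec_outside[OF us(1)] by (simp add: Rn_def)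
      then show "0 \<le> l (\<lambda>i. real_of_int (stream_vec us i))" by (rule is_norm_nonneg[OF l])
    qed
    have h1: "1 \<le> real h" using h by simp
    have hk: "real h ^ i \<le> real h ^ j" if "i \<le> j" for i j using that h1 by (rule power_increasing)
    have "real R + 1 \<le> 18 * real h" using h by (simp add: R_def)
    moreover have "real J + 1 \<le> (30 * real c + 1) * real h ^ 2"
      using hk[of 0 2] by (simp add: J_def power2_eq_square algebra_simps)
    moreover have "real D = 864000 * real h ^ 3" by (simp add: D_def)
    ultimately have "real K \<le> 2000 * (18 * real h) * ((30 * real c + 1) * real h ^ 2) * (864000 * real h ^ 3)\<^sup>2"
      unfolding K_def by (simp only: of_nat_mult of_nat_power of_nat_add of_nat_1 of_nat_numeral, intro mult_mono) auto
    moreover have "real B + 1 \<le> (real c + 3) * real h" using h by (simp add: B_def algebra_simps)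
    ultimately have "(real B + 1) * ((real R + 1) * real K) \<le> ((real c + 3) * real h) *
        ((18 * real h) * (2000 * (18 * real h) * ((30 * real c + 1) * real h ^ 2) * (864000 * real h ^ 3)\<^sup>2))"
      using \<open>real R + 1 \<le> 18 * real h\<close> by (intro mult_mono) auto
    \<comment> \<open>The degree 11 consists of 1 from \<open>B\<close>, 1 from \<open>R\<close> and
      9 from \<open>K\<close>, where \<open>R\<close>, \<open>J\<close> and \<open>D\<^sup>2\<close>
      contribute 1, 2 and 6.\<close>
    also have "\<dots> = (real c + 3) * 18 * (2000 * 18 * (30 * real c + 1) * 864000\<^sup>2) * real h ^ 11"
      by (simp add: power_mult_distrib power_mult[symmetric] eval_nat_numeral) (simp add: algebra_simps)
    also have "real q \<le> (real c + 17) * real h ^ 11"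
    proof -
      have "real q \<le> (real c + 17) * real h ^ 1" using h by (simp add: q_def algebra_simps)
      also have "\<dots> \<le> (real c + 17) * real h ^ 11" using hk[of 1 11] by (intro mult_left_mono) auto
      finally show ?thesis .
    qed
    ultimately show "real s \<le> (real c + 17 + (real c + 3) * 18 * (2000 * 18 * (30 * real c + 1) * 864000\<^sup>2)) * real h ^ 11"
      unfolding s_def by (simp add: algebra_simps)
  qed
qed

theorem corollary6p5:
  fixes C\<^sub>0 :: real
  assumes "C\<^sub>0 \<ge> 1"
  shows "\<exists>p :: real poly. \<forall>n :: nat. n \<ge> 2 \<longrightarrow>
    (\<forall>(l' :: (nat \<Rightarrow> real) \<Rightarrow> real) (\<epsilon> :: real). Q'_norm n l' \<and> 0 < \<epsilon> \<and> \<epsilon> \<le> 1 / 2 \<longrightarrow>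
      (\<exists>(A :: streaming_alg) (s :: nat).
         space_bounded n s A \<and>
         real s \<le> poly p (log 2 (real n) / \<epsilon>) \<and>
         (\<forall>us. turnstile_stream n us \<and>
               (\<forall>i<n. \<bar>real_of_int (stream_vec us i)\<bar> \<le> real n powr C\<^sub>0) \<longrightarrow>
            measure_pmf.prob (run_alg A l' us)
              {z. is_D_approx (1 + \<epsilon>) (l' (\<lambda>i. real_of_int (stream_vec us i))) z} \<ge> 0.99)))"
proof -
  define c where "c = nat \<lceil>C\<^sub>0\<rceil>"
  define a where "a = real c + 17 + (real c + 3) * 18 * (2000 * 18 * (30 * real c + 1) * 864000\<^sup>2)"
  have a: "0 \<le> a" by (simp add: a_def)
  have c: "C\<^sub>0 \<le> real c" using assms by (simp add: c_def of_nat_ceiling)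
  show ?thesis
  \<comment> \<open>The bound \<open>h \<le> 1 + L\<close> turns \<open>a * h ^ 11\<close> into this
    polynomial in \<open>L\<close>, and \<open>a\<close> depends on \<open>C\<^sub>0\<close>
    alone.\<close>
  proof (intro exI[of _ "smult a ([:1, 1:] ^ 11)"] allI impI, elim conjE)
    fix n :: nat and l' :: "(nat \<Rightarrow> real) \<Rightarrow> real" and \<epsilon> :: real
    assume n: "2 \<le> n" and Q: "Q'_norm n l'" and \<epsilon>: "0 < \<epsilon>" "\<epsilon> \<le> 1 / 2"
    define L where "L = log 2 (real n) / \<epsilon>"
    \<comment> \<open>Since \<open>log 2 n \<ge> 1\<close> and
      \<open>1 / \<epsilon> \<ge> 2\<close>, the quotient \<open>L\<close> dominates both
      quantities, so one integer can serve as a bound for each.\<close>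
    define h where "h = nat \<lceil>L\<rceil>"
    have log: "1 \<le> log 2 (real n)" using n by (simp add: le_log_iff)
    have "2 * 1 \<le> (1 / \<epsilon>) * log 2 (real n)"
      using \<epsilon> log by (intro mult_mono) (auto simp: field_simps)
    then have L2: "2 \<le> L" by (simp add: L_def)
    have Lh: "L \<le> real h" by (simp add: h_def of_nat_ceiling)
    have hL: "real h \<le> 1 + L" using L2 unfolding h_def by linarith
    have "1 / \<epsilon> \<le> L" using log \<epsilon> by (simp add: L_def divide_right_mono)
    then have "1 / \<epsilon> \<le> real h" using Lh by linarith
    then have "1 / real h \<le> \<epsilon>" using Lh L2 \<epsilon> by (simp add: field_simps)
    have "log 2 (real n) * 1 \<le> log 2 (real n) * (1 / \<epsilon>)" using \<epsilon> log by (intro mult_left_mono) auto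
    then have "log 2 (real n) \<le> real h" using Lh by (simp add: L_def)
    then have nh: "real n \<le> 2 ^ h" using n by (simp add: log_le_iff powr_realpow)
    then have "n \<le> 2 ^ h" by (metis of_nat_le_iff of_nat_numeral of_nat_power)
    have "2 \<le> h" "0 < n" using Lh L2 n by linarith+
    obtain A s where A: "space_bounded n s A" "real s \<le> a * real h ^ 11"
      "\<And>us. turnstile_stream n us \<Longrightarrow> (\<And>i. i < n \<Longrightarrow> \<bar>stream_vec us i\<bar> \<le> 2 ^ (c * h)) \<Longrightarrow>
       99 / 100 \<le> measure_pmf.prob (run_alg A l' us)
         {z. is_D_approx (1 + \<epsilon>) (l' (\<lambda>i. real_of_int (stream_vec us i))) z}"
      unfolding a_def using streaming_alg_polynomial_space[OF Q \<open>0 < n\<close> \<open>n \<le> 2 ^ h\<close> \<open>2 \<le> h\<close> \<open>1 / real h \<le> \<epsilon>\<close> \<epsilon>(2), of c]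
      by blast
    have powr: "real n powr C\<^sub>0 \<le> 2 ^ (c * h)"
    proof -
      have "real n powr C\<^sub>0 \<le> real n powr real c" using n c by (intro powr_mono) auto
      also have "\<dots> = real n ^ c" using n by (simp add: powr_realpow)
      also have "\<dots> \<le> (2 ^ h) ^ c" using nh by (intro power_mono) auto
      finally show ?thesis by (simp add: power_mult mult.commute[of c])
    qed
    show "\<exists>A s. space_bounded n s A \<and> real s \<le> poly (smult a ([:1, 1:] ^ 11)) (log 2 (real n) / \<epsilon>) \<and>
      (\<forall>us. turnstile_stream n us \<and> (\<forall>i<n. \<bar>real_of_int (stream_vec us i)\<bar> \<le> real n powr C\<^sub>0) \<longrightarrow>
         0.99 \<le> measure_pmf.prob (run_alg A l' us)
           {z. is_D_approx (1 + \<epsilon>) (l' (\<lambda>i. real_of_int (stream_vec us i))) z})"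
    proof (intro exI conjI allI impI)
      show "space_bounded n s A" by (rule A(1))
      have "a * real h ^ 11 \<le> a * (1 + L) ^ 11" using a hL by (intro mult_left_mono power_mono) auto
      then show "real s \<le> poly (smult a ([:1, 1:] ^ 11)) (log 2 (real n) / \<epsilon>)"
        using A(2) by (simp add: L_def)
      fix us
      assume us: "turnstile_stream n us \<and> (\<forall>i<n. \<bar>real_of_int (stream_vec us i)\<bar> \<le> real n powr C\<^sub>0)"
      have "\<bar>stream_vec us i\<bar> \<le> 2 ^ (c * h)" if "i < n" for i
      proof -
        have "real_of_int \<bar>stream_vec us i\<bar> \<le> real_of_int (2 ^ (c * h))"
          using us that powr by fastforce
        then show ?thesis by (simp only: of_int_le_iff)
      qed
      then show "0.99 \<le> measure_pmf.prob (run_alg A l' us)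
           {z. is_D_approx (1 + \<epsilon>) (l' (\<lambda>i. real_of_int (stream_vec us i))) z}"
        using A(3)[of us] us by simp
    qed
  qed
qed

end
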